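(* Let $n\geq 2$. There exist constants $D_k>0$, $k=1,2,3,\dots$ (depending only on $n$ and $k$), such that for every smooth $SO(n)$-invariant Riemannian metric $g$ on the sphere $\mathbb{S}^n$ with unit volume and non-negative scalar curvature, and for every $k\geq 1$, $$\lambda_k^{SO(n)}(g)\leq D_k.$$
   Context: The group $SO(n)$ acts on $\mathbb{S}^n\subset\mathbb{R}^{n+1}$ through the embedding $SO(n)\to SO(n+1)$, $A\mapsto\begin{pmatrix}1&0\\0&A\end{pmatrix}$, and the standard linear action of $SO(n+1)$ on $\mathbb{R}^{n+1}$. For a compact Riemannian manifold $(M,g)$ and a group $G$ of isometries of $g$, the $G$-invariant spectrum is the spectrum of the ordinary (non-negative) Laplacian restricted to $G$-invariant functions. Its eigenvalues, counted with multiplicity, are written $0=\lambda_0^G(g)<\lambda_1^G(g)\leq\lambda_2^G(g)\leq\cdots$. Equivalently, $\lambda_k^G(g)$ is the minimum over all $(k+1)$-dimensional subspaces $V$ of the $G$-invariant functions in $W^{1,2}(M)$ of $\sup_{0\neq\varphi\in V}\frac{\int_M|\nabla\varphi|^2\,dV_g}{\int_M\varphi^2\,dV_g}$. *)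

theory Defs
  imports "HOL-Analysis.Analysis"
begin

text \<open>
  With \<open>n = CARD('n)\<close>, the space $\mathbb{R}^{n+1}$ is rendered as \<^typ>\<open>real \<times> real ^ 'n\<close>, whose norm
  is Euclidean; \<open>SO(n)\<close> acts on the second factor and fixes the first coordinate.
\<close>

type_synonym 'n space = "real \<times> (real ^ 'n)"

abbreviation unit_sphere :: "'n::finite space set" where
  "unit_sphere \<equiv> sphere 0 1"

definition special_orthogonal :: "(real ^ 'n ^ 'n) set" where
  "special_orthogonal = {A. orthogonal_matrix A \<and> det A = 1}"

definition so_act :: "real ^ 'n ^ 'n \<Rightarrow> 'n space \<Rightarrow> 'n::finite space" where
  "so_act A p = (fst p, A *v snd p)"

definition tangent_space :: "'n::finite space \<Rightarrow> 'n space set" where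
  "tangent_space p = {v. v \<bullet> p = 0}"


subsection \<open>Smooth maps and local parametrizations\<close>

text \<open>Only meant for open \<open>U\<close>.\<close>

primrec C_on :: "nat \<Rightarrow> ('a::euclidean_space \<Rightarrow> 'b::real_normed_vector) \<Rightarrow> 'a set \<Rightarrow> bool" where
  "C_on 0 f U \<longleftrightarrow> continuous_on U f"
| "C_on (Suc k) f U \<longleftrightarrow>
     f differentiable_on U \<and> (\<forall>v. C_on k (\<lambda>x. frechet_derivative f (at x) v) U)"

definition smooth_on :: "'a::euclidean_space set \<Rightarrow> ('a \<Rightarrow> 'b::real_normed_vector) \<Rightarrow> bool" where
  "smooth_on U f \<longleftrightarrow> (\<forall>k. C_on k f U)"

definition partial :: "'n::finite \<Rightarrow> (real ^ 'n \<Rightarrow> 'b::real_normed_vector) \<Rightarrow> real ^ 'n \<Rightarrow> 'b" where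
  "partial i f u = frechet_derivative f (at u) (axis i 1)"

text \<open>
  Injective immersions of open subsets of $\mathbb{R}^n$ into the \<open>n\<close>-dimensional sphere. By the inverse
  function theorem these are exactly the inverses of the charts of the maximal smooth atlas.
\<close>

definition local_param :: "(real ^ 'n) set \<Rightarrow> (real ^ 'n \<Rightarrow> 'n::finite space) \<Rightarrow> bool" where
  "local_param U \<psi> \<longleftrightarrow> open U \<and> smooth_on U \<psi> \<and> \<psi> ` U \<subseteq> unit_sphere \<and> inj_on \<psi> U \<and>
     (\<forall>u\<in>U. inj (frechet_derivative \<psi> (at u)))"


subsection \<open>Riemannian metrics on the sphere\<close>

text \<open>\<open>g p v w\<close> is only relevant for \<open>p\<close> on the sphere and \<open>v\<close>, \<open>w\<close> tangent at \<open>p\<close>.\<close>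

type_synonym 'n metric_field = "'n space \<Rightarrow> 'n space \<Rightarrow> 'n space \<Rightarrow> real"

definition gram :: "'n metric_field \<Rightarrow> (real ^ 'n \<Rightarrow> 'n::finite space) \<Rightarrow> real ^ 'n \<Rightarrow> real ^ 'n ^ 'n" where
  "gram g \<psi> u = (\<chi> i j. g (\<psi> u) (partial i \<psi> u) (partial j \<psi> u))"

definition riemannian_metric :: "'n::finite metric_field \<Rightarrow> bool" where
  "riemannian_metric g \<longleftrightarrow>
     (\<forall>p\<in>unit_sphere. \<forall>u\<in>tangent_space p. \<forall>v\<in>tangent_space p. \<forall>w\<in>tangent_space p. \<forall>c.
        g p v w = g p w v \<and>
        g p (u + v) w = g p u w + g p v w \<and>
        g p (c *\<^sub>R v) w = c * g p v w \<and>
        (v \<noteq> 0 \<longrightarrow> 0 < g p v v)) \<and>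
     (\<forall>U \<psi>. local_param U \<psi> \<longrightarrow> (\<forall>i j. smooth_on U (\<lambda>u. gram g \<psi> u $ i $ j)))"

definition so_invariant_metric :: "'n::finite metric_field \<Rightarrow> bool" where
  "so_invariant_metric g \<longleftrightarrow>
     (\<forall>A\<in>special_orthogonal. \<forall>p\<in>unit_sphere. \<forall>v\<in>tangent_space p. \<forall>w\<in>tangent_space p.
        g (so_act A p) (so_act A v) (so_act A w) = g p v w)"


subsection \<open>Scalar curvature\<close>

definition christoffel ::
    "'n::finite metric_field \<Rightarrow> (real ^ 'n \<Rightarrow> 'n space) \<Rightarrow> 'n \<Rightarrow> 'n \<Rightarrow> 'n \<Rightarrow> real ^ 'n \<Rightarrow> real" where
  "christoffel g \<psi> k i j u =
     (\<Sum>l\<in>UNIV. matrix_inv (gram g \<psi> u) $ k $ l *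
        (partial i (\<lambda>x. gram g \<psi> x $ j $ l) u + partial j (\<lambda>x. gram g \<psi> x $ i $ l) u
          - partial l (\<lambda>x. gram g \<psi> x $ i $ j) u)) / 2"

definition ricci ::
    "'n::finite metric_field \<Rightarrow> (real ^ 'n \<Rightarrow> 'n space) \<Rightarrow> 'n \<Rightarrow> 'n \<Rightarrow> real ^ 'n \<Rightarrow> real" where
  "ricci g \<psi> i j u =
     (\<Sum>k\<in>UNIV. partial k (christoffel g \<psi> k i j) u - partial j (christoffel g \<psi> k i k) u
        + (\<Sum>l\<in>UNIV. christoffel g \<psi> k k l u * christoffel g \<psi> l i j u
                  - christoffel g \<psi> k j l u * christoffel g \<psi> l i k u))"

definition scalar_curvature ::
    "'n::finite metric_field \<Rightarrow> (real ^ 'n \<Rightarrow> 'n space) \<Rightarrow> real ^ 'n \<Rightarrow> real" where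
  "scalar_curvature g \<psi> u =
     (\<Sum>i\<in>UNIV. \<Sum>j\<in>UNIV. matrix_inv (gram g \<psi> u) $ i $ j * ricci g \<psi> i j u)"

text \<open>
  The value of the scalar curvature at \<open>\<psi> u\<close> does not depend on the parametrization, so this is the
  pointwise condition on the sphere.
\<close>

definition nonneg_scalar_curvature :: "'n::finite metric_field \<Rightarrow> bool" where
  "nonneg_scalar_curvature g \<longleftrightarrow>
     (\<forall>U \<psi>. local_param U \<psi> \<longrightarrow> (\<forall>u\<in>U. 0 \<le> scalar_curvature g \<psi> u))"


subsection \<open>Riemannian volume measure\<close>

text \<open>
  Inverse stereographic projection from the pole \<open>(1, 0)\<close>. It parametrizes the sphere up to that
  single point, which is a null set, so the Riemannian volume measure is the image of
  $\sqrt{\det (g_{ij})}\,du$ under it.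
\<close>

definition stereo :: "real ^ 'n \<Rightarrow> 'n::finite space" where
  "stereo u = (((norm u)\<^sup>2 - 1) / ((norm u)\<^sup>2 + 1), (2 / ((norm u)\<^sup>2 + 1)) *\<^sub>R u)"

definition vol :: "'n::finite metric_field \<Rightarrow> 'n space measure" where
  "vol g = distr (density lborel (\<lambda>u. ennreal (sqrt (det (gram g stereo u)))))
             (restrict_space borel unit_sphere) stereo"


subsection \<open>The Sobolev space and the invariant eigenvalues\<close>

definition test_function :: "(real ^ 'n::finite) set \<Rightarrow> (real ^ 'n \<Rightarrow> real) \<Rightarrow> bool" where
  "test_function U \<eta> \<longleftrightarrow> smooth_on UNIV \<eta> \<and>
     compact (closure {u. \<eta> u \<noteq> 0}) \<and> closure {u. \<eta> u \<noteq> 0} \<subseteq> U"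

text \<open>
  Square integrable vector fields \<open>X\<close> for which, in every parametrization, the covector components
  $g(X, \partial_i\psi)$ are the weak partial derivatives of $\varphi \circ \psi$. For \<open>\<phi>\<close> in $L^2$ such a
  field is unique almost everywhere.
\<close>

definition weak_gradients ::
    "'n::finite metric_field \<Rightarrow> ('n space \<Rightarrow> real) \<Rightarrow> ('n space \<Rightarrow> 'n space) set" where
  "weak_gradients g \<phi> = {X.
     X \<in> borel_measurable (vol g) \<and>
     (\<forall>p\<in>unit_sphere. X p \<in> tangent_space p) \<and>
     (\<integral>\<^sup>+ p. ennreal (g p (X p) (X p)) \<partial>vol g) < \<infinity> \<and>
     (\<forall>U \<psi> \<eta> i. local_param U \<psi> \<and> test_function U \<eta> \<longrightarrow>
        (LINT u:U|lborel. \<phi> (\<psi> u) * partial i \<eta> u) =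
        - (LINT u:U|lborel. g (\<psi> u) (X (\<psi> u)) (partial i \<psi> u) * \<eta> u))}"

text \<open>Elements of $W^{1,2}$ are represented by functions, not by classes modulo null functions.\<close>

definition W12 :: "'n::finite metric_field \<Rightarrow> ('n space \<Rightarrow> real) set" where
  "W12 g = {\<phi>. \<phi> \<in> borel_measurable (vol g) \<and>
     (\<integral>\<^sup>+ p. ennreal ((\<phi> p)\<^sup>2) \<partial>vol g) < \<infinity> \<and> weak_gradients g \<phi> \<noteq> {}}"

definition W12_invariant :: "'n::finite metric_field \<Rightarrow> ('n space \<Rightarrow> real) set" where
  "W12_invariant g =
     {\<phi> \<in> W12 g. \<forall>A\<in>special_orthogonal. AE p in vol g. \<phi> (so_act A p) = \<phi> p}"

text \<open>
  The infimum ranges over a single value, because any two weak gradients agree almost everywhere;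
  it only serves to select one.
\<close>

definition dirichlet_energy :: "'n::finite metric_field \<Rightarrow> ('n space \<Rightarrow> real) \<Rightarrow> ennreal" where
  "dirichlet_energy g \<phi> = (INF X \<in> weak_gradients g \<phi>. \<integral>\<^sup>+ p. ennreal (g p (X p) (X p)) \<partial>vol g)"

definition rayleigh_quotient :: "'n::finite metric_field \<Rightarrow> ('n space \<Rightarrow> real) \<Rightarrow> ennreal" where
  "rayleigh_quotient g \<phi> = dirichlet_energy g \<phi> / (\<integral>\<^sup>+ p. ennreal ((\<phi> p)\<^sup>2) \<partial>vol g)"

text \<open>
  A \<open>(k+1)\<close>-dimensional subspace of the invariant part of $W^{1,2}$ is given by a basis
  \<open>\<phi> 0, \<dots>, \<phi> k\<close>, where linear independence is understood modulo null functions.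
\<close>

definition invariant_basis :: "'n::finite metric_field \<Rightarrow> nat \<Rightarrow> (nat \<Rightarrow> 'n space \<Rightarrow> real) \<Rightarrow> bool" where
  "invariant_basis g k \<phi> \<longleftrightarrow>
     (\<forall>i\<le>k. \<phi> i \<in> W12_invariant g) \<and>
     (\<forall>c. (AE p in vol g. (\<Sum>i\<le>k. c i * \<phi> i p) = 0) \<longrightarrow> (\<forall>i\<le>k. c i = 0))"

text \<open>
  The \<open>k\<close>-th eigenvalue of the Laplacian on invariant functions, counted with multiplicity from
  \<open>k = 0\<close>, by the min-max principle. With values in \<^typ>\<open>ennreal\<close> neither the infimum nor the
  supremum can degenerate to an unspecified value.
\<close>

definition invariant_eigenvalue :: "'n::finite metric_field \<Rightarrow> nat \<Rightarrow> ennreal" where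
  "invariant_eigenvalue g k =
     (INF \<phi> \<in> {\<phi>. invariant_basis g k \<phi>}.
        SUP c \<in> {c. \<exists>i\<le>k. c i \<noteq> 0}. rayleigh_quotient g (\<lambda>p. \<Sum>i\<le>k. c i * \<phi> i p))"

end

theory Submission imports Defs begin

text \<open>
  In the stereographic chart the orbit at radius \<open>r\<close> is a round sphere of radius \<open>f\<close>, so the metric
  is \<open>ds\<^sup>2 + f\<^sup>2 d\<sigma>\<^sup>2\<close> for the arc length \<open>s\<close> orthogonal to the orbits. The scalar curvature is
  \<open>- 2 (n - 1) f'' / f + (n - 1) (n - 2) (1 - f'\<^sup>2) / f\<^sup>2\<close>. If it is non-negative, then \<open>f'' \<le> 0\<close>
  wherever \<open>f' > 1\<close>; as smoothness at the pole forces \<open>f' = 1\<close> there, \<open>f' \<le> 1\<close> everywhere. Let \<open>y\<close> be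
  the enclosed volume divided by the volume of the unit sphere in $\mathbb{R}^n$. Then
  \<open>dy = f\<^bsup>n - 1\<^esup> ds\<close>, hence \<open>f\<^sup>n \<le> n y\<close> is bounded in terms of \<open>n\<close> alone, because the total volume is \<open>1\<close>. For a
  function \<open>h\<close> of \<open>y\<close> the Rayleigh quotient is the quotient of the integrals of \<open>(f\<^bsup>n - 1\<^esup> h')\<^sup>2\<close> and
  \<open>h\<^sup>2\<close> with respect to \<open>dy\<close>. So \<open>k + 1\<close> fixed functions with disjoint supports away from the ends,
  hence away from the poles, bound the \<open>k\<close>-th eigenvalue.
\<close>

subsection \<open>Calculus of smooth maps\<close>

text \<open>Unit volume makes the bound uniform: \<open>y\<close> runs over the same interval
  \<open>[0, 1 / ball_const]\<close> for every metric, and the L2 norm in \<open>y\<close> carries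
  no trace of the metric. The single quantity left to control is the factor
  \<open>f ^ (2 * (n - 1))\<close> in the energy. The slope bound that controls it propagates from
  the pole \<open>u = 0\<close> alone; the other pole lies at infinity of the chart.

  The obstacle is dimension two. SO(2) contains no reflections, so the radial direction of the chart
  need not be orthogonal to the orbits and a cross term \<open>cF\<close> survives. Hence the
  curvature is computed twice, in polar coordinates for a surface and in the shape a delta_ij + b
  u_i u_j for n >= 3, and both computations feed one function \<open>slope\<close>. Arc length is
  never introduced as a coordinate: everything is a function of the stereographic radius, with ds/dr
  written through \<open>disc\<close>.

  On the sphere the test functions are C1 functions of the first coordinate, so that they can be
  pulled back along every parametrization, the poles included.\<close>

lemma has_derivative_cong_open:
  assumes "open U" "u \<in> U" "\<And>x. x \<in> U \<Longrightarrow> f x = g x"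
  shows "(f has_derivative D) (at u) \<longleftrightarrow> (g has_derivative D) (at u)"
  using has_derivative_transform_within_open[OF _ assms(1,2), of f D UNIV g]
    has_derivative_transform_within_open[OF _ assms(1,2), of g D UNIV f] assms(3) by metis

lemma frechet_derivative_cong_open:
  assumes "open U" "u \<in> U" "\<And>x. x \<in> U \<Longrightarrow> f x = g x"
  shows "frechet_derivative f (at u) = frechet_derivative g (at u)"
  using has_derivative_cong_open[OF assms] unfolding frechet_derivative_def by presburger

lemma differentiable_on_cong_open:
  assumes "open U" "\<And>x. x \<in> U \<Longrightarrow> f x = g x"
  shows "f differentiable_on U \<longleftrightarrow> g differentiable_on U"
proof -
  have "(f has_derivative D) (at u) = (g has_derivative D) (at u)" if "u \<in> U" for D u
    by (rule has_derivative_cong_open[OF assms(1) that assms(2)])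
  then show ?thesis
    using assms(1) by (simp add: differentiable_on_eq_differentiable_at differentiable_def)
qed

lemma C_on_cong:
  assumes "open U" "\<And>x. x \<in> U \<Longrightarrow> f x = g x"
  shows "C_on k f U \<longleftrightarrow> C_on k g U"
  using assms(2)
proof (induction k arbitrary: f g)
  case 0
  then show ?case by (simp cong: continuous_on_cong)
next
  case (Suc k)
  have "C_on k (\<lambda>x. frechet_derivative f (at x) v) U = C_on k (\<lambda>x. frechet_derivative g (at x) v) U" for v
    by (rule Suc.IH) (simp add: frechet_derivative_cong_open[OF assms(1) _ Suc.prems])
  then show ?case using differentiable_on_cong_open[OF assms(1) Suc.prems] by simp
qed

text \<open>\<open>C_on\<close> is stated with the chosen \<open>frechet_derivative\<close>; on an
  open set any explicit formula for the derivative may take its place.\<close>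

lemma C_on_SucI:
  assumes "open U" "\<And>x. x \<in> U \<Longrightarrow> (f has_derivative D x) (at x)" "\<And>v. C_on k (\<lambda>x. D x v) U"
  shows "C_on (Suc k) f U"
proof -
  have "frechet_derivative f (at x) = D x" if "x \<in> U" for x
    using frechet_derivative_at[OF assms(2)[OF that]] by simp
  then have "C_on k (\<lambda>x. frechet_derivative f (at x) v) U" for v
    using assms(3)[of v] C_on_cong[OF assms(1), of "\<lambda>x. frechet_derivative f (at x) v" "\<lambda>x. D x v"] by simp
  moreover have "f differentiable_on U"
    using assms(1,2) by (auto simp: differentiable_on_eq_differentiable_at differentiable_def)
  ultimately show ?thesis by simp
qed

lemma C_on_SucD:
  assumes "open U" "C_on (Suc k) f U" "x \<in> U"
  shows "(f has_derivative frechet_derivative f (at x)) (at x)"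
  using assms by (simp add: differentiable_on_eq_differentiable_at frechet_derivative_works)

lemma C_on_const: "open U \<Longrightarrow> C_on k (\<lambda>_. c) U"
proof (induction k arbitrary: c)
  case 0 then show ?case by simp
next
  case (Suc k)
  show ?case by (rule C_on_SucI[OF Suc.prems has_derivative_const]) (rule Suc.IH[OF Suc.prems])
qed

lemma C_on_subset: "C_on k f U \<Longrightarrow> open U \<Longrightarrow> open V \<Longrightarrow> V \<subseteq> U \<Longrightarrow> C_on k f V"
proof (induction k arbitrary: f)
  case 0 then show ?case by (auto intro: continuous_on_subset)
next
  case (Suc k) then show ?case by (auto intro: differentiable_on_subset)
qed

lemma C_on_lower: "open U \<Longrightarrow> C_on (Suc k) f U \<Longrightarrow> C_on k f U"
proof (induction k arbitrary: f)
  case 0 then show ?case by (auto intro: differentiable_imp_continuous_on)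
next
  case (Suc k)
  then have "C_on (Suc k) (\<lambda>x. frechet_derivative f (at x) v) U" for v by simp
  then have "C_on k (\<lambda>x. frechet_derivative f (at x) v) U" for v
    by (rule Suc.IH[OF Suc.prems(1)])
  then show ?case using Suc.prems by simp
qed

lemma C_on_linear:
  assumes "bounded_linear L" "open U" "C_on k f U"
  shows "C_on k (\<lambda>x. L (f x)) U"
  using assms(3)
proof (induction k arbitrary: f)
  case 0
  then show ?case using bounded_linear.continuous_on[OF assms(1)] by auto
next
  case (Suc k)
  show ?case
  proof (rule C_on_SucI[OF assms(2)])
    show "((\<lambda>x. L (f x)) has_derivative (\<lambda>v. L (frechet_derivative f (at x) v))) (at x)" if "x \<in> U" for x
      using bounded_linear.has_derivative[OF assms(1) C_on_SucD[OF assms(2) Suc.prems that]] .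
    show "C_on k (\<lambda>x. L (frechet_derivative f (at x) v)) U" for v
      using Suc by simp
  qed
qed

lemma C_on_linear_id: "bounded_linear L \<Longrightarrow> open U \<Longrightarrow> C_on k L U"
proof (cases k)
  case (Suc m)
  assume "bounded_linear L" "open U"
  then show ?thesis
    unfolding Suc by (intro C_on_SucI[OF _ bounded_linear_imp_has_derivative] C_on_const)
qed (simp add: linear_continuous_on)

lemma C_on_add:
  assumes "open U" "C_on k f U" "C_on k g U"
  shows "C_on k (\<lambda>x. f x + g x) U"
  using assms(2,3)
proof (induction k arbitrary: f g)
  case 0 then show ?case by (auto intro: continuous_on_add)
next
  case (Suc k)
  show ?case
  proof (rule C_on_SucI[OF assms(1)])
    show "((\<lambda>x. f x + g x) has_derivative
        (\<lambda>v. frechet_derivative f (at x) v + frechet_derivative g (at x) v)) (at x)" if "x \<in> U" for x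
      by (intro has_derivative_add C_on_SucD[OF assms(1) Suc.prems(1) that] C_on_SucD[OF assms(1) Suc.prems(2) that])
  qed (use Suc in simp)
qed

lemma C_on_sum:
  assumes "open U" "\<And>i. i \<in> I \<Longrightarrow> C_on k (f i) U"
  shows "C_on k (\<lambda>x. \<Sum>i\<in>I. f i x) U"
  using assms(2)
  by (induction I rule: infinite_finite_induct) (auto intro: C_on_const C_on_add assms(1))

lemma C_on_bilinear:
  assumes "bounded_bilinear B" "open U" "C_on k f U" "C_on k g U"
  shows "C_on k (\<lambda>x. B (f x) (g x)) U"
  using assms(3,4)
proof (induction k arbitrary: f g)
  case 0 then show ?case using bounded_bilinear.continuous_on[OF assms(1)] by auto
next
  case (Suc k)
  show ?case
  proof (rule C_on_SucI[OF assms(2)])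
    show "((\<lambda>x. B (f x) (g x)) has_derivative
       (\<lambda>v. B (f x) (frechet_derivative g (at x) v) + B (frechet_derivative f (at x) v) (g x))) (at x)"
      if "x \<in> U" for x
      by (intro bounded_bilinear.FDERIV[OF assms(1)] C_on_SucD[OF assms(2) Suc.prems(1) that]
        C_on_SucD[OF assms(2) Suc.prems(2) that])
    show "C_on k (\<lambda>x. B (f x) (frechet_derivative g (at x) v) + B (frechet_derivative f (at x) v) (g x)) U" for v
      using Suc.prems C_on_lower[OF assms(2) Suc.prems(1)] C_on_lower[OF assms(2) Suc.prems(2)]
      by (intro C_on_add[OF assms(2)] Suc.IH) auto
  qed
qed

lemmas C_on_mult = C_on_bilinear[OF bounded_bilinear_mult]
lemmas C_on_scaleR = C_on_bilinear[OF bounded_bilinear_scaleR]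
lemmas C_on_inner = C_on_bilinear[OF bounded_bilinear_inner]

lemma C_on_compose:
  fixes f :: "'a::euclidean_space \<Rightarrow> 'b::euclidean_space" and g :: "'b \<Rightarrow> 'c::real_normed_vector"
  assumes "open U" "open V" "f ` U \<subseteq> V" "C_on k f U" "C_on k g V"
  shows "C_on k (\<lambda>x. g (f x)) U"
  using assms(4,5)
proof (induction k arbitrary: g)
  case 0 then show ?case using assms(3) by (auto intro: continuous_on_compose2)
next
  case (Suc k)
  let ?Df = "\<lambda>x. frechet_derivative f (at x)" and ?Dg = "\<lambda>x. frechet_derivative g (at x)"
  show ?case
  proof (rule C_on_SucI[OF assms(1)])
    fix x assume x: "x \<in> U"
    then have fx: "f x \<in> V" using assms(3) by auto
    have "((\<lambda>x. g (f x)) has_derivative (\<lambda>v. ?Dg (f x) (?Df x v))) (at x)"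
      using diff_chain_at[OF C_on_SucD[OF assms(1) Suc.prems(1) x] C_on_SucD[OF assms(2) Suc.prems(2) fx]]
      by (simp add: o_def)
    \<comment> \<open>\<open>C_on\<close> only speaks of derivatives in a fixed direction, whereas
      here the direction \<open>?Df x v\<close> moves with \<open>x\<close>. Expanding it in the
      basis leaves a sum of products of derivatives in fixed directions.\<close>
    moreover have "?Dg (f x) (?Df x v) = (\<Sum>b\<in>Basis. (?Df x v \<bullet> b) *\<^sub>R ?Dg (f x) b)" for v
    proof -
      have lin: "linear (?Dg (f x))" by (rule has_derivative_linear[OF C_on_SucD[OF assms(2) Suc.prems(2) fx]])
      have "?Dg (f x) (?Df x v) = ?Dg (f x) (\<Sum>b\<in>Basis. (?Df x v \<bullet> b) *\<^sub>R b)"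
        by (simp add: euclidean_representation)
      also have "\<dots> = (\<Sum>b\<in>Basis. (?Df x v \<bullet> b) *\<^sub>R ?Dg (f x) b)"
        by (simp add: linear_sum[OF lin] linear_scale[OF lin])
      finally show ?thesis .
    qed
    ultimately show "((\<lambda>x. g (f x)) has_derivative (\<lambda>v. \<Sum>b\<in>Basis. (?Df x v \<bullet> b) *\<^sub>R ?Dg (f x) b)) (at x)"
      by simp
  next
    fix v
    have f: "C_on k f U" by (rule C_on_lower[OF assms(1) Suc.prems(1)])
    have "C_on k (\<lambda>x. ?Dg (f x) b) U" for b
      by (rule Suc.IH[OF f]) (use Suc.prems in simp)
    moreover have "C_on k (\<lambda>x. ?Df x v) U" using Suc.prems by simp
    ultimately show "C_on k (\<lambda>x. \<Sum>b\<in>Basis. (?Df x v \<bullet> b) *\<^sub>R ?Dg (f x) b) U"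
      by (intro C_on_sum C_on_scaleR C_on_inner C_on_const assms(1))
  qed
qed

lemma C_on_real_SucI:
  fixes f :: "real \<Rightarrow> real"
  assumes "open U" "\<And>x. x \<in> U \<Longrightarrow> (f has_real_derivative D x) (at x)" "C_on k D U"
  shows "C_on (Suc k) f U"
  using assms(2) by (intro C_on_SucI[OF assms(1), of f "\<lambda>x v. D x * v"] C_on_mult C_on_const assms(1,3))
    (auto simp: has_field_derivative_def)

lemma C_on_inverse: "C_on k (inverse :: real \<Rightarrow> real) {x. x \<noteq> 0}"
proof (induction k)
  case 0 show ?case by (auto intro!: continuous_intros)
next
  case (Suc k)
  have op: "open {x::real. x \<noteq> 0}" by (simp add: open_Collect_neq)
  show ?case
    using C_on_linear[OF bounded_linear_minus[OF bounded_linear_ident] op C_on_mult[OF op Suc Suc]]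
    by (intro C_on_real_SucI[OF op, of _ "\<lambda>x. - (inverse x * inverse x)"])
      (auto intro!: derivative_eq_intros simp: power2_eq_square)
qed

lemma C_on_sin_cos: "C_on k (sin :: real \<Rightarrow> real) UNIV \<and> C_on k (cos :: real \<Rightarrow> real) UNIV"
proof (induction k)
  case 0 show ?case by (auto intro!: continuous_intros)
next
  case (Suc k)
  have "C_on (Suc k) (sin :: real \<Rightarrow> real) UNIV"
    using Suc by (intro C_on_real_SucI[of _ _ cos]) (auto intro!: derivative_eq_intros)
  moreover have "C_on (Suc k) (cos :: real \<Rightarrow> real) UNIV"
    using Suc C_on_linear[OF bounded_linear_minus[OF bounded_linear_ident] open_UNIV, of k "sin :: real \<Rightarrow> real"]
    by (intro C_on_real_SucI[of _ _ "\<lambda>x. - sin x"]) (auto intro!: derivative_eq_intros)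
  ultimately show ?case ..
qed

lemma C_on_Pair:
  assumes "open U" "C_on k f U" "C_on k g U"
  shows "C_on k (\<lambda>x. (f x, g x)) U"
proof -
  have "C_on k (\<lambda>x. (f x, 0) + (0, g x)) U"
    using assms by (intro C_on_add C_on_linear[of "\<lambda>y. (y, 0)"] C_on_linear[of "\<lambda>y. (0, y)"]
      bounded_linear_Pair bounded_linear_zero bounded_linear_ident) auto
  then show ?thesis by simp
qed

lemma C_on_real_derivs:
  fixes f :: "real \<Rightarrow> real"
  assumes "\<And>k. C_on k f UNIV"
  obtains f' where "\<And>x. (f has_real_derivative f' x) (at x)" "\<And>k. C_on k f' UNIV"
proof
  fix x
  have *: "(f has_derivative frechet_derivative f (at x)) (at x)"
    using C_on_SucD[OF open_UNIV assms[of 1, unfolded One_nat_def]] by simp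
  then show "(f has_real_derivative frechet_derivative f (at x) 1) (at x)"
    unfolding has_field_derivative_def
    by (metis (no_types, lifting) ext has_derivative_linear linear_scale mult.right_neutral mult.commute real_scaleR_def)
next
  show "C_on k (\<lambda>x. frechet_derivative f (at x) 1) UNIV" for k
    using assms[of "Suc k"] by simp
qed

subsection \<open>The stereographic chart\<close>

definition dstereo :: "real ^ 'n \<Rightarrow> real ^ 'n \<Rightarrow> 'n::finite space" where
  "dstereo u w = (4 * (u \<bullet> w) / (u \<bullet> u + 1)\<^sup>2,
     (2 / (u \<bullet> u + 1)) *\<^sub>R w - (4 * (u \<bullet> w) / (u \<bullet> u + 1)\<^sup>2) *\<^sub>R u)"

definition stereo_inv :: "'n::finite space \<Rightarrow> real ^ 'n" where
  "stereo_inv p = (1 / (1 - fst p)) *\<^sub>R snd p"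

text \<open>The inner product form is rational in the coordinates, so that the derivative rules
  apply at \<open>u = 0\<close> too.\<close>

lemma stereo_inner: "stereo u = ((u \<bullet> u - 1) / (u \<bullet> u + 1), (2 / (u \<bullet> u + 1)) *\<^sub>R u)"
  by (simp add: stereo_def power2_norm_eq_inner)

lemma inner_plus_1_pos [simp]: "0 < u \<bullet> u + 1" for u :: "'a::real_inner"
  by (simp add: add_nonneg_pos)

lemma inner_plus_1_neq [simp]: "u \<bullet> u + 1 \<noteq> 0" for u :: "'a::real_inner"
  using inner_plus_1_pos[of u] by linarith

lemma inner_plus_1_neq' [simp]: "1 + u \<bullet> u \<noteq> 0" for u :: "'a::real_inner"
  using inner_plus_1_pos[of u] by linarith

lemma stereo_has_derivative: "(stereo has_derivative dstereo u) (at u)"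
proof -
  have "((\<lambda>u. ((u \<bullet> u - 1) / (u \<bullet> u + 1), (2 / (u \<bullet> u + 1)) *\<^sub>R u)) has_derivative dstereo u) (at u)"
    by (rule derivative_eq_intros refl inner_plus_1_neq)+
      (simp add: dstereo_def fun_eq_iff prod_eq_iff inner_commute power2_eq_square
        diff_divide_distrib add_divide_distrib algebra_simps,
       simp add: field_simps)
  then show ?thesis unfolding stereo_inner[abs_def] .
qed

lemma stereo_smooth: "smooth_on UNIV (stereo :: real ^ 'n \<Rightarrow> 'n::finite space)"
proof -
  have op: "open {x::real. x \<noteq> 0}" by (simp add: open_Collect_neq)
  have q: "C_on k (\<lambda>u. u \<bullet> u :: real) (UNIV :: (real ^ 'n) set)" for k
    by (intro C_on_inner C_on_linear_id) auto
  have q1: "C_on k (\<lambda>u. u \<bullet> u + c :: real) (UNIV :: (real ^ 'n) set)" for k c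
    by (intro C_on_add C_on_const q) auto
  have inv: "C_on k (\<lambda>u. inverse (u \<bullet> u + 1) :: real) (UNIV :: (real ^ 'n) set)" for k
    by (rule C_on_compose[OF _ op _ q1 C_on_inverse]) auto
  have "C_on k (\<lambda>u. ((u \<bullet> u + (-1)) * inverse (u \<bullet> u + 1), (2 * inverse (u \<bullet> u + 1)) *\<^sub>R u))
      (UNIV :: (real ^ 'n) set)" for k
    by (intro C_on_Pair C_on_mult C_on_scaleR C_on_const q1 inv C_on_linear_id) auto
  then show ?thesis
    unfolding smooth_on_def stereo_inner[abs_def] by (simp add: divide_inverse)
qed

lemma stereo_in_sphere [simp]: "stereo u \<in> unit_sphere"
proof -
  have "norm (stereo u) ^ 2 = 1"
    unfolding power2_norm_eq_inner stereo_inner inner_prod_def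
    by (simp add: divide_simps) (simp add: power2_eq_square algebra_simps)
  then show ?thesis by (simp add: dist_norm power2_eq_1_iff)
     (metis norm_ge_zero neg_0_le_iff_le not_one_le_zero)
qed

lemma fst_stereo: "fst (stereo u) = (u \<bullet> u - 1) / (u \<bullet> u + 1)"
  by (simp add: stereo_inner)

lemma one_minus_fst_stereo: "1 - fst (stereo u) = 2 / (u \<bullet> u + 1)"
  unfolding fst_stereo using inner_plus_1_neq[of u] by (simp add: divide_simps)

lemma stereo_inv_stereo [simp]: "stereo_inv (stereo u) = u"
proof -
  have *: "1 / (2 / a) * (2 / a) = 1" if "a \<noteq> 0" for a :: real
    using that by simp
  show ?thesis
    unfolding stereo_inv_def one_minus_fst_stereo
    by (simp only: stereo_inner snd_conv scaleR_scaleR *[OF inner_plus_1_neq] scaleR_one)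
qed

lemma inj_stereo: "inj stereo"
  by (rule inj_on_inverseI) (rule stereo_inv_stereo)

lemma unit_sphere_iff: "p \<in> unit_sphere \<longleftrightarrow> fst p * fst p + snd p \<bullet> snd p = 1"
proof -
  have "norm p = 1 \<longleftrightarrow> p \<bullet> p = 1" by (simp add: norm_eq_sqrt_inner)
  then show ?thesis by (simp add: inner_prod_def)
qed

lemma stereo_stereo_inv:
  assumes "p \<in> unit_sphere" "fst p \<noteq> 1"
  shows "stereo (stereo_inv p) = p"
proof -
  obtain x z where p: "p = (x, z)" by (cases p)
  have x: "1 - x \<noteq> 0" and xz: "z \<bullet> z = (1 - x) * (1 + x)"
    using assms(2) assms(1)[unfolded unit_sphere_iff] by (auto simp: p algebra_simps)
  have q: "stereo_inv p \<bullet> stereo_inv p = (1 + x) / (1 - x)"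
    using x by (simp add: stereo_inv_def p xz)
  have e: "(1 + x) / (1 - x) + 1 = 2 / (1 - x)" "(1 + x) / (1 - x) - 1 = 2 * x / (1 - x)"
    using x by (auto simp: field_simps)
  show ?thesis
    using x unfolding stereo_inner q e by (simp add: p stereo_inv_def)
qed

lemma linear_dstereo: "linear (dstereo u)"
  using stereo_has_derivative has_derivative_linear by blast

lemma dstereo_tangent [simp]: "dstereo u w \<in> tangent_space (stereo u)"
  unfolding tangent_space_def dstereo_def stereo_inner inner_prod_def
  by (simp add: inner_diff_left inner_diff_right inner_commute divide_simps)
     (simp add: power2_eq_square algebra_simps)

lemma dstereo_surj:
  assumes "v \<in> tangent_space (stereo u)"
  obtains w where "dstereo u w = v"
proof -
  obtain x z where v: "v = (x, z)" by (cases v)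
  let ?q = "u \<bullet> u"
  have "x * (?q - 1) / (?q + 1) + 2 / (?q + 1) * (u \<bullet> z) = 0"
    using assms by (simp add: tangent_space_def v stereo_inner inner_prod_def inner_commute)
  then have "(x * (?q - 1) + 2 * (u \<bullet> z)) / (?q + 1) = 0"
    by (simp add: add_divide_distrib)
  then have uz: "2 * (u \<bullet> z) = - (x * (?q - 1))" by simp
  \<comment> \<open>Once the first component of \<open>dstereo u w\<close> is known to be
    \<open>x\<close>, the second one can be solved for \<open>w\<close>. Tangency is what makes the
    first component come out as \<open>x\<close>.\<close>
  let ?w = "((?q + 1) / 2) *\<^sub>R (z + x *\<^sub>R u)"
  have "2 * (u \<bullet> ?w) = (?q + 1) / 2 * (2 * (u \<bullet> z) + 2 * x * ?q)"
    by (simp add: inner_add_right field_simps)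
  also have "\<dots> = x * (?q + 1)\<^sup>2 / 2"
    unfolding uz by (simp add: power2_eq_square field_simps)
  finally have "4 * (u \<bullet> ?w) = x * (?q + 1)\<^sup>2" by simp
  then have uw: "4 * (u \<bullet> ?w) / (?q + 1)\<^sup>2 = x" using inner_plus_1_neq[of u] by simp
  have scale: "(2 / a) *\<^sub>R (a / 2) *\<^sub>R y = y" if "a \<noteq> 0" for a and y :: "real ^ 'a"
    using that by simp
  have "dstereo u ?w = (x, z + x *\<^sub>R u - x *\<^sub>R u)"
    unfolding dstereo_def uw scale[OF inner_plus_1_neq[of u]] ..
  then have "dstereo u ?w = v" by (simp add: v)
  then show thesis by (rule that)
qed

lemma dstereo_inj: assumes "dstereo u w = 0" shows "w = 0"
proof -
  have uw: "4 * (u \<bullet> w) / (u \<bullet> u + 1)\<^sup>2 = 0"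
    using assms by (simp add: dstereo_def prod_eq_iff)
  then show ?thesis using assms unfolding dstereo_def uw by (simp add: prod_eq_iff)
qed

lemma local_param_stereo: "local_param UNIV (stereo :: real ^ 'n::finite \<Rightarrow> _)"
proof -
  have fr: "frechet_derivative stereo (at u) = dstereo u" for u :: "real ^ 'n"
    using frechet_derivative_at[OF stereo_has_derivative] by metis
  moreover have "inj (dstereo u)" for u :: "real ^ 'n"
    by (simp add: linear_injective_0[OF linear_dstereo] dstereo_inj)
  ultimately show ?thesis
    unfolding local_param_def fr using stereo_smooth inj_stereo stereo_in_sphere by blast
qed

lemma partial_eqI: "(f has_derivative D) (at u) \<Longrightarrow> partial i f u = D (axis i 1)"
  using frechet_derivative_at by (metis partial_def)

lemma partial_stereo: "partial i stereo u = dstereo u (axis i 1)"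
  by (rule partial_eqI[OF stereo_has_derivative])

section \<open>Rotations in coordinate planes\<close>

lemma orthogonal_matrix_inner:
  fixes A :: "real ^ 'n ^ 'n"
  assumes "orthogonal_matrix A" shows "(A *v u) \<bullet> (A *v w) = u \<bullet> w"
proof -
  have "(A *v u) \<bullet> (A *v w) = (u v* transpose A) \<bullet> (A *v w)" by simp
  also have "\<dots> = u \<bullet> ((transpose A ** A) *v w)"
    unfolding dot_lmul_matrix matrix_vector_mul_assoc ..
  finally show ?thesis using assms by (simp add: orthogonal_matrix_def)
qed

lemma so_act_stereo: "orthogonal_matrix A \<Longrightarrow> so_act A (stereo u) = stereo (A *v u)"
  by (simp add: so_act_def stereo_inner orthogonal_matrix_inner matrix_vector_mult_scaleR)

lemma so_act_dstereo: "orthogonal_matrix A \<Longrightarrow> so_act A (dstereo u w) = dstereo (A *v u) (A *v w)"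
  by (simp add: so_act_def dstereo_def orthogonal_matrix_inner matrix_vector_mult_scaleR
    matrix_vector_mult_diff_distrib)

lemma special_orthogonalI:
  assumes "orthogonal_transformation f" "det (matrix f) = 1"
  shows "matrix f \<in> special_orthogonal" "matrix f *v w = f w"
  using assms orthogonal_transformation_matrix[of f]
  by (auto simp: special_orthogonal_def orthogonal_transformation_linear)

text \<open>Explicit members of SO(n); the quarter and half turns among them supply the symmetry of
  the metric along a ray.\<close>

definition plane_rot :: "'n::finite \<Rightarrow> 'n \<Rightarrow> real \<Rightarrow> real ^ 'n \<Rightarrow> real ^ 'n" where
  "plane_rot i j t w = (\<chi> k. if k = i then cos t * w $ i - sin t * w $ j
     else if k = j then sin t * w $ i + cos t * w $ j else w $ k)"

lemma linear_plane_rot: "linear (plane_rot i j t)"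
proof (rule linearI)
  show "plane_rot i j t (v + w) = plane_rot i j t v + plane_rot i j t w" for v w
    unfolding plane_rot_def vec_eq_iff by (simp add: distrib_left)
  show "plane_rot i j t (c *\<^sub>R w) = c *\<^sub>R plane_rot i j t w" for c w
    unfolding plane_rot_def vec_eq_iff by (simp add: right_diff_distrib distrib_left mult.left_commute)
qed

lemma plane_rot_add:
  assumes "i \<noteq> j" shows "plane_rot i j s (plane_rot i j t w) = plane_rot i j (s + t) w"
proof -
  have "plane_rot i j s (plane_rot i j t w) $ k = plane_rot i j (s + t) w $ k" for k
    using assms by (cases "k = i"; cases "k = j") (simp_all add: plane_rot_def cos_add sin_add algebra_simps)
  then show ?thesis by (simp add: vec_eq_iff)
qed

lemma orthogonal_plane_rot:
  assumes "i \<noteq> j" shows "orthogonal_transformation (plane_rot i j t)"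
proof -
  have "plane_rot i j t v \<bullet> plane_rot i j t v = v \<bullet> v" for v
  proof -
    have split: "w \<bullet> w = w $ i * w $ i + w $ j * w $ j + (\<Sum>k\<in>UNIV - {i, j}. w $ k * w $ k)" for w :: "real ^ 'a"
      using assms sum.subset_diff[of "{i, j}" UNIV "\<lambda>k. w $ k * w $ k"] by (simp add: inner_vec_def)
    have ring: "(c * x - s * y) * (c * x - s * y) + (s * x + c * y) * (s * x + c * y) = (c * c + s * s) * (x * x + y * y)"
      for c s x y :: real by (simp add: algebra_simps)
    show ?thesis
      using assms ring[of "cos t" "v $ i" "sin t" "v $ j"]
      unfolding split sin_cos_squared_add3 by (simp add: plane_rot_def)
  qed
  then show ?thesis
    using linear_plane_rot by (simp add: orthogonal_transformation norm_eq_sqrt_inner)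
qed

text \<open>A rotation is the square of the rotation by half the angle, so its determinant is positive.\<close>

lemma plane_rot_special_orthogonal:
  assumes "i \<noteq> j"
  shows "matrix (plane_rot i j t) \<in> special_orthogonal" "matrix (plane_rot i j t) *v w = plane_rot i j t w"
proof -
  have lin: "linear (plane_rot i j s)" for s by (rule linear_plane_rot)
  have "plane_rot i j (t / 2) \<circ> plane_rot i j (t / 2) = plane_rot i j t"
    by (simp add: o_def fun_eq_iff plane_rot_add[OF assms])
  then have "det (matrix (plane_rot i j t)) = det (matrix (plane_rot i j (t / 2))) ^ 2"
    by (metis matrix_compose[OF lin lin] det_mul power2_eq_square)
  moreover have "\<bar>det (matrix (plane_rot i j (t / 2)))\<bar> = 1"
    by (rule orthogonal_transformation_det[OF orthogonal_plane_rot[OF assms]])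
  ultimately have "det (matrix (plane_rot i j t)) = 1" by (metis abs_power2 power2_abs one_power2)
  then show "matrix (plane_rot i j t) \<in> special_orthogonal" "matrix (plane_rot i j t) *v w = plane_rot i j t w"
    using special_orthogonalI[OF orthogonal_plane_rot[OF assms]] by auto
qed

subsection \<open>Integration by parts and polar coordinates\<close>

lemma has_derivative_zero_off:
  assumes "(f has_derivative D) (at u)" "closed S" "u \<notin> S" "\<And>x. x \<notin> S \<Longrightarrow> f x = 0"
  shows "D v = 0"
proof -
  have "(f has_derivative (\<lambda>_. 0)) (at u)"
    using has_derivative_cong_open[of "- S" u f "\<lambda>_. 0"] assms by (auto simp: open_Compl)
  then show ?thesis using has_derivative_unique[OF assms(1)] by metis
qed

lemma continuous_compact_support_integrable:
  fixes f :: "'a::euclidean_space \<Rightarrow> real"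
  assumes "continuous_on UNIV f" "compact K" "\<And>u. u \<notin> K \<Longrightarrow> f u = 0"
  shows "integrable lborel f"
proof -
  have "integrable lborel (\<lambda>u. indicator K u *\<^sub>R f u)"
    by (rule borel_integrable_compact[OF assms(2)]) (use assms(1) continuous_on_subset in blast)
  moreover have "(\<lambda>u. indicator K u *\<^sub>R f u) = f"
    using assms(3) by (auto simp: indicator_def fun_eq_iff)
  ultimately show ?thesis by simp
qed

text \<open>By translation invariance, the difference quotients integrate to zero.\<close>

lemma integral_derivative_compact_support:
  fixes f :: "'a::euclidean_space \<Rightarrow> real"
  assumes D: "\<And>u. (f has_derivative D u) (at u)" and cont: "continuous_on UNIV (\<lambda>u. D u v)"
    and K: "compact K" "\<And>u. u \<notin> K \<Longrightarrow> f u = 0"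
  shows "integral\<^sup>L lborel (\<lambda>u. D u v) = 0"
proof -
  define t :: "nat \<Rightarrow> real" where "t m = 1 / real (Suc m)" for m
  have t: "0 < t m" "t m \<le> 1" "t m \<noteq> 0" for m by (auto simp: t_def)
  define q where "q m u = (f (u + t m *\<^sub>R v) - f u) / t m" for m u
  have contf: "continuous_on UNIV f"
    using D by (intro has_derivative_continuous_on) (auto intro: has_derivative_at_withinI)
  have intf: "integrable lborel f"
    by (rule continuous_compact_support_integrable[OF contf K])
  have D0: "D u v = 0" if "u \<notin> K" for u
    using has_derivative_zero_off[OF D compact_imp_closed[OF K(1)] that K(2)] .
  have line: "((\<lambda>s. f (u + s *\<^sub>R v)) has_real_derivative D (u + s *\<^sub>R v) v) (at s)" for u s
  proof -
    have "((\<lambda>s. f (u + s *\<^sub>R v)) has_derivative (\<lambda>h. D (u + s *\<^sub>R v) (h *\<^sub>R v))) (at s)"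
      by (rule has_derivative_compose[OF _ D]) (auto intro!: derivative_eq_intros)
    moreover have "D (u + s *\<^sub>R v) (h *\<^sub>R v) = D (u + s *\<^sub>R v) v * h" for h
      using linear_scale[OF has_derivative_linear[OF D[of "u + s *\<^sub>R v"]], of h v] by simp
    ultimately show ?thesis by (simp add: has_field_derivative_def)
  qed
  obtain M where M: "\<And>u. \<bar>D u v\<bar> \<le> M" "0 \<le> M"
  proof -
    have "compact ((\<lambda>u. D u v) ` K)"
      by (rule compact_continuous_image[OF continuous_on_subset[OF cont] K(1)]) auto
    then obtain B where "\<forall>x\<in>(\<lambda>u. D u v) ` K. norm x \<le> B"
      using compact_imp_bounded bounded_iff by metis
    then have "\<bar>D u v\<bar> \<le> max B 0" for u
      using D0[of u] by (cases "u \<in> K") (auto simp: le_max_iff_disj)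
    then show thesis using that[of "max B 0"] by auto
  qed
  obtain R where R: "\<And>u. u \<in> K \<Longrightarrow> norm u \<le> R"
    using compact_imp_bounded[OF K(1)] bounded_iff by metis
  \<comment> \<open>The mean value theorem bounds the difference quotients by the bound
    \<open>M\<close> of the derivative. As the increments \<open>t m\<close> are at most 1, all
    quotients vanish outside one ball, so a single integrable function dominates them.\<close>
  have q_bound: "norm (q m u) \<le> indicator (cball 0 (R + norm v)) u *\<^sub>R M" for m u
  proof (cases "u \<in> cball 0 (R + norm v)")
    case True
    obtain s where "f (u + t m *\<^sub>R v) - f (u + 0 *\<^sub>R v) = (t m - 0) * D (u + s *\<^sub>R v) v"
      using MVT2[OF t(1)[of m], of "\<lambda>s. f (u + s *\<^sub>R v)" "\<lambda>s. D (u + s *\<^sub>R v) v"] line by metis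
    then have "q m u = D (u + s *\<^sub>R v) v" using t(3)[of m] by (simp add: q_def)
    then show ?thesis using True M by simp
  next
    case False
    then have n: "norm u > R + norm v" by simp
    have "u \<notin> K" using R[of u] n norm_ge_zero[of v] by linarith
    moreover have "u + t m *\<^sub>R v \<notin> K"
    proof
      assume "u + t m *\<^sub>R v \<in> K"
      then have "norm (u + t m *\<^sub>R v) \<le> R" by (rule R)
      moreover have "norm u \<le> norm (u + t m *\<^sub>R v) + norm (t m *\<^sub>R v)"
        using norm_triangle_ineq4[of "u + t m *\<^sub>R v" "t m *\<^sub>R v"] by simp
      moreover have "norm (t m *\<^sub>R v) \<le> norm v"
        using t[of m] by (simp add: mult_left_le_one_le)
      ultimately show False using n by linarith
    qed
    ultimately show ?thesis using False by (simp add: q_def K(2))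
  qed
  have q_int: "integral\<^sup>L lborel (q m) = 0" for m
  proof -
    have ib: "integrable lborel (\<lambda>u. f (t m *\<^sub>R v + u))"
      using integrable_distr[of "(+) (t m *\<^sub>R v)" lborel borel f] intf
      by (simp add: lborel_distr_plus)
    have "integral\<^sup>L lborel (\<lambda>u. f (t m *\<^sub>R v + u)) = integral\<^sup>L lborel f"
      using integral_distr[of "(+) (t m *\<^sub>R v)" lborel borel f] borel_measurable_integrable[OF intf]
      by (simp add: lborel_distr_plus)
    moreover have "integral\<^sup>L lborel (q m)
        = (integral\<^sup>L lborel (\<lambda>u. f (t m *\<^sub>R v + u)) - integral\<^sup>L lborel f) / t m"
      unfolding q_def using intf ib by (simp add: add.commute)
    ultimately show ?thesis by simp
  qed
  have "(\<lambda>m. integral\<^sup>L lborel (q m)) \<longlonglongrightarrow> integral\<^sup>L lborel (\<lambda>u. D u v)"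
  proof (rule integral_dominated_convergence)
    show "(\<lambda>u. D u v) \<in> borel_measurable lborel"
      using borel_measurable_continuous_onI[OF cont] by simp
    have "continuous_on UNIV (q m)" for m
      unfolding q_def by (intro continuous_intros continuous_on_compose2[OF contf]) (auto simp: t)
    then show "q m \<in> borel_measurable lborel" for m
      by (simp add: borel_measurable_continuous_onI)
    show "integrable lborel (\<lambda>u. indicator (cball 0 (R + norm v)) u *\<^sub>R M)"
      by (rule borel_integrable_compact) auto
    show "AE u in lborel. norm (q m u) \<le> indicator (cball 0 (R + norm v)) u *\<^sub>R M" for m
      using q_bound by simp
    have "(\<lambda>m. q m u) \<longlonglongrightarrow> D u v" for u
    proof -
      have "((\<lambda>h. (f (u + (0 + h) *\<^sub>R v) - f (u + 0 *\<^sub>R v)) / h) \<longlongrightarrow> D (u + 0 *\<^sub>R v) v) (at 0)"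
        using line[of u 0] unfolding DERIV_def by simp
      moreover have "filterlim t (at 0) sequentially"
        unfolding filterlim_at t_def using LIMSEQ_inverse_real_of_nat
        by (auto simp: inverse_eq_divide)
      ultimately show ?thesis
        unfolding q_def using filterlim_compose[of "\<lambda>h. (f (u + h *\<^sub>R v) - f u) / h" "nhds (D u v)" "at 0" t]
        by simp
    qed
    then show "AE u in lborel. (\<lambda>m. q m u) \<longlonglongrightarrow> D u v" by simp
  qed
  then show ?thesis by (simp add: q_int LIMSEQ_const_iff)
qed

lemma continuous_on_extend_zero:
  fixes f :: "'a::topological_space \<Rightarrow> real"
  assumes "open U" "closed S" "S \<subseteq> U" "continuous_on U f" "\<And>x. x \<in> U - S \<Longrightarrow> f x = 0"
  shows "continuous_on UNIV (\<lambda>x. indicator U x *\<^sub>R f x)"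
proof -
  have "continuous_on (U \<union> - S) (\<lambda>x. indicator U x *\<^sub>R f x)"
  proof (rule continuous_on_open_Un)
    show "continuous_on U (\<lambda>x. indicator U x *\<^sub>R f x)"
      using assms(4) by (simp cong: continuous_on_cong)
    have "indicator U x *\<^sub>R f x = 0" if "x \<in> - S" for x
      using assms(5)[of x] that by (cases "x \<in> U") auto
    then show "continuous_on (- S) (\<lambda>x. indicator U x *\<^sub>R f x)"
      by (rule continuous_on_eq[OF continuous_on_const[of _ 0], OF sym])
  qed (use assms in auto)
  moreover have "U \<union> - S = UNIV" using assms by auto
  ultimately show ?thesis by simp
qed

text \<open>Because \<open>\<eta>\<close> vanishes off a compact part of \<open>U\<close>, the
  product of \<open>f\<close> and \<open>\<eta>\<close> extended by zero is differentiable
  everywhere, and the integral of its derivative vanishes.\<close>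

lemma integration_by_parts:
  fixes f \<eta> :: "'a::euclidean_space \<Rightarrow> real"
  assumes U: "open U" and f: "\<And>u. u \<in> U \<Longrightarrow> (f has_derivative Df u) (at u)"
    and Df: "continuous_on U (\<lambda>u. Df u v)"
    and \<eta>: "\<And>u. (\<eta> has_derivative D\<eta> u) (at u)" and D\<eta>: "continuous_on UNIV (\<lambda>u. D\<eta> u v)"
    and S: "compact S" "S \<subseteq> U" "\<And>u. u \<notin> S \<Longrightarrow> \<eta> u = 0"
  shows "(LINT u:U|lborel. f u * D\<eta> u v) = - (LINT u:U|lborel. Df u v * \<eta> u)"
proof -
  have clS: "closed S" by (rule compact_imp_closed[OF S(1)])
  have D\<eta>0: "D\<eta> u w = 0" if "u \<notin> S" for u w
    using has_derivative_zero_off[OF \<eta> clS that S(3)] .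
  have cf: "continuous_on U f"
    using f by (intro has_derivative_continuous_on) (auto intro: has_derivative_at_withinI)
  have c\<eta>: "continuous_on U \<eta>"
    using \<eta> by (intro has_derivative_continuous_on) (auto intro: has_derivative_at_withinI)
  have D\<eta>': "continuous_on U (\<lambda>u. D\<eta> u v)" using D\<eta> continuous_on_subset by blast
  define P where "P u = indicator U u *\<^sub>R (f u * \<eta> u)" for u
  define DP where "DP u w = indicator U u *\<^sub>R (f u * D\<eta> u w + Df u w * \<eta> u)" for u w
  have c1: "continuous_on UNIV (\<lambda>u. indicator U u *\<^sub>R (f u * D\<eta> u v))"
    by (rule continuous_on_extend_zero[OF U clS S(2)]) (auto intro!: continuous_intros cf D\<eta>' simp: D\<eta>0)
  have c2: "continuous_on UNIV (\<lambda>u. indicator U u *\<^sub>R (Df u v * \<eta> u))"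
    by (rule continuous_on_extend_zero[OF U clS S(2)]) (auto intro!: continuous_intros Df c\<eta> simp: S(3))
  have i1: "integrable lborel (\<lambda>u. indicator U u *\<^sub>R (f u * D\<eta> u v))"
    by (rule continuous_compact_support_integrable[OF c1 S(1)]) (simp add: D\<eta>0)
  have i2: "integrable lborel (\<lambda>u. indicator U u *\<^sub>R (Df u v * \<eta> u))"
    by (rule continuous_compact_support_integrable[OF c2 S(1)]) (simp add: S(3))
  have "(P has_derivative DP u) (at u)" for u
  proof (cases "u \<in> U")
    case True
    have "((\<lambda>u. f u * \<eta> u) has_derivative DP u) (at u)"
      using has_derivative_mult[OF f[OF True] \<eta>[of u]] True by (simp add: DP_def[abs_def])
    then show ?thesis
      by (rule has_derivative_transform_within_open[OF _ U True]) (simp add: P_def)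
  next
    case False
    then have "u \<in> - S" using S by auto
    have "((\<lambda>_. 0) has_derivative DP u) (at u)" using False by (simp add: DP_def[abs_def])
    then show ?thesis
      using has_derivative_cong_open[of "- S" u P "\<lambda>_. 0"] clS \<open>u \<in> - S\<close>
      by (auto simp: P_def S(3) open_Compl)
  qed
  moreover have "continuous_on UNIV (\<lambda>u. DP u v)"
    unfolding DP_def scaleR_add_right by (rule continuous_on_add[OF c1 c2])
  ultimately have "integral\<^sup>L lborel (\<lambda>u. DP u v) = 0"
    by (rule integral_derivative_compact_support[OF _ _ S(1)]) (simp add: P_def S(3))
  moreover have "integral\<^sup>L lborel (\<lambda>u. DP u v) =
     (LINT u:U|lborel. f u * D\<eta> u v) + (LINT u:U|lborel. Df u v * \<eta> u)"
    unfolding DP_def scaleR_add_right set_lebesgue_integral_def by (rule Bochner_Integration.integral_add[OF i1 i2])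
  ultimately show ?thesis by simp
qed

text \<open>Half lines generate the Borel sets and are closed under intersection, so it suffices to
  compare the volumes of balls with the integrals of the density, whose antiderivative is
  \<open>unit_ball_vol n * r ^ n\<close>.\<close>

lemma distr_norm_lborel:
  fixes n :: nat
  defines "n \<equiv> DIM('a::euclidean_space)"
  shows "distr (lborel :: 'a measure) borel norm =
     density lborel (\<lambda>r. ennreal (real n * unit_ball_vol n * r ^ (n - 1)) * indicator {0..} r)" (is "?L = ?R")
proof (rule measure_eqI_generator_eq[where E = "range (\<lambda>a::real. {..a})" and \<Omega> = UNIV and A = "\<lambda>i. {..real i}"])
  have n: "n \<noteq> 0" unfolding n_def by simp
  show "Int_stable (range (\<lambda>a::real. {..a}))" by (auto simp: Int_stable_def)
  show "range (\<lambda>a::real. {..a}) \<subseteq> Pow UNIV" by simp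
  show "sets ?L = sigma_sets UNIV (range (\<lambda>a::real. {..a}))"
    by (simp add: borel_eq_atMost)
  show "sets ?R = sigma_sets UNIV (range (\<lambda>a::real. {..a}))"
    by (simp add: borel_eq_atMost)
  show "range (\<lambda>i. {..real i}) \<subseteq> range (\<lambda>a::real. {..a})" by auto
  show "(\<Union>i. {..real i}) = UNIV" using real_arch_simple by auto
  have L: "emeasure ?L {..a} = (if a < 0 then 0 else ennreal (unit_ball_vol n * a ^ n))" for a
  proof -
    have "norm -` {..a} \<inter> space (lborel :: 'a measure) = cball 0 a" by (auto)
    then show ?thesis
      by (simp add: emeasure_distr emeasure_cball n_def)
  qed
  have R: "emeasure ?R {..a} = (if a < 0 then 0 else ennreal (unit_ball_vol n * a ^ n))" for a
  proof -
    have "emeasure ?R {..a} = (\<integral>\<^sup>+ r. ennreal (real n * unit_ball_vol n * r ^ (n - 1)) * indicator {0..} r * indicator {..a} r \<partial>lborel)"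
      by (rule emeasure_density) auto
    also have "\<dots> = (\<integral>\<^sup>+ r. ennreal (real n * unit_ball_vol n * r ^ (n - 1)) * indicator {0..a} r \<partial>lborel)"
      by (rule nn_integral_cong) (auto split: split_indicator)
    also have "\<dots> = (if a < 0 then 0 else ennreal (unit_ball_vol n * a ^ n))"
    proof (cases "a < 0")
      case False
      have "(\<integral>\<^sup>+ r. ennreal (real n * unit_ball_vol n * r ^ (n - 1)) * indicator {0..a} r \<partial>lborel)
         = ennreal (unit_ball_vol n * a ^ n - unit_ball_vol n * 0 ^ n)"
      proof (rule nn_integral_FTC_Icc)
        show "((\<lambda>r. unit_ball_vol n * r ^ n) has_real_derivative real n * unit_ball_vol n * r ^ (n - 1)) (at r)" for r
          by (auto intro!: derivative_eq_intros)
      qed (use False in auto)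
      then show ?thesis using False n by (simp add: power_0_left)
    qed auto
    finally show ?thesis .
  qed
  show "emeasure ?L X = emeasure ?R X" if "X \<in> range (\<lambda>a::real. {..a})" for X
    using that L R by auto
  show "emeasure ?L {..real i} \<noteq> \<infinity>" for i by (simp add: L)
qed

lemma nn_integral_norm_lborel:
  fixes h :: "real \<Rightarrow> ennreal"
  assumes [measurable]: "h \<in> borel_measurable borel"
  shows "(\<integral>\<^sup>+ u. h (norm (u :: 'a::euclidean_space)) \<partial>lborel) =
    ennreal (DIM('a) * unit_ball_vol DIM('a)) * (\<integral>\<^sup>+ r. h r * ennreal (r ^ (DIM('a) - 1)) * indicator {0..} r \<partial>lborel)"
proof -
  let ?c = "ennreal (DIM('a) * unit_ball_vol DIM('a))"
  have "(\<integral>\<^sup>+ u. h (norm (u :: 'a)) \<partial>lborel) = (\<integral>\<^sup>+ r. h r \<partial>distr (lborel :: 'a measure) borel norm)"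
    by (simp add: nn_integral_distr)
  also have "\<dots> = (\<integral>\<^sup>+ r. ennreal (DIM('a) * unit_ball_vol DIM('a) * r ^ (DIM('a) - 1)) * indicator {0..} r * h r \<partial>lborel)"
    unfolding distr_norm_lborel by (rule nn_integral_density) auto
  also have "\<dots> = (\<integral>\<^sup>+ r. ?c * (h r * ennreal (r ^ (DIM('a) - 1)) * indicator {0..} r) \<partial>lborel)"
    by (rule nn_integral_cong) (auto simp: ennreal_mult ac_simps split: split_indicator)
  also have "\<dots> = ?c * (\<integral>\<^sup>+ r. h r * ennreal (r ^ (DIM('a) - 1)) * indicator {0..} r \<partial>lborel)"
    by (rule nn_integral_cmult) auto
  finally show ?thesis .
qed

subsection \<open>Invariant metrics in the stereographic chart\<close>

lemma norm_stereo [simp]: "norm (stereo u) = 1"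
  using stereo_in_sphere[of u] by simp

lemma axis_zero [simp]: "axis i (0 :: real) = 0"
  by (simp add: axis_eq_0_iff)

lemma norm_axis_real [simp]: "norm (axis i (x :: real)) = \<bar>x\<bar>"
  by (simp add: norm_eq_sqrt_inner inner_axis_axis)

lemma det_two_indices:
  fixes A :: "real ^ 'n ^ 'n"
  assumes "UNIV = {i, j :: 'n}" "i \<noteq> j"
  shows "det A = A $ i $ i * A $ j $ j - A $ i $ j * A $ j $ i"
proof -
  have f: "finite {j}" "i \<notin> {j}" using assms(2) by auto
  show ?thesis
    unfolding det_def assms(1) sum_over_permutations_insert[OF f] permutes_sing
    using assms(2)
    by (simp add: sign_swap_id sign_id swap_id_eq transpose_eq_iff)
qed

locale rot_metric =
  fixes g :: "'n::finite metric_field" and i1 i2 :: 'n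
  assumes metric: "riemannian_metric g" and invariant: "so_invariant_metric g" and i12: "i1 \<noteq> i2"
begin

definition form :: "real ^ 'n \<Rightarrow> real ^ 'n \<Rightarrow> real ^ 'n \<Rightarrow> real" where
  "form u v w = g (stereo u) (dstereo u v) (dstereo u w)"

lemma g_sym:
  "p \<in> unit_sphere \<Longrightarrow> v \<in> tangent_space p \<Longrightarrow> w \<in> tangent_space p \<Longrightarrow> g p v w = g p w v"
  using metric unfolding riemannian_metric_def by blast

lemma g_scale:
  "p \<in> unit_sphere \<Longrightarrow> v \<in> tangent_space p \<Longrightarrow> w \<in> tangent_space p \<Longrightarrow> g p (c *\<^sub>R v) w = c * g p v w"
  using metric unfolding riemannian_metric_def by blast

lemma form_sym: "form u v w = form u w v"
  unfolding form_def by (rule g_sym) auto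

lemma form_scale_left: "form u (c *\<^sub>R v) w = c * form u v w"
  unfolding form_def linear_scale[OF linear_dstereo] by (rule g_scale) auto

lemma form_add_left: "form u (v + v') w = form u v w + form u v' w"
proof -
  have "g p (x + y) w = g p x w + g p y w"
    if "p \<in> unit_sphere" "x \<in> tangent_space p" "y \<in> tangent_space p" "w \<in> tangent_space p" for p x y w
    using metric that unfolding riemannian_metric_def by blast
  then show ?thesis
    unfolding form_def linear_add[OF linear_dstereo] using stereo_in_sphere dstereo_tangent by blast
qed

lemma form_pos: "v \<noteq> 0 \<Longrightarrow> 0 < form u v v"
proof -
  assume "v \<noteq> 0"
  then have "dstereo u v \<noteq> 0" using dstereo_inj by blast
  moreover have "w \<noteq> 0 \<Longrightarrow> 0 < g p w w" if "p \<in> unit_sphere" "w \<in> tangent_space p" for p w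
    using metric that unfolding riemannian_metric_def by blast
  ultimately show ?thesis unfolding form_def using stereo_in_sphere dstereo_tangent by blast
qed

lemma form_linear_left: "linear (\<lambda>v. form u v w)"
  by (rule linearI) (simp_all add: form_add_left form_scale_left)

lemma form_linear_right: "linear (\<lambda>w. form u v w)"
  using form_linear_left by (simp add: form_sym[of u v])

lemma gram_stereo: "gram g stereo u $ i $ j = form u (axis i 1) (axis j 1)"
  by (simp add: gram_def form_def partial_stereo)

lemma form_expand_left: "form u v w = (\<Sum>i\<in>UNIV. v $ i * form u (axis i 1) w)"
  by (subst (1) basis_expansion[of v, symmetric])
     (simp add: scalar_mult_eq_scaleR linear_sum[OF form_linear_left] linear_scale[OF form_linear_left])

lemma form_gram: "form u v w = v \<bullet> (gram g stereo u *v w)"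
proof -
  have "form u v w = (\<Sum>i\<in>UNIV. v $ i * form u w (axis i 1))"
    by (subst form_expand_left) (simp add: form_sym[of u w])
  also have "\<dots> = (\<Sum>i\<in>UNIV. v $ i * (\<Sum>j\<in>UNIV. w $ j * gram g stereo u $ i $ j))"
    by (subst form_expand_left[of u w]) (simp add: gram_stereo form_sym[of u "axis _ 1" "axis _ 1"])
  also have "\<dots> = v \<bullet> (gram g stereo u *v w)"
    by (simp add: inner_vec_def matrix_vector_mult_def mult.commute)
  finally show ?thesis .
qed

lemma form_rot:
  assumes "A \<in> special_orthogonal"
  shows "form (A *v u) (A *v v) (A *v w) = form u v w"
proof -
  have "orthogonal_matrix A" using assms by (simp add: special_orthogonal_def)
  then show ?thesis
    using invariant[unfolded so_invariant_metric_def, rule_format, OF assms stereo_in_sphere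
      dstereo_tangent dstereo_tangent, of u v w]
    by (simp add: form_def so_act_stereo so_act_dstereo)
qed

lemma form_plane_rot:
  assumes "i \<noteq> j"
  shows "form (plane_rot i j t u) (plane_rot i j t v) (plane_rot i j t w) = form u v w"
  using form_rot[OF plane_rot_special_orthogonal(1)[OF assms]]
  by (simp only: plane_rot_special_orthogonal(2)[OF assms])

lemma plane_rot_axis:
  assumes "i \<noteq> j"
  shows "k \<noteq> i \<Longrightarrow> k \<noteq> j \<Longrightarrow> plane_rot i j t (axis k x) = axis k x"
    and "plane_rot i j t (axis i x) = axis i (cos t * x) + axis j (sin t * x)"
    and "plane_rot i j t (axis j x) = axis i (- sin t * x) + axis j (cos t * x)"
  using assms by (auto simp: plane_rot_def vec_eq_iff axis_def)

lemma axis_uminus: "axis i (- x) = - axis i (x :: real)"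
  by (simp add: vec_eq_iff axis_def)

lemma form_uminus_left: "form u (- v) w = - form u v w"
  using form_scale_left[of u "-1" v w] by simp

lemma form_uminus_right: "form u v (- w) = - form u v w"
  using form_uminus_left by (simp add: form_sym[of u v])

text \<open>A quarter turn sends the first axis to the second and the second to minus the first. At
  a fixed point this equates the two diagonal entries, and by symmetry of the form it turns the
  mixed entry into its negative.\<close>

lemma form_quarter_turn:
  assumes "i \<noteq> j" "plane_rot i j (pi / 2) u = u"
  shows "form u (axis i 1) (axis i 1) = form u (axis j 1) (axis j 1)" "form u (axis i 1) (axis j 1) = 0"
proof -
  have r: "plane_rot i j (pi / 2) (axis i 1) = axis j 1" "plane_rot i j (pi / 2) (axis j 1) = - axis i 1"
    unfolding plane_rot_axis(2,3)[OF assms(1)] by (simp_all add: axis_eq_0_iff axis_uminus)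
  show "form u (axis i 1) (axis i 1) = form u (axis j 1) (axis j 1)"
    using form_plane_rot[OF assms(1), of "pi/2" u "axis i 1" "axis i 1"] by (simp add: r assms(2))
  show "form u (axis i 1) (axis j 1) = 0"
    using form_plane_rot[OF assms(1), of "pi/2" u "axis i 1" "axis j 1"]
      form_sym[of u "axis i 1" "axis j 1"]
    by (simp add: r assms(2) form_uminus_right)
qed

text \<open>
  The chart is studied along the ray \<open>axis i1 r\<close>. In dimension two the radial and the rotational
  direction need not be orthogonal, which is the role of \<open>cF\<close>.
\<close>

definition cA :: "real \<Rightarrow> real" where "cA r = form (axis i1 r) (axis i2 1) (axis i2 1)"
definition cE :: "real \<Rightarrow> real" where "cE r = form (axis i1 r) (axis i1 1) (axis i1 1)"
definition cF :: "real \<Rightarrow> real" where "cF r = form (axis i1 r) (axis i1 1) (axis i2 1)"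
text \<open>The Gram determinant of the radial and one rotational direction. The part of the radial
  direction orthogonal to the orbits has squared length \<open>disc r / cA r\<close>, so arc length
  along the profile is ds = sqrt (disc / cA) dr.\<close>

definition disc :: "real \<Rightarrow> real" where "disc r = cE r * cA r - (cF r)\<^sup>2"

lemma gram_C_on: "C_on k (\<lambda>u. gram g stereo u $ i $ j) UNIV"
  using metric local_param_stereo unfolding riemannian_metric_def smooth_on_def by blast

lemma C_on_axis: "C_on k (\<lambda>r::real. axis i r :: real ^ 'n) UNIV"
proof -
  have "linear (\<lambda>r::real. axis i r :: real ^ 'n)"
    by (rule linearI) (auto simp: vec_eq_iff axis_def)
  then show ?thesis by (intro C_on_linear_id linear_linear[THEN iffD1]) (auto simp: linear_conv_bounded_linear)
qed

lemma coefficients_C_on: "C_on k cA UNIV" "C_on k cE UNIV" "C_on k cF UNIV"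
proof -
  have "C_on k (\<lambda>r. gram g stereo (axis i1 r) $ i $ j) UNIV" for i j
    by (rule C_on_compose[OF open_UNIV open_UNIV _ C_on_axis gram_C_on]) auto
  then show "C_on k cA UNIV" "C_on k cE UNIV" "C_on k cF UNIV"
    unfolding cA_def[abs_def] cE_def[abs_def] cF_def[abs_def] by (simp_all add: gram_stereo)
qed

lemma axis_neq_0: "axis i (1::real) \<noteq> 0"
  by (simp add: axis_eq_0_iff)

lemma cA_pos: "0 < cA r" and cE_pos: "0 < cE r"
  unfolding cA_def cE_def by (intro form_pos axis_neq_0)+

lemma disc_pos: "0 < disc r"
proof -
  let ?e = "axis i1 1 :: real ^ 'n" and ?f = "axis i2 1 :: real ^ 'n"
  \<comment> \<open>This is \<open>cA r\<close> times the component of \<open>?e\<close> orthogonal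
    to \<open>?f\<close>, so that its squared length is \<open>cA r * disc r\<close>.\<close>
  let ?v = "cA r *\<^sub>R ?e + (- cF r) *\<^sub>R ?f"
  have "?v $ i1 = cA r" using i12 by (simp add: axis_def)
  then have "?v \<noteq> 0" using cA_pos[of r] by (metis less_irrefl zero_index)
  then have "0 < form (axis i1 r) ?v ?v" by (rule form_pos)
  also have "\<dots> = cA r * disc r"
    unfolding linear_add[OF form_linear_left] linear_add[OF form_linear_right]
      linear_scale[OF form_linear_left] linear_scale[OF form_linear_right]
    using form_sym[of "axis i1 r" ?f ?e]
    by (simp add: disc_def cA_def[symmetric] cE_def[symmetric] cF_def[symmetric] power2_eq_square algebra_simps)
  finally show ?thesis using cA_pos[of r] by (simp add: zero_less_mult_iff)
qed

text \<open>The origin is fixed by every rotation, so the quarter turn is available there even in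
  dimension two. The result is \<open>slope 0 = 1\<close>, the starting value of the slope
  bound.\<close>

lemma coefficients_at_pole: "cE 0 = cA 0" "cF 0 = 0"
proof -
  have "plane_rot i1 i2 (pi / 2) 0 = 0" by (rule linear_0[OF linear_plane_rot])
  then show "cE 0 = cA 0" "cF 0 = 0"
    using form_quarter_turn[OF i12, of 0] by (simp_all add: cA_def cE_def cF_def)
qed

text \<open>Two directions off the ray span a plane whose rotations fix the ray. The quarter turn
  settles the entries within that plane; the half turn flips \<open>axis j 1\<close> and keeps
  \<open>axis i1 1\<close>, which kills the cross term. Such a plane exists only from dimension
  three on.\<close>

lemma form_ray_transversal:
  assumes "j \<noteq> i1" "k \<noteq> i1" "j \<noteq> k"
  shows "form (axis i1 r) (axis j 1) (axis j 1) = form (axis i1 r) (axis k 1) (axis k 1)"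
    "form (axis i1 r) (axis j 1) (axis k 1) = 0" "form (axis i1 r) (axis i1 1) (axis j 1) = 0"
proof -
  have fix_ray: "plane_rot j k t (axis i1 r) = axis i1 r" for t r
    by (rule plane_rot_axis(1)) (use assms in auto)
  show "form (axis i1 r) (axis j 1) (axis j 1) = form (axis i1 r) (axis k 1) (axis k 1)"
    "form (axis i1 r) (axis j 1) (axis k 1) = 0"
    using form_quarter_turn[OF assms(3) fix_ray] by auto
  have "plane_rot j k pi (axis j 1) = - axis j 1"
    unfolding plane_rot_axis(2)[OF assms(3)] by (simp add: axis_uminus axis_eq_0_iff)
  then show "form (axis i1 r) (axis i1 1) (axis j 1) = 0"
    using form_plane_rot[OF assms(3), of pi "axis i1 r" "axis i1 1" "axis j 1"]
    by (simp add: fix_ray form_uminus_right)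
qed

text \<open>The case split of the whole argument: from dimension three on, each direction off the
  ray has a partner to rotate with.\<close>

lemma two_or_more: "UNIV = {i1, i2} \<or> (\<forall>j. j \<noteq> i1 \<longrightarrow> (\<exists>k. k \<noteq> i1 \<and> k \<noteq> j))"
proof (cases "UNIV = {i1, i2}")
  case False
  then obtain m where "m \<noteq> i1" "m \<noteq> i2" by auto
  then show ?thesis using i12 by metis
qed simp

lemma CARD_ge_2: "2 \<le> CARD('n)"
  using card_mono[of UNIV "{i1, i2}"] i12 by simp

lemma ray_structure:
  assumes "UNIV \<noteq> {i1, i2}"
  shows "j \<noteq> i1 \<Longrightarrow> form (axis i1 r) (axis j 1) (axis j 1) = cA r"
    "j \<noteq> i1 \<Longrightarrow> k \<noteq> i1 \<Longrightarrow> j \<noteq> k \<Longrightarrow> form (axis i1 r) (axis j 1) (axis k 1) = 0"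
    "j \<noteq> i1 \<Longrightarrow> form (axis i1 r) (axis i1 1) (axis j 1) = 0"
    "cF r = 0"
proof -
  show *: "form (axis i1 r) (axis i1 1) (axis j 1) = 0" if "j \<noteq> i1" for j
    using two_or_more assms that form_ray_transversal(3) by metis
  show "form (axis i1 r) (axis j 1) (axis k 1) = 0" if "j \<noteq> i1" "k \<noteq> i1" "j \<noteq> k"
    using form_ray_transversal(2)[OF that] .
  show "form (axis i1 r) (axis j 1) (axis j 1) = cA r" if "j \<noteq> i1"
    unfolding cA_def using form_ray_transversal(1)[OF that, of i2] i12 by (cases "j = i2") auto
  show "cF r = 0" unfolding cF_def using * i12 by auto
qed

lemma rot_to_ray:
  obtains A where "A \<in> special_orthogonal" "A *v axis i1 (norm u) = u"
proof -
  have "norm (axis i1 (norm u) :: real ^ 'n) = norm u" by simp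
  then obtain f :: "real ^ 'n \<Rightarrow> real ^ 'n"
    where f: "orthogonal_transformation f" "det (matrix f) = 1" "f (axis i1 (norm u)) = u"
    by (rule rotation_exists[OF CARD_ge_2])
  then show thesis using special_orthogonalI[OF f(1,2)] that by metis
qed

lemma gram_rot:
  assumes "A \<in> special_orthogonal"
  shows "transpose A ** gram g stereo (A *v u) ** A = gram g stereo u" (is "?L = ?R")
proof -
  have "v \<bullet> (?L *v w) = v \<bullet> (?R *v w)" for v w
  proof -
    have "v \<bullet> (?L *v w) = (v v* transpose A) \<bullet> (gram g stereo (A *v u) *v (A *v w))"
      unfolding dot_lmul_matrix matrix_vector_mul_assoc by (simp add: matrix_mul_assoc)
    also have "\<dots> = form (A *v u) (A *v v) (A *v w)" by (simp add: form_gram)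
    also have "\<dots> = form u v w" by (rule form_rot[OF assms])
    finally show ?thesis by (simp only: form_gram)
  qed
  then have "?L *v w = ?R *v w" for w using vector_eq_ldot by blast
  then show ?thesis by (simp add: matrix_eq)
qed

lemma det_gram_rot: "A \<in> special_orthogonal \<Longrightarrow> det (gram g stereo (A *v u)) = det (gram g stereo u)"
  using arg_cong[OF gram_rot, of A det u] by (simp add: det_mul det_transpose special_orthogonal_def)

text \<open>A rotation to the ray leaves a 2 by 2 determinant in dimension two, and from dimension
  three on a diagonal matrix with entry \<open>cE\<close> once and \<open>cA\<close> otherwise. In
  the latter case \<open>cF\<close> vanishes, so splitting off \<open>disc\<close> covers both with
  one formula.\<close>

lemma det_gram_stereo: "det (gram g stereo u) = cA (norm u) ^ (CARD('n) - 2) * disc (norm u)"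
proof -
  obtain A where A: "A \<in> special_orthogonal" "A *v axis i1 (norm u) = u" by (rule rot_to_ray)
  let ?s = "axis i1 (norm u) :: real ^ 'n"
  have "det (gram g stereo u) = det (gram g stereo ?s)"
    using det_gram_rot[OF A(1), of ?s] by (simp add: A(2))
  also have "\<dots> = cA (norm u) ^ (CARD('n) - 2) * disc (norm u)"
  proof (cases "UNIV = {i1, i2}")
    case True
    then have "CARD('n) = 2" using i12 by (metis card_2_iff)
    then show ?thesis
      using form_sym[of ?s "axis i2 1" "axis i1 1"]
      by (simp add: det_two_indices[OF True i12] gram_stereo disc_def power2_eq_square
        cA_def[symmetric] cE_def[symmetric] cF_def[symmetric])
  next
    case False
    have "det (gram g stereo ?s) = (\<Prod>i\<in>UNIV. gram g stereo ?s $ i $ i)"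
    proof (rule det_diagonal)
      show "gram g stereo ?s $ i $ j = 0" if "i \<noteq> j" for i j
        using that ray_structure(2,3)[OF False] form_sym[of ?s "axis i 1" "axis j 1"]
        by (cases "i = i1"; cases "j = i1") (auto simp: gram_stereo)
    qed
    also have "\<dots> = gram g stereo ?s $ i1 $ i1 * (\<Prod>i\<in>UNIV - {i1}. gram g stereo ?s $ i $ i)"
      by (rule prod.remove) auto
    also have "(\<Prod>i\<in>UNIV - {i1}. gram g stereo ?s $ i $ i) = (\<Prod>i\<in>UNIV - {i1 :: 'n}. cA (norm u))"
      by (rule prod.cong) (auto simp: gram_stereo ray_structure(1)[OF False])
    also have "\<dots> = cA (norm u) ^ (CARD('n) - 1)" by simp
    also have "CARD('n) - 1 = Suc (CARD('n) - 2)" using CARD_ge_2 by simp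
    finally show ?thesis
      by (simp add: disc_def ray_structure(4)[OF False] gram_stereo cE_def[symmetric] ac_simps)
  qed
  finally show ?thesis .
qed

lemma det_gram_pos: "0 < det (gram g stereo u)"
  unfolding det_gram_stereo using cA_pos disc_pos by simp

text \<open>Cramer's rule, chosen so that the solution visibly depends continuously on \<open>u\<close>.\<close>

definition grad_radial :: "real ^ 'n \<Rightarrow> real ^ 'n" where
  "grad_radial u = (\<chi> k. det (\<chi> i j. if j = k then u $ i else gram g stereo u $ i $ j) / det (gram g stereo u))"

text \<open>The right side is the differential of half the squared Euclidean norm, so
  \<open>grad_radial\<close> is the Riemannian gradient of that function in the chart.\<close>

lemma form_grad_radial: "form u (grad_radial u) v = u \<bullet> v"
proof -
  have "gram g stereo u *v grad_radial u = u"
    using cramer[of "gram g stereo u" "grad_radial u" u] det_gram_pos[of u] by (simp add: grad_radial_def)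
  then have "form u v (grad_radial u) = v \<bullet> u" by (simp add: form_gram)
  then show ?thesis by (simp add: form_sym[of u v] inner_commute)
qed

lemma continuous_det:
  fixes M :: "'b::topological_space \<Rightarrow> real ^ 'n ^ 'n"
  assumes "\<And>i j. continuous_on S (\<lambda>u. M u $ i $ j)"
  shows "continuous_on S (\<lambda>u. det (M u))"
  unfolding det_def by (intro continuous_intros assms)

lemma continuous_gram: "continuous_on S (\<lambda>u. gram g stereo u $ i $ j)"
  using gram_C_on[of 0 i j] continuous_on_subset by auto

lemma continuous_grad_radial: "continuous_on UNIV grad_radial"
proof -
  have "continuous_on UNIV (\<lambda>u. det (\<chi> i j. if j = k then u $ i else gram g stereo u $ i $ j))" for k
  proof (rule continuous_det)
    fix i j show "continuous_on UNIV (\<lambda>u. (\<chi> i j. if j = k then u $ i else gram g stereo u $ i $ j) $ i $ j)"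
      by (cases "j = k") (auto intro!: continuous_gram continuous_intros)
  qed
  moreover have "continuous_on UNIV (\<lambda>u. det (gram g stereo u))"
    by (rule continuous_det[OF continuous_gram])
  ultimately show ?thesis
    unfolding grad_radial_def[abs_def]
    by (intro continuous_on_vec_lambda continuous_on_divide)
       (auto simp: less_imp_neq[OF det_gram_pos, symmetric])
qed

text \<open>The vector is the axis of the ray minus its orthogonal projection to the orbit
  direction, so it pairs to zero with every axis other than \<open>axis i1 1\<close>.\<close>

lemma grad_radial_ray:
  "form (axis i1 r) (axis i1 1 + (- (cF r / cA r)) *\<^sub>R axis i2 1) v = disc r / cA r * v $ i1"
    (is "form ?s ?z v = _")
proof -
  have "form ?s ?z (axis j 1) = (if j = i1 then disc r / cA r else 0)" for j
  proof -
    have exp: "form ?s ?z w = form ?s (axis i1 1) w - cF r / cA r * form ?s (axis i2 1) w" for w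
      unfolding form_add_left form_scale_left by simp
    have A: "cA r \<noteq> 0" using cA_pos[of r] by simp
    consider "j = i1" | "j = i2" | "j \<noteq> i1" "j \<noteq> i2" by auto
    then show ?thesis
    proof cases
      case 1 then show ?thesis using A form_sym[of ?s "axis i2 1" "axis i1 1"]
        unfolding exp by (simp add: cE_def[symmetric] cF_def[symmetric] disc_def power2_eq_square field_simps)
    next
      case 2 then show ?thesis using A i12
        unfolding exp by (simp add: cA_def[symmetric] cF_def[symmetric])
    next
      case 3
      then have *: "UNIV \<noteq> {i1, i2}" by auto
      show ?thesis unfolding exp using 3 ray_structure(3,4)[OF *] by simp
    qed
  qed
  note basis = this
  have "form ?s ?z v = (\<Sum>j\<in>UNIV. v $ j * form ?s ?z (axis j 1))"
    unfolding form_sym[of ?s ?z] by (rule form_expand_left)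
  also have "\<dots> = disc r / cA r * v $ i1"
    unfolding basis by (simp add: if_distrib cong: if_cong)
  finally show ?thesis .
qed

text \<open>The gradient of r^2 / 2 has squared length r^2 (dr/ds)^2, and (dr/ds)^2 is
  \<open>cA / disc\<close>. After a rotation to the ray the gradient is identified as a multiple of
  the vector of \<open>grad_radial_ray\<close>.\<close>

lemma form_grad_radial_self:
  "form u (grad_radial u) (grad_radial u) = (norm u)\<^sup>2 * cA (norm u) / disc (norm u)"
proof -
  let ?r = "norm u"
  obtain A where A: "A \<in> special_orthogonal" "A *v axis i1 ?r = u" by (rule rot_to_ray)
  have orth: "orthogonal_matrix A" using A(1) by (simp add: special_orthogonal_def)
  let ?z = "axis i1 1 + (- (cF ?r / cA ?r)) *\<^sub>R axis i2 1 :: real ^ 'n"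
  let ?c = "?r * cA ?r / disc ?r"
  have nz: "disc ?r \<noteq> 0" "cA ?r \<noteq> 0" using disc_pos[of ?r] cA_pos[of ?r] by auto
  have inner_axis1: "axis i1 x \<bullet> v = x * v $ i1" for x and v :: "real ^ 'n"
    by (simp add: inner_axis')
  have z: "form u (?c *\<^sub>R (A *v ?z)) v = u \<bullet> v" for v
  proof -
    obtain v' where v': "v = A *v v'"
      using orth unfolding orthogonal_matrix_def
      by (metis matrix_vector_mul_assoc matrix_vector_mul_lid)
    have "form u (A *v ?z) v = form (axis i1 ?r) ?z v'"
      using form_rot[OF A(1), of "axis i1 ?r" ?z v'] by (simp only: A(2) v')
    also have "\<dots> = disc ?r / cA ?r * v' $ i1" by (rule grad_radial_ray)
    finally have "form u (?c *\<^sub>R (A *v ?z)) v = ?r * v' $ i1"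
      using nz by (simp add: form_scale_left)
    also have "\<dots> = axis i1 ?r \<bullet> v'" by (simp add: inner_axis1)
    also have "\<dots> = (A *v axis i1 ?r) \<bullet> (A *v v')" by (rule orthogonal_matrix_inner[OF orth, symmetric])
    finally show ?thesis by (simp only: A(2) v')
  qed
  \<comment> \<open>Both vectors represent the functional that pairs with \<open>u\<close>, so their
    difference has squared length zero and positivity makes them equal.\<close>
  let ?d = "grad_radial u + (- 1) *\<^sub>R (?c *\<^sub>R (A *v ?z))"
  have "form u ?d ?d = 0" unfolding form_add_left[of u "grad_radial u"] form_scale_left[of u "-1"] z form_grad_radial by simp
  then have "?d = 0" using form_pos[of ?d u] by force
  then have eq: "grad_radial u = ?c *\<^sub>R (A *v ?z)" by simp
  have "form u (grad_radial u) (grad_radial u) = u \<bullet> grad_radial u" by (rule form_grad_radial)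
  also have "\<dots> = u \<bullet> (?c *\<^sub>R (A *v ?z))" by (simp only: eq)
  also have "\<dots> = ?c * ((A *v axis i1 ?r) \<bullet> (A *v ?z))" by (simp add: A(2))
  also have "\<dots> = ?c * ?r" unfolding orthogonal_matrix_inner[OF orth] inner_axis1 using i12 by (simp add: axis_def)
  finally show ?thesis by (simp add: power2_eq_square)
qed

end

subsection \<open>Scalar curvature of a rotationally symmetric metric\<close>

definition kron :: "'n \<Rightarrow> 'n \<Rightarrow> real" where "kron i j = (if i = j then 1 else 0)"

lemma kron_sym: "kron i j = kron j i" by (simp add: kron_def)

lemma kron_self [simp]: "kron i i = 1" by (simp add: kron_def)

lemma sum_kron [simp]:
  "(\<Sum>k\<in>UNIV. f k * kron k i) = (f i :: real)" "(\<Sum>k\<in>UNIV. f k * kron i k) = f i"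
  "(\<Sum>k\<in>UNIV. kron k i * f k) = f i" "(\<Sum>k\<in>UNIV. kron i k * f k) = f (i :: 'n::finite)"
  by (simp_all add: kron_def if_distrib if_distribR cong: if_cong)

lemma axis_nth_kron: "axis i 1 $ j = kron i j"
  by (simp add: axis_def kron_def)

lemma inner_self_sum: "(\<Sum>k\<in>UNIV. u $ k * u $ k) = u \<bullet> (u :: real ^ 'n)"
  by (simp add: inner_vec_def)

text \<open>
  For a metric \<open>a \<delta>\<^sub>i\<^sub>j + b u\<^sub>i u\<^sub>j\<close> whose coefficients depend only on \<open>u \<bullet> u\<close>, all Christoffel
  symbols have this shape.
\<close>

definition radial_gamma :: "real \<Rightarrow> real \<Rightarrow> real \<Rightarrow> real ^ 'n \<Rightarrow> 'n \<Rightarrow> 'n \<Rightarrow> 'n \<Rightarrow> real" where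
  "radial_gamma A B C u k i j =
     A * (u $ i * kron j k + u $ j * kron i k) + B * (kron i j * u $ k) + C * (u $ i * u $ j * u $ k)"

text \<open>The contractions that the Ricci tensor asks for: \<open>u\<close> with the upper index,
  \<open>u\<close> with a lower index, and the trace.\<close>

lemma radial_gamma_contract:
  fixes u :: "real ^ 'n::finite" and A B C :: real
  defines "q \<equiv> u \<bullet> u"
  shows "(\<Sum>l\<in>UNIV. u $ l * radial_gamma A B C u l i k)
       = (2 * A + C * q) * (u $ i * u $ k) + B * q * kron i k" (is "?L1 = ?R1")
    and "(\<Sum>k\<in>UNIV. u $ k * radial_gamma A B C u j i k)
       = (A + B + C * q) * (u $ i * u $ j) + A * q * kron i j" (is "?L2 = ?R2")
    and "(\<Sum>k\<in>UNIV. radial_gamma A B C u k i k)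
       = ((real CARD('n) + 1) * A + B + C * q) * u $ i" (is "?L3 = ?R3")
proof -
  have "?L1 = A * u $ i * (\<Sum>l\<in>UNIV. u $ l * kron k l) + A * u $ k * (\<Sum>l\<in>UNIV. u $ l * kron i l)
     + B * kron i k * (\<Sum>l\<in>UNIV. u $ l * u $ l) + C * (u $ i * u $ k) * (\<Sum>l\<in>UNIV. u $ l * u $ l)"
    unfolding radial_gamma_def by (simp only: sum_distrib_left sum.distrib[symmetric]) (simp add: algebra_simps)
  then show "?L1 = ?R1" unfolding inner_self_sum q_def by (simp add: algebra_simps)
  have "?L2 = A * u $ i * (\<Sum>k\<in>UNIV. u $ k * kron k j) + A * kron i j * (\<Sum>k\<in>UNIV. u $ k * u $ k)
     + B * u $ j * (\<Sum>k\<in>UNIV. u $ k * kron i k) + C * (u $ i * u $ j) * (\<Sum>k\<in>UNIV. u $ k * u $ k)"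
    unfolding radial_gamma_def by (simp only: sum_distrib_left sum.distrib[symmetric]) (simp add: algebra_simps)
  then show "?L2 = ?R2" unfolding inner_self_sum q_def by (simp add: algebra_simps)
  have "?L3 = (\<Sum>k\<in>(UNIV :: 'n set). A * u $ i) + A * (\<Sum>k\<in>UNIV. u $ k * kron i k)
     + B * (\<Sum>k\<in>UNIV. u $ k * kron i k) + C * u $ i * (\<Sum>k\<in>UNIV. u $ k * u $ k)"
    unfolding radial_gamma_def by (simp only: sum_distrib_left sum.distrib[symmetric]) (simp add: algebra_simps)
  then show "?L3 = ?R3" unfolding inner_self_sum q_def by (simp add: algebra_simps)
qed

lemma radial_gamma_apply:
  fixes u :: "real ^ 'n::finite"
  shows "(\<Sum>l\<in>UNIV. radial_gamma A B C u k j l * X l)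
       = A * (u $ j * X k) + A * kron j k * (\<Sum>l\<in>UNIV. u $ l * X l) + B * (u $ k * X j)
         + C * (u $ j * u $ k) * (\<Sum>l\<in>UNIV. u $ l * X l)"
proof -
  have "(\<Sum>l\<in>UNIV. radial_gamma A B C u k j l * X l)
     = A * u $ j * (\<Sum>l\<in>UNIV. kron l k * X l) + A * kron j k * (\<Sum>l\<in>UNIV. u $ l * X l)
       + B * u $ k * (\<Sum>l\<in>UNIV. kron j l * X l) + C * (u $ j * u $ k) * (\<Sum>l\<in>UNIV. u $ l * X l)"
    unfolding radial_gamma_def by (simp only: sum_distrib_left sum.distrib[symmetric]) (simp add: algebra_simps)
  then show ?thesis by simp
qed

lemma radial_gamma_products:
  fixes u :: "real ^ 'n::finite" and A B C :: real
  defines "q \<equiv> u \<bullet> u" and "M \<equiv> (real CARD('n) + 1) * A + B + C * (u \<bullet> u)"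
  defines "G \<equiv> radial_gamma A B C u"
  shows "(\<Sum>k\<in>UNIV. \<Sum>l\<in>UNIV. G k k l * G l i j) = M * ((2 * A + C * q) * (u $ i * u $ j) + B * q * kron i j)"
    and "(\<Sum>k\<in>UNIV. \<Sum>l\<in>UNIV. G k j l * G l i k) =
      (A * M + A * (2 * A + C * q) + B * (A + B + C * q) + C * q * (2 * A + B + C * q)) * (u $ i * u $ j)
        + 2 * A * B * q * kron i j"
proof -
  have symG: "G k i j = G k j i" for k i j by (simp add: G_def radial_gamma_def kron_sym algebra_simps)
  have "(\<Sum>k\<in>UNIV. \<Sum>l\<in>UNIV. G k k l * G l i j) = (\<Sum>l\<in>UNIV. (\<Sum>k\<in>UNIV. G k k l) * G l i j)"
    by (subst sum.swap) (simp add: sum_distrib_right)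
  also have "\<dots> = (\<Sum>l\<in>UNIV. (\<Sum>k\<in>UNIV. G k l k) * G l i j)"
    by (intro sum.cong refl arg_cong2[where f = "(*)"] symG)
  also have "\<dots> = M * (\<Sum>l\<in>UNIV. u $ l * G l i j)"
    unfolding G_def radial_gamma_contract(3) M_def by (simp add: sum_distrib_left algebra_simps)
  finally show "(\<Sum>k\<in>UNIV. \<Sum>l\<in>UNIV. G k k l * G l i j) = M * ((2 * A + C * q) * (u $ i * u $ j) + B * q * kron i j)"
    unfolding G_def radial_gamma_contract(1) q_def .
  define Y where "Y k = (2 * A + C * q) * (u $ i * u $ k) + B * q * kron i k" for k
  have "(\<Sum>k\<in>UNIV. \<Sum>l\<in>UNIV. G k j l * G l i k)
     = (\<Sum>k\<in>UNIV. A * (u $ j * G k i k) + A * kron j k * Y k + B * (u $ k * G j i k) + C * (u $ j * u $ k) * Y k)"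
    unfolding G_def radial_gamma_apply radial_gamma_contract(1) Y_def q_def ..
  also have "\<dots> = A * u $ j * (\<Sum>k\<in>UNIV. G k i k) + A * (\<Sum>k\<in>UNIV. kron j k * Y k)
      + B * (\<Sum>k\<in>UNIV. u $ k * G j i k) + C * u $ j * (\<Sum>k\<in>UNIV. u $ k * Y k)"
    by (simp only: sum_distrib_left sum.distrib[symmetric]) (simp add: algebra_simps)
  also have "(\<Sum>k\<in>UNIV. u $ k * Y k) = (2 * A + C * q) * u $ i * (\<Sum>k\<in>UNIV. u $ k * u $ k) + B * q * (\<Sum>k\<in>UNIV. u $ k * kron i k)"
    unfolding Y_def by (simp only: sum_distrib_left sum.distrib[symmetric]) (simp add: algebra_simps)
  finally show "(\<Sum>k\<in>UNIV. \<Sum>l\<in>UNIV. G k j l * G l i k) =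
      (A * M + A * (2 * A + C * q) + B * (A + B + C * q) + C * q * (2 * A + B + C * q)) * (u $ i * u $ j)
        + 2 * A * B * q * kron i j"
    unfolding inner_self_sum sum_kron unfolding G_def radial_gamma_contract(2,3) Y_def M_def q_def
    by (simp add: algebra_simps kron_sym)
qed

lemma has_derivative_radial:
  assumes "(f has_real_derivative f') (at (u \<bullet> u))"
  shows "((\<lambda>x. f (x \<bullet> x)) has_derivative (\<lambda>h. f' * (2 * (u \<bullet> h)))) (at u)"
proof -
  have "((\<lambda>x. x \<bullet> x) has_derivative (\<lambda>h. 2 * (u \<bullet> h))) (at u)"
    by (rule derivative_eq_intros refl)+ (simp add: inner_commute)
  then show ?thesis
    using has_derivative_compose[of "\<lambda>x. x \<bullet> x" _ u UNIV f "(*) f'"] assms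
    by (simp add: has_field_derivative_def)
qed

lemma partial_radial_gamma:
  fixes u :: "real ^ 'n::finite"
  assumes "(A has_real_derivative A') (at (u \<bullet> u))" "(B has_real_derivative B') (at (u \<bullet> u))"
    "(C has_real_derivative C') (at (u \<bullet> u))"
  shows "partial m (\<lambda>x. radial_gamma (A (x \<bullet> x)) (B (x \<bullet> x)) (C (x \<bullet> x)) x k i j) u =
     2 * u $ m * radial_gamma A' B' C' u k i j
     + A (u \<bullet> u) * (kron m i * kron j k + kron m j * kron i k) + B (u \<bullet> u) * (kron i j * kron m k)
     + C (u \<bullet> u) * (kron m i * (u $ j * u $ k) + kron m j * (u $ i * u $ k) + kron m k * (u $ i * u $ j))"
proof -
  note D = has_derivative_radial[OF assms(1)] has_derivative_radial[OF assms(2)] has_derivative_radial[OF assms(3)]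
  have nth: "((\<lambda>x. x $ l) has_derivative (\<lambda>h. h $ l)) (at u)" for l
    by (rule bounded_linear_imp_has_derivative[OF bounded_linear_vec_nth])
  have "((\<lambda>x. radial_gamma (A (x \<bullet> x)) (B (x \<bullet> x)) (C (x \<bullet> x)) x k i j) has_derivative
    (\<lambda>h. 2 * (u \<bullet> h) * radial_gamma A' B' C' u k i j
     + A (u \<bullet> u) * (h $ i * kron j k + h $ j * kron i k) + B (u \<bullet> u) * (kron i j * h $ k)
     + C (u \<bullet> u) * (h $ i * (u $ j * u $ k) + h $ j * (u $ i * u $ k) + h $ k * (u $ i * u $ j)))) (at u)"
    unfolding radial_gamma_def
    by (rule has_derivative_eq_rhs[OF has_derivative_add[OF has_derivative_add[OF
          has_derivative_mult[OF D(1) has_derivative_add[OF has_derivative_mult_left[OF nth] has_derivative_mult_left[OF nth]]]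
          has_derivative_mult[OF D(2) has_derivative_mult_right[OF nth]]]
          has_derivative_mult[OF D(3) has_derivative_mult[OF has_derivative_mult[OF nth nth] nth]]]])
       (simp add: fun_eq_iff algebra_simps)
  from partial_eqI[OF this, of m] show ?thesis by (simp add: inner_axis axis_nth_kron)
qed

text \<open>The Ricci tensor differentiates the Christoffel symbols, so their shape has to be known
  on a neighbourhood of \<open>u\<close>. \<open>P\<close> and \<open>Q\<close> collect the
  divergence, trace and product terms.\<close>

lemma ricci_radial:
  fixes \<psi> :: "real ^ 'n \<Rightarrow> 'n::finite space"
  assumes U: "open U" "u \<in> U"
    and \<Gamma>: "\<And>x k i j. x \<in> U \<Longrightarrow> christoffel g \<psi> k i j x = radial_gamma (A (x \<bullet> x)) (B (x \<bullet> x)) (C (x \<bullet> x)) x k i j"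
    and D: "(A has_real_derivative A') (at (u \<bullet> u))" "(B has_real_derivative B') (at (u \<bullet> u))"
      "(C has_real_derivative C') (at (u \<bullet> u))"
    and defs: "q = u \<bullet> u" "N = real CARD('n)" "M = (N + 1) * A q + B q + C q * q"
      "M' = (N + 1) * A' + B' + C' * q + C q"
      "P = 2 * A q + 2 * B' * q + N * B q - M + M * B q * q - 2 * A q * B q * q"
      "Q = 4 * A' + 2 * C' * q + (N + 2) * C q - 2 * M' + M * (2 * A q + C q * q)
        - (A q * M + A q * (2 * A q + C q * q) + B q * (A q + B q + C q * q) + C q * q * (2 * A q + B q + C q * q))"
  shows "ricci g \<psi> i j u = P * kron i j + Q * (u $ i * u $ j)"
proof -
  let ?G = "radial_gamma (A q) (B q) (C q) u"
  have part: "partial m (christoffel g \<psi> k i j) u =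
     2 * u $ m * radial_gamma A' B' C' u k i j
     + A q * (kron m i * kron j k + kron m j * kron i k) + B q * (kron i j * kron m k)
     + C q * (kron m i * (u $ j * u $ k) + kron m j * (u $ i * u $ k) + kron m k * (u $ i * u $ j))" for m k i j
  proof -
    have "partial m (christoffel g \<psi> k i j) u =
       partial m (\<lambda>x. radial_gamma (A (x \<bullet> x)) (B (x \<bullet> x)) (C (x \<bullet> x)) x k i j) u"
      unfolding partial_def by (rule arg_cong[OF frechet_derivative_cong_open[OF U \<Gamma>]])
    then show ?thesis unfolding partial_radial_gamma[OF D] defs(1) .
  qed
  have s1: "(\<Sum>k\<in>UNIV. partial k (christoffel g \<psi> k i j) u) =
      (4 * A' + 2 * C' * q + (N + 2) * C q) * (u $ i * u $ j) + (2 * A q + 2 * B' * q + N * B q) * kron i j"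
  proof -
    have "(\<Sum>k\<in>UNIV. partial k (christoffel g \<psi> k i j) u) =
       2 * (\<Sum>k\<in>UNIV. u $ k * radial_gamma A' B' C' u k i j)
       + A q * (\<Sum>k\<in>UNIV. kron k i * kron j k) + A q * (\<Sum>k\<in>UNIV. kron k j * kron i k)
       + B q * kron i j * (\<Sum>k\<in>(UNIV :: 'n set). kron k k)
       + C q * u $ j * (\<Sum>k\<in>UNIV. kron k i * u $ k) + C q * u $ i * (\<Sum>k\<in>UNIV. kron k j * u $ k)
       + C q * (u $ i * u $ j) * (\<Sum>k\<in>(UNIV :: 'n set). kron k k)"
      unfolding part by (simp only: sum_distrib_left sum.distrib[symmetric]) (simp add: algebra_simps)
    then show ?thesis
      unfolding radial_gamma_contract(1) sum_kron defs(1,2) by (simp add: algebra_simps kron_sym)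
  qed
  have s2: "(\<Sum>k\<in>UNIV. partial j (christoffel g \<psi> k i k) u) = 2 * M' * (u $ i * u $ j) + M * kron i j"
  proof -
    have "(\<Sum>k\<in>UNIV. partial j (christoffel g \<psi> k i k) u) =
       2 * u $ j * (\<Sum>k\<in>UNIV. radial_gamma A' B' C' u k i k)
       + A q * kron j i * (\<Sum>k\<in>(UNIV :: 'n set). kron k k) + A q * (\<Sum>k\<in>UNIV. kron j k * kron i k)
       + B q * (\<Sum>k\<in>UNIV. kron i k * kron j k)
       + C q * kron j i * (\<Sum>k\<in>UNIV. u $ k * u $ k) + 2 * C q * u $ i * (\<Sum>k\<in>UNIV. kron j k * u $ k)"
      unfolding part by (simp only: sum_distrib_left sum.distrib[symmetric]) (simp add: algebra_simps)
    then show ?thesis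
      unfolding radial_gamma_contract(3) sum_kron inner_self_sum defs(1-4)
      by (simp add: algebra_simps kron_sym)
  qed
  have G: "christoffel g \<psi> k i j u = ?G k i j" for k i j
    using \<Gamma>[OF U(2)] defs(1) by simp
  have "ricci g \<psi> i j u = (\<Sum>k\<in>UNIV. partial k (christoffel g \<psi> k i j) u) - (\<Sum>k\<in>UNIV. partial j (christoffel g \<psi> k i k) u)
      + (\<Sum>k\<in>UNIV. \<Sum>l\<in>UNIV. ?G k k l * ?G l i j) - (\<Sum>k\<in>UNIV. \<Sum>l\<in>UNIV. ?G k j l * ?G l i k)"
    unfolding ricci_def G by (simp add: sum.distrib sum_subtractf)
  also have "\<dots> = P * kron i j + Q * (u $ i * u $ j)"
    unfolding s1 s2 radial_gamma_products defs(5,6)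
    unfolding defs(1-4) by (simp add: algebra_simps)
  finally show ?thesis .
qed

text \<open>The left side is the trace of the Ricci tensor: \<open>N - 1\<close> directions along
  the orbit with eigenvalue \<open>P / a\<close>, and the radial one with
  \<open>(P + Q * q) / E\<close>. For the right side put q = r^2, f^2 = q a and ds = sqrt E dr. Then
  df/ds is \<open>(a + q * a1) / sqrt (a * E)\<close> and the last bracket is half of f'' / f, which
  is the curvature formula of the overview.\<close>

lemma scalar_curvature_algebra:
  fixes a a1 a2 b b1 q N :: real
  assumes "a \<noteq> 0" "E \<noteq> 0" "q \<noteq> 0" "E = a + b * q"
    and "A = a1 / a" "A' = a2 / a - a1\<^sup>2 / a\<^sup>2" "B = (b - a1) / E"
      "B' = (b1 - a2) / E - (b - a1) * (a1 + b + b1 * q) / E\<^sup>2" "C = b1 / E - 2 * a1 * b / (a * E)"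
    and "M = (N + 1) * A + B + C * q" "M' = (N + 1) * A' + B' + C' * q + C"
      "P = 2 * A + 2 * B' * q + N * B - M + M * B * q - 2 * A * B * q"
      "Q = 4 * A' + 2 * C' * q + (N + 2) * C - 2 * M' + M * (2 * A + C * q)
        - (A * M + A * (2 * A + C * q) + B * (A + B + C * q) + C * q * (2 * A + B + C * q))"
  shows "(N - 1) * P / a + (P + Q * q) / E = (N - 1) * (N - 2) * (1 - (a + q * a1)\<^sup>2 / (a * E)) / (q * a)
     - 4 * (N - 1) * ((2 * a1 + q * a2) / (a * E) - (a + q * a1) * (a1 * E + a * (a1 + b + b1 * q)) / (2 * a\<^sup>2 * E\<^sup>2))"
proof -
  define h where "h = a + q * a1"
  define h1 where "h1 = 2 * a1 + q * a2"
  define E1 where "E1 = a1 + b + b1 * q"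
  define T where "T = A + B + C * q"
  note nz = assms(1-3)
  have bq: "b * q = E - a" using assms(4) by simp
  have T: "T = E1 / E - A"
  proof -
    have "T = a1 / a + (b - a1) / E + b1 * q / E - 2 * a1 * (b * q) / (a * E)"
      unfolding T_def assms(5,7,9) left_diff_distrib by simp
    also have "\<dots> = E1 / E - A"
      unfolding bq E1_def assms(5) using nz(1,2) by (simp add: field_simps)
    finally show ?thesis .
  qed
  have B: "B * q = 1 - h / E"
  proof -
    have "B * q = (b * q - a1 * q) / E" by (simp add: assms(7) left_diff_distrib)
    then show ?thesis unfolding bq h_def using nz(2) by (simp add: field_simps)
  qed
  have B1: "B' * q = h * E1 / E\<^sup>2 - h1 / E - B"
  proof -
    have "B' * q = (b1 * q - a2 * q) / E - (b * q - a1 * q) * E1 / E\<^sup>2"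
      unfolding assms(8) E1_def[symmetric]
      by (simp add: left_diff_distrib right_diff_distrib diff_divide_distrib ac_simps)
    also have "\<dots> = h * E1 / E\<^sup>2 - h1 / E - B"
      unfolding bq assms(7) h_def h1_def using nz(2)
      by (simp add: E1_def field_simps power2_eq_square)
    finally show ?thesis .
  qed
  \<comment> \<open>\<open>B'\<close> and \<open>C'\<close> cancel here, and the dimension enters
    only as the factor \<open>N - 1\<close>.\<close>
  have S: "P + Q * q = (N - 1) * (- 2 * A' * q + (T - 2 * A) + q * A * T)"
    unfolding assms(10-13) T_def by algebra
  have P: "P = - 2 * h1 / E + h * E1 / E\<^sup>2 + (N - 2) * B - (N - 3) * A * h / E"
  proof -
    have "P = 2 * (B' * q) + (N - 1) * (B - A) - (T - A - B) + ((N - 1) * A + A + T) * (B * q) - 2 * A * (B * q)"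
      unfolding assms(10,12) T_def by algebra
    also have "\<dots> = - 2 * h1 / E + h * E1 / E\<^sup>2 + (N - 2) * B - (N - 3) * A * h / E"
      unfolding B B1 T using nz(2) by (simp add: field_simps power2_eq_square)
    finally show ?thesis .
  qed
  have S': "- 2 * A' * q + (T - 2 * A) + q * A * T = - 2 * h1 / a + a1 * h / a\<^sup>2 + E1 * h / (a * E)"
    unfolding T assms(5,6) h_def h1_def using nz(1,2) by (simp add: field_simps power2_eq_square)
  have "P / a + (- 2 * A' * q + (T - 2 * A) + q * A * T) / E = (N - 2) * (1 - h\<^sup>2 / (a * E)) / (q * a)
     - 4 * (h1 / (a * E) - h * (a1 * E + a * E1) / (2 * a\<^sup>2 * E\<^sup>2))"
  proof -
    have B': "B = (1 - h / E) / q" using B nz(3) by (simp add: field_simps)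
    have a1: "a1 = (h - a) / q" using nz(3) by (simp add: h_def)
    have "P / a + (- 2 * A' * q + (T - 2 * A) + q * A * T) / E
      = (- 2 * h1 / E + h * E1 / E\<^sup>2 + (N - 2) * ((1 - h / E) / q) - (N - 3) * (a1 / a) * h / E) / a
        + (- 2 * h1 / a + a1 * h / a\<^sup>2 + E1 * h / (a * E)) / E"
      unfolding S' by (simp only: P B' assms(5))
    also have "\<dots> = (N - 2) * (1 - h\<^sup>2 / (a * E)) / (q * a)
     - 4 * (h1 / (a * E) - h * (a1 * E + a * E1) / (2 * a\<^sup>2 * E\<^sup>2))"
      unfolding a1 using nz by (simp add: divide_simps) (simp add: algebra_simps power2_eq_square)
    finally show ?thesis .
  qed
  moreover have "(N - 1) * P / a + (N - 1) * X / E = (N - 1) * (N - 2) * W / V - 4 * (N - 1) * Z"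
    if "P / a + X / E = (N - 2) * W / V - 4 * Z" for W V X Z
  proof -
    have "(N - 1) * P / a + (N - 1) * X / E = (N - 1) * (P / a + X / E)" by (simp add: distrib_left)
    moreover have "c * ((N - 2) * W / V - 4 * Z) = c * (N - 2) * W / V - 4 * c * Z" for c
      by (simp add: right_diff_distrib)
    ultimately show ?thesis unfolding that by simp
  qed
  ultimately show ?thesis
    unfolding S h_def[symmetric] h1_def[symmetric] E1_def[symmetric] by blast
qed

lemma matrix_inv_eqI:
  fixes A N :: "real ^ 'n ^ 'n"
  assumes "N ** A = mat 1"
  shows "matrix_inv A = N"
proof -
  have "A ** N = mat 1" using assms by (simp add: matrix_left_right_inverse)
  then have "invertible A" using assms by (auto simp: invertible_def)
  then have "A ** matrix_inv A = mat 1"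
    unfolding invertible_def matrix_inv_def by (rule someI2_ex) simp
  then show ?thesis using assms by (metis matrix_mul_assoc matrix_mul_lid matrix_mul_rid)
qed

lemma scalar_curvature_radial:
  fixes \<psi> :: "real ^ 'n \<Rightarrow> 'n::finite space" and a b a1 a2 b1 b2 :: "real \<Rightarrow> real"
  assumes gram: "\<And>u i j. u \<noteq> 0 \<Longrightarrow> gram g \<psi> u $ i $ j = a (u \<bullet> u) * kron i j + b (u \<bullet> u) * (u $ i * u $ j)"
    and a: "\<And>q. 0 < q \<Longrightarrow> (a has_real_derivative a1 q) (at q)" "\<And>q. 0 < q \<Longrightarrow> (a1 has_real_derivative a2 q) (at q)"
    and b: "\<And>q. 0 < q \<Longrightarrow> (b has_real_derivative b1 q) (at q)" "\<And>q. 0 < q \<Longrightarrow> (b1 has_real_derivative b2 q) (at q)"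
    and pos: "\<And>q. 0 < q \<Longrightarrow> 0 < a q" "\<And>q. 0 < q \<Longrightarrow> 0 < a q + b q * q"
    and u: "u \<noteq> 0" and defs: "q = u \<bullet> u" "N = real CARD('n)" "E = a q + b q * q"
  shows "scalar_curvature g \<psi> u = (N - 1) * (N - 2) * (1 - (a q + q * a1 q)\<^sup>2 / (a q * E)) / (q * a q)
     - 4 * (N - 1) * ((2 * a1 q + q * a2 q) / (a q * E)
        - (a q + q * a1 q) * (a1 q * E + a q * (a1 q + b q + b1 q * q)) / (2 * (a q)\<^sup>2 * E\<^sup>2))"
proof -
  \<comment> \<open>The origin is removed because the coefficients are differentiable for
    \<open>q > 0\<close> only: in the application \<open>b\<close> is a quotient by
    \<open>q\<close>.\<close>
  define U where "U = (- {0} :: (real ^ 'n) set)"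
  have U: "open U" and inU: "x \<in> U \<longleftrightarrow> x \<noteq> 0" for x by (auto simp: U_def)
  have qpos: "0 < x \<bullet> x" if "x \<in> U" for x :: "real ^ 'n" using that by (simp add: inU)
  have nz: "a (x \<bullet> x) \<noteq> 0" "a (x \<bullet> x) + b (x \<bullet> x) * (x \<bullet> x) \<noteq> 0" if "x \<in> U" for x :: "real ^ 'n"
    using pos[OF qpos[OF that]] by auto
  \<comment> \<open>The Sherman-Morrison formula for the inverse of a multiple of the identity plus
    a rank-one matrix.\<close>
  define inv where "inv x i j = (kron i j - b (x \<bullet> x) / (a (x \<bullet> x) + b (x \<bullet> x) * (x \<bullet> x)) * (x $ i * x $ j)) / a (x \<bullet> x)"
    for x :: "real ^ 'n" and i j
  have inv_apply: "(\<Sum>l\<in>UNIV. inv x k l * X l) =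
      (X k - b (x \<bullet> x) / (a (x \<bullet> x) + b (x \<bullet> x) * (x \<bullet> x)) * x $ k * (\<Sum>l\<in>UNIV. x $ l * X l)) / a (x \<bullet> x)"
    for x k and X :: "'n \<Rightarrow> real"
  proof -
    have "(\<Sum>l\<in>UNIV. inv x k l * X l) = ((\<Sum>l\<in>UNIV. kron k l * X l)
       - b (x \<bullet> x) / (a (x \<bullet> x) + b (x \<bullet> x) * (x \<bullet> x)) * x $ k * (\<Sum>l\<in>UNIV. x $ l * X l)) / a (x \<bullet> x)"
      unfolding inv_def
      by (simp only: sum_distrib_left sum_subtractf[symmetric] sum_divide_distrib) (simp add: algebra_simps)
    then show ?thesis by simp
  qed
  have matrix_inv: "matrix_inv (gram g \<psi> x) $ i $ j = inv x i j" if x: "x \<in> U" for x i j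
  proof -
    have entry: "(\<Sum>l\<in>UNIV. inv x k l * gram g \<psi> x $ l $ m) = kron k m" for k m
    proof -
      have "(\<Sum>l\<in>UNIV. x $ l * gram g \<psi> x $ l $ m) =
         a (x \<bullet> x) * (\<Sum>l\<in>UNIV. x $ l * kron l m) + b (x \<bullet> x) * x $ m * (\<Sum>l\<in>UNIV. x $ l * x $ l)"
        using x unfolding gram[OF x[unfolded inU]]
        by (simp only: sum_distrib_left sum.distrib[symmetric]) (simp add: algebra_simps)
      then have c: "(\<Sum>l\<in>UNIV. x $ l * gram g \<psi> x $ l $ m) = (a (x \<bullet> x) + b (x \<bullet> x) * (x \<bullet> x)) * x $ m"
        unfolding inner_self_sum by (simp add: algebra_simps)
      have cancel: "y / E * s * (E * t) = y * (s * t)" if "E \<noteq> 0" for y E s t :: real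
        using that by simp
      show ?thesis
        unfolding inv_apply c cancel[OF nz(2)[OF x]] unfolding gram[OF x[unfolded inU]]
        using nz(1)[OF x] by simp
    qed
    let ?N = "(\<chi> i j. inv x i j) :: real ^ 'n ^ 'n"
    have "?N ** gram g \<psi> x = mat 1"
      by (simp add: vec_eq_iff matrix_matrix_mult_def entry mat_def) (simp add: kron_def)
    then have "matrix_inv (gram g \<psi> x) = ?N" by (rule matrix_inv_eqI)
    then show ?thesis by simp
  qed
  have part: "partial k (\<lambda>x. gram g \<psi> x $ i $ j) x =
      2 * x $ k * (a1 (x \<bullet> x) * kron i j + b1 (x \<bullet> x) * (x $ i * x $ j))
       + b (x \<bullet> x) * (kron k i * x $ j + kron k j * x $ i)" if x: "x \<in> U" for x k i j
  proof -
    have nth: "((\<lambda>x. x $ l) has_derivative (\<lambda>h. h $ l)) (at x)" for l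
      by (rule bounded_linear_imp_has_derivative[OF bounded_linear_vec_nth])
    have "((\<lambda>x. a (x \<bullet> x) * kron i j + b (x \<bullet> x) * (x $ i * x $ j)) has_derivative
       (\<lambda>h. 2 * (x \<bullet> h) * (a1 (x \<bullet> x) * kron i j + b1 (x \<bullet> x) * (x $ i * x $ j))
       + b (x \<bullet> x) * (h $ i * x $ j + h $ j * x $ i))) (at x)"
      by (rule has_derivative_eq_rhs[OF has_derivative_add[OF
            has_derivative_mult_left[OF has_derivative_radial[OF a(1)[OF qpos[OF x]]]]
            has_derivative_mult[OF has_derivative_radial[OF b(1)[OF qpos[OF x]]] has_derivative_mult[OF nth nth]]]])
         (simp add: fun_eq_iff algebra_simps)
    from partial_eqI[OF this, of k]
    have "partial k (\<lambda>x. a (x \<bullet> x) * kron i j + b (x \<bullet> x) * (x $ i * x $ j)) x =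
      2 * x $ k * (a1 (x \<bullet> x) * kron i j + b1 (x \<bullet> x) * (x $ i * x $ j))
       + b (x \<bullet> x) * (kron k i * x $ j + kron k j * x $ i)"
      by (simp add: inner_axis axis_nth_kron)
    moreover have "partial k (\<lambda>x. gram g \<psi> x $ i $ j) x
       = partial k (\<lambda>x. a (x \<bullet> x) * kron i j + b (x \<bullet> x) * (x $ i * x $ j)) x"
      unfolding partial_def by (rule arg_cong[OF frechet_derivative_cong_open[OF U x]]) (simp add: inU gram)
    ultimately show ?thesis by simp
  qed
  define A where "A q = a1 q / a q" for q
  define B where "B q = (b q - a1 q) / (a q + b q * q)" for q
  define C where "C q = b1 q / (a q + b q * q) - 2 * a1 q * b q / (a q * (a q + b q * q))" for q
  have \<Gamma>: "christoffel g \<psi> k i j x = radial_gamma (A (x \<bullet> x)) (B (x \<bullet> x)) (C (x \<bullet> x)) x k i j"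
    if x: "x \<in> U" for x k i j
  proof -
    define L where "L l = a1 (x \<bullet> x) * (x $ i * kron j l + x $ j * kron i l - x $ l * kron i j)
       + b1 (x \<bullet> x) * (x $ i * x $ j * x $ l) + b (x \<bullet> x) * (kron i j * x $ l)" for l
    have "christoffel g \<psi> k i j x = (\<Sum>l\<in>UNIV. inv x k l * (2 * L l)) / 2"
      unfolding christoffel_def matrix_inv[OF x] part[OF x]
      by (intro arg_cong2[where f = "(/)"] sum.cong refl arg_cong2[where f = "(*)"])
         (simp add: L_def algebra_simps kron_sym)
    also have "\<dots> = (\<Sum>l\<in>UNIV. inv x k l * L l)"
      by (simp add: sum_divide_distrib)
    also have "\<dots> = (L k - b (x \<bullet> x) / (a (x \<bullet> x) + b (x \<bullet> x) * (x \<bullet> x)) * x $ k * (\<Sum>l\<in>UNIV. x $ l * L l)) / a (x \<bullet> x)"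
      by (rule inv_apply)
    also have "(\<Sum>l\<in>UNIV. x $ l * L l) = a1 (x \<bullet> x) * x $ i * (\<Sum>l\<in>UNIV. x $ l * kron j l)
        + a1 (x \<bullet> x) * x $ j * (\<Sum>l\<in>UNIV. x $ l * kron i l)
        + (b1 (x \<bullet> x) * (x $ i * x $ j) + b (x \<bullet> x) * kron i j - a1 (x \<bullet> x) * kron i j) * (\<Sum>l\<in>UNIV. x $ l * x $ l)"
      unfolding L_def by (simp only: sum_distrib_left sum.distrib[symmetric]) (simp add: algebra_simps)
    also have "\<dots> = 2 * a1 (x \<bullet> x) * (x $ i * x $ j)
        + (b1 (x \<bullet> x) * (x $ i * x $ j) + b (x \<bullet> x) * kron i j - a1 (x \<bullet> x) * kron i j) * (x \<bullet> x)"
      unfolding inner_self_sum sum_kron by simp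
    finally show ?thesis
      unfolding radial_gamma_def A_def B_def C_def L_def using nz[OF x]
      by (simp add: divide_simps) (simp add: algebra_simps)
  qed
  have q: "0 < q" using u by (simp add: defs(1))
  have nzq: "a q \<noteq> 0" "E \<noteq> 0" "q \<noteq> 0" using pos[OF q] q by (auto simp: defs(3))
  obtain A' B' C' where D: "(A has_real_derivative A') (at q)" "(B has_real_derivative B') (at q)"
      "(C has_real_derivative C') (at q)"
    and A': "A' = a2 q / a q - (a1 q)\<^sup>2 / (a q)\<^sup>2"
    and B': "B' = (b1 q - a2 q) / E - (b q - a1 q) * (a1 q + b q + b1 q * q) / E\<^sup>2"
  proof -
    note d = a(1)[OF q] a(2)[OF q] b(1)[OF q] b(2)[OF q]
    have dE: "((\<lambda>q. a q + b q * q) has_real_derivative a1 q + b q + b1 q * q) (at q)"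
      by (rule derivative_eq_intros d refl)+ simp
    have E: "a q + b q * q \<noteq> 0" using nzq(2) defs(3) by simp
    have "(A has_real_derivative a2 q / a q - (a1 q)\<^sup>2 / (a q)\<^sup>2) (at q)"
      unfolding A_def[abs_def] using nzq(1)
      by (intro DERIV_cong[OF DERIV_divide[OF d(2) d(1)]]) (auto simp: field_simps power2_eq_square)
    moreover have "(B has_real_derivative (b1 q - a2 q) / E - (b q - a1 q) * (a1 q + b q + b1 q * q) / E\<^sup>2) (at q)"
      unfolding B_def[abs_def] using E
      by (intro DERIV_cong[OF DERIV_divide[OF DERIV_diff[OF d(3) d(2)] dE]])
         (auto simp: defs(3) diff_divide_distrib power2_eq_square)
    \<comment> \<open>The existence of this derivative is enough, since its terms cancel in
      \<open>Q\<close>.\<close>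
    moreover obtain C' where "(C has_real_derivative C') (at q)"
    proof -
      have aE: "a q * (a q + b q * q) \<noteq> 0" using E nzq(1) by simp
      have n: "((\<lambda>q. 2 * a1 q * b q) has_real_derivative 2 * a2 q * b q + 2 * a1 q * b1 q) (at q)"
        by (rule derivative_eq_intros d refl)+ simp
      show thesis
        by (rule that, unfold C_def[abs_def])
           (rule DERIV_diff[OF DERIV_divide[OF d(4) dE E] DERIV_divide[OF n DERIV_mult[OF d(1) dE] aE]])
    qed
    ultimately show thesis by (rule that[OF _ _ _ refl refl])
  qed
  note D' = D[unfolded defs(1)]
  define M where "M = (N + 1) * A q + B q + C q * q"
  define M' where "M' = (N + 1) * A' + B' + C' * q + C q"
  define P where "P = 2 * A q + 2 * B' * q + N * B q - M + M * B q * q - 2 * A q * B q * q"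
  define Q where "Q = 4 * A' + 2 * C' * q + (N + 2) * C q - 2 * M' + M * (2 * A q + C q * q)
        - (A q * M + A q * (2 * A q + C q * q) + B q * (A q + B q + C q * q) + C q * q * (2 * A q + B q + C q * q))"
  have uU: "u \<in> U" using u by (simp add: inU)
  have ric: "ricci g \<psi> i j u = P * kron i j + Q * (u $ i * u $ j)" for i j
    by (rule ricci_radial[OF U uU \<Gamma> D' defs(1,2) M_def M'_def P_def Q_def])
  have "scalar_curvature g \<psi> u = (\<Sum>i\<in>UNIV. \<Sum>j\<in>UNIV. inv u i j * (P * kron i j + Q * (u $ i * u $ j)))"
    unfolding scalar_curvature_def ric matrix_inv[OF uU] ..
  also have "\<dots> = (\<Sum>i\<in>UNIV. (P * kron i i + Q * (u $ i * u $ i) - b q / E * u $ i * ((P + Q * q) * u $ i)) / a q)"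
  proof (rule sum.cong[OF refl])
    fix i
    have "(\<Sum>j\<in>UNIV. u $ j * (P * kron i j + Q * (u $ i * u $ j)))
       = P * (\<Sum>j\<in>UNIV. u $ j * kron i j) + Q * u $ i * (\<Sum>j\<in>UNIV. u $ j * u $ j)"
      by (simp only: sum_distrib_left sum.distrib[symmetric]) (simp add: algebra_simps)
    then have "(\<Sum>j\<in>UNIV. u $ j * (P * kron i j + Q * (u $ i * u $ j))) = (P + Q * q) * u $ i"
      unfolding inner_self_sum defs(1) by (simp add: algebra_simps)
    then show "(\<Sum>j\<in>UNIV. inv u i j * (P * kron i j + Q * (u $ i * u $ j))) =
      (P * kron i i + Q * (u $ i * u $ i) - b q / E * u $ i * ((P + Q * q) * u $ i)) / a q"
      unfolding inv_apply by (simp add: defs(1,3))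
  qed
  also have "\<dots> = (P * (\<Sum>i\<in>(UNIV :: 'n set). 1) + (Q - b q / E * (P + Q * q)) * (\<Sum>i\<in>UNIV. u $ i * u $ i)) / a q"
    by (simp only: sum_distrib_left sum.distrib[symmetric] sum_divide_distrib) (simp add: algebra_simps)
  also have "\<dots> = (N * P + Q * q - (b q * q) / E * (P + Q * q)) / a q"
    unfolding inner_self_sum by (simp add: defs(1,2) algebra_simps add_divide_distrib)
  also have "\<dots> = (N - 1) * P / a q + (P + Q * q) / E"
  proof -
    have bq: "b q * q = E - a q" by (simp add: defs(3))
    show ?thesis unfolding bq using nzq(1,2) by (simp add: field_simps)
  qed
  also have "\<dots> = (N - 1) * (N - 2) * (1 - (a q + q * a1 q)\<^sup>2 / (a q * E)) / (q * a q)
     - 4 * (N - 1) * ((2 * a1 q + q * a2 q) / (a q * E)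
        - (a q + q * a1 q) * (a1 q * E + a q * (a1 q + b q + b1 q * q)) / (2 * (a q)\<^sup>2 * E\<^sup>2))"
    by (rule scalar_curvature_algebra[OF nzq defs(3) _ A' _ B' _ M_def M'_def P_def Q_def])
       (simp_all add: A_def B_def C_def defs(3))
  finally show ?thesis .
qed

subsection \<open>Scalar curvature of a rotationally symmetric surface\<close>

lemma partial_one_variable:
  fixes f :: "real ^ 'n::finite \<Rightarrow> real"
  assumes "open U" "u \<in> U" "\<And>x. x \<in> U \<Longrightarrow> f x = h (x $ i)" "(h has_real_derivative h') (at (u $ i))"
  shows "partial k f u = (if k = i then h' else 0)"
proof -
  have nth: "((\<lambda>x. x $ i) has_derivative (\<lambda>x. x $ i)) (at u)"
    by (rule bounded_linear_imp_has_derivative[OF bounded_linear_vec_nth])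
  have "((\<lambda>x. h (x $ i)) has_derivative (\<lambda>x. h' * x $ i)) (at u)"
    using has_derivative_compose[OF nth, of h "(*) h'"] assms(4) by (simp add: has_field_derivative_def)
  then have "partial k (\<lambda>x. h (x $ i)) u = h' * axis k 1 $ i" by (rule partial_eqI)
  moreover have "partial k f u = partial k (\<lambda>x. h (x $ i)) u"
    unfolding partial_def by (rule arg_cong[OF frechet_derivative_cong_open[OF assms(1-3)]])
  ultimately show ?thesis by (simp add: axis_def)
qed

text \<open>The symbols \<open>p\<close> and \<open>q\<close> cancel in the trace, so that
  \<open>E\<close> and \<open>F\<close> enter the result through the determinant \<open>D\<close>
  and its derivative alone.\<close>

lemma scalar_curvature_surface_algebra:
  fixes D E F G :: real
  assumes D: "D = E * G - F * F" "D \<noteq> 0" and D1: "D1 = E1 * G + E * G1 - 2 * F * F1"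
    and m: "m = G1 / (2 * D)" "m1 = G2 / (2 * D) - G1 * D1 / (2 * D\<^sup>2)"
  shows "(G * (- (E1 * m + E * m1) + E * m * p + 2 * F * m * q - (E * m)\<^sup>2)
     - 2 * F * (- (F1 * m + F * m1) - E * F * m\<^sup>2 + G * m * q)
     + E * (- (G1 * m + G * m1) - G * m * p + E * G * m\<^sup>2 - 2 * F\<^sup>2 * m\<^sup>2)) / D
     = - G2 / D + G1 * D1 / (2 * D\<^sup>2)" (is "?L / D = _")
proof -
  have "?L = - 2 * D * m1 - m * D1"
    unfolding D(1) D1 by algebra
  also have "(- 2 * D * m1 - m * D1) / D = - G2 / D + G1 * D1 / (2 * D\<^sup>2)"
    unfolding m using D(2) by (simp add: field_simps power2_eq_square)
  finally show ?thesis .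
qed

text \<open>When the metric depends on one coordinate only, put f = sqrt G, the speed of the other
  coordinate lines; arc length orthogonal to these is ds = sqrt (D / G) dt. In these terms the right
  side is - 2 f'' / f, twice the Gauss curvature, with the cross term \<open>F\<close> absorbed in
  \<open>D\<close>.\<close>

lemma scalar_curvature_surface:
  fixes \<psi> :: "real ^ 'n \<Rightarrow> 'n::finite space" and E F G :: "real \<Rightarrow> real"
  assumes ij: "UNIV = {i, j :: 'n}" "i \<noteq> j" and U: "open U" "\<And>x. x \<in> U \<Longrightarrow> x $ i \<in> T"
    and gram: "\<And>x. x \<in> U \<Longrightarrow> gram g \<psi> x $ i $ i = E (x $ i)" "\<And>x. x \<in> U \<Longrightarrow> gram g \<psi> x $ i $ j = F (x $ i)"
      "\<And>x. x \<in> U \<Longrightarrow> gram g \<psi> x $ j $ i = F (x $ i)" "\<And>x. x \<in> U \<Longrightarrow> gram g \<psi> x $ j $ j = G (x $ i)"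
    and d1: "\<And>t. t \<in> T \<Longrightarrow> (E has_real_derivative E1 t) (at t)" "\<And>t. t \<in> T \<Longrightarrow> (F has_real_derivative F1 t) (at t)"
      "\<And>t. t \<in> T \<Longrightarrow> (G has_real_derivative G1 t) (at t)"
    and d2: "\<And>t. t \<in> T \<Longrightarrow> (E1 has_real_derivative E2 t) (at t)" "\<And>t. t \<in> T \<Longrightarrow> (F1 has_real_derivative F2 t) (at t)"
      "\<And>t. t \<in> T \<Longrightarrow> (G1 has_real_derivative G2 t) (at t)"
    and D: "\<And>t. D t = E t * G t - F t * F t" "\<And>t. t \<in> T \<Longrightarrow> D t \<noteq> 0"
    and D1: "\<And>t. D1 t = E1 t * G t + E t * G1 t - 2 * F t * F1 t"
    and u: "u \<in> U" "t = u $ i"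
  shows "scalar_curvature g \<psi> u = - G2 t / D t + G1 t * D1 t / (2 * (D t)\<^sup>2)"
proof -
  have sum2: "(\<Sum>k\<in>UNIV. f k) = f i + f j" for f :: "'n \<Rightarrow> real"
    unfolding ij(1) using ij(2) by simp
  have nz: "D (x $ i) \<noteq> 0" if "x \<in> U" for x using U(2)[OF that] D(2) by blast
  have all: "k = i \<or> k = j" for k using ij(1) by auto
  have inv: "matrix_inv (gram g \<psi> x) $ i $ i = G (x $ i) / D (x $ i)"
      "matrix_inv (gram g \<psi> x) $ i $ j = - F (x $ i) / D (x $ i)"
      "matrix_inv (gram g \<psi> x) $ j $ i = - F (x $ i) / D (x $ i)"
      "matrix_inv (gram g \<psi> x) $ j $ j = E (x $ i) / D (x $ i)" if x: "x \<in> U" for x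
  proof -
    define N :: "real ^ 'n ^ 'n" where "N = (\<chi> k l. if k = i then (if l = i then G (x $ i) else - F (x $ i)) / D (x $ i)
        else (if l = i then - F (x $ i) else E (x $ i)) / D (x $ i))"
    have N: "N $ i $ i = G (x $ i) / D (x $ i)" "N $ i $ j = - F (x $ i) / D (x $ i)"
      "N $ j $ i = - F (x $ i) / D (x $ i)" "N $ j $ j = E (x $ i) / D (x $ i)"
      using ij(2) by (auto simp: N_def)
    have d: "E (x $ i) * G (x $ i) = D (x $ i) + F (x $ i) * F (x $ i)" by (simp add: D(1))
    have "(N ** gram g \<psi> x) $ k $ l = mat 1 $ k $ l" for k l
      using all[of k] all[of l] ij(2) ij(2)[symmetric] nz[OF x] d
      by (auto simp: matrix_matrix_mult_def sum2 N gram[OF x] mat_def divide_simps)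
         (auto simp: algebra_simps)
    then have "N ** gram g \<psi> x = mat 1" by (simp add: vec_eq_iff)
    then have "matrix_inv (gram g \<psi> x) = N" by (rule matrix_inv_eqI)
    then show "matrix_inv (gram g \<psi> x) $ i $ i = G (x $ i) / D (x $ i)"
      "matrix_inv (gram g \<psi> x) $ i $ j = - F (x $ i) / D (x $ i)"
      "matrix_inv (gram g \<psi> x) $ j $ i = - F (x $ i) / D (x $ i)"
      "matrix_inv (gram g \<psi> x) $ j $ j = E (x $ i) / D (x $ i)" by (simp_all add: N)
  qed
  have part: "partial k (\<lambda>x. gram g \<psi> x $ i $ i) x = (if k = i then E1 (x $ i) else 0)"
    "partial k (\<lambda>x. gram g \<psi> x $ i $ j) x = (if k = i then F1 (x $ i) else 0)"
    "partial k (\<lambda>x. gram g \<psi> x $ j $ i) x = (if k = i then F1 (x $ i) else 0)"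
    "partial k (\<lambda>x. gram g \<psi> x $ j $ j) x = (if k = i then G1 (x $ i) else 0)" if x: "x \<in> U" for x k
    using partial_one_variable[OF U(1) x gram(1) d1(1)[OF U(2)[OF x]]]
      partial_one_variable[OF U(1) x gram(2) d1(2)[OF U(2)[OF x]]]
      partial_one_variable[OF U(1) x gram(3) d1(2)[OF U(2)[OF x]]]
      partial_one_variable[OF U(1) x gram(4) d1(3)[OF U(2)[OF x]]] by auto
  \<comment> \<open>\<open>p\<close> and \<open>q\<close> are the symbols with both lower indices
    \<open>i\<close>; all others are, up to sign, a metric coefficient times
    \<open>m\<close>.\<close>
  define m where "m t = G1 t / (2 * D t)" for t
  define p where "p t = (G t * E1 t / 2 - F t * F1 t) / D t" for t
  define q where "q t = (E t * F1 t - F t * E1 t / 2) / D t" for t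
  have ji: "j \<noteq> i" using ij(2) by simp
  have chr: "christoffel g \<psi> i i i x = p (x $ i)" "christoffel g \<psi> j i i x = q (x $ i)"
    "christoffel g \<psi> i i j x = - (F (x $ i) * m (x $ i))" "christoffel g \<psi> i j i x = - (F (x $ i) * m (x $ i))"
    "christoffel g \<psi> j i j x = E (x $ i) * m (x $ i)" "christoffel g \<psi> j j i x = E (x $ i) * m (x $ i)"
    "christoffel g \<psi> i j j x = - (G (x $ i) * m (x $ i))" "christoffel g \<psi> j j j x = F (x $ i) * m (x $ i)"
    if x: "x \<in> U" for x
    unfolding christoffel_def sum2 inv[OF x] part[OF x]
    using nz[OF x] ij(2) ji
    by (simp_all add: p_def q_def m_def) (simp_all add: field_simps)
  have tT: "t \<in> T" using U(2)[OF u(1)] u(2) by simp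
  have Dt: "D t \<noteq> 0" by (rule D(2)[OF tT])
  have D1t: "(D has_real_derivative D1 t) (at t)"
  proof -
    have "((\<lambda>t. E t * G t - F t * F t) has_real_derivative D1 t) (at t)"
      by (rule derivative_eq_intros d1[OF tT] refl)+ (simp add: D1)
    then show ?thesis by (simp add: D(1)[abs_def])
  qed
  define m1 where "m1 = G2 t / (2 * D t) - G1 t * D1 t / (2 * (D t)\<^sup>2)"
  have m1: "(m has_real_derivative m1) (at t)"
    unfolding m_def[abs_def]
    by (rule derivative_eq_intros d2[OF tT] D1t refl)+
       (use Dt in \<open>auto simp: m1_def field_simps power2_eq_square\<close>)
  \<comment> \<open>The values of \<open>p1\<close> and \<open>q1\<close> can stay open:
    \<open>p1\<close> cancels in the Ricci component \<open>i i\<close>, and the symbol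
    \<open>q\<close> is differentiated only in direction \<open>j\<close>, on which nothing
    depends.\<close>
  obtain p1 where p1: "(p has_real_derivative p1) (at t)"
    by (rule that, unfold p_def[abs_def])
       (rule DERIV_divide[OF DERIV_diff[OF DERIV_cdivide[OF DERIV_mult[OF d1(3)[OF tT] d2(1)[OF tT]]]
          DERIV_mult[OF d1(2)[OF tT] d2(2)[OF tT]]] D1t Dt])
  obtain q1 where q1: "(q has_real_derivative q1) (at t)"
    by (rule that, unfold q_def[abs_def])
       (rule DERIV_divide[OF DERIV_diff[OF DERIV_mult[OF d1(1)[OF tT] d2(2)[OF tT]]
          DERIV_cdivide[OF DERIV_mult[OF d1(2)[OF tT] d2(1)[OF tT]]]] D1t Dt])
  have pm: "partial k f u = (if k = i then h' else 0)"
    if "(h has_real_derivative h') (at t)" "\<And>x. x \<in> U \<Longrightarrow> f x = h (x $ i)" for f h h' k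
    by (rule partial_one_variable[OF U(1) u(1)]) (use that u(2) in auto)
  have dm: "((\<lambda>t. E t * m t) has_real_derivative E1 t * m t + E t * m1) (at t)"
    "((\<lambda>t. F t * m t) has_real_derivative F1 t * m t + F t * m1) (at t)"
    "((\<lambda>t. - (F t * m t)) has_real_derivative - (F1 t * m t + F t * m1)) (at t)"
    "((\<lambda>t. - (G t * m t)) has_real_derivative - (G1 t * m t + G t * m1)) (at t)"
    by (rule derivative_eq_intros d1[OF tT] m1 refl | simp)+
  have pc: "partial k (christoffel g \<psi> i i i) u = (if k = i then p1 else 0)"
    "partial k (christoffel g \<psi> j i i) u = (if k = i then q1 else 0)"
    "partial k (christoffel g \<psi> i i j) u = (if k = i then - (F1 t * m t + F t * m1) else 0)"
    "partial k (christoffel g \<psi> i j i) u = (if k = i then - (F1 t * m t + F t * m1) else 0)"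
    "partial k (christoffel g \<psi> j i j) u = (if k = i then E1 t * m t + E t * m1 else 0)"
    "partial k (christoffel g \<psi> j j i) u = (if k = i then E1 t * m t + E t * m1 else 0)"
    "partial k (christoffel g \<psi> i j j) u = (if k = i then - (G1 t * m t + G t * m1) else 0)"
    "partial k (christoffel g \<psi> j j j) u = (if k = i then F1 t * m t + F t * m1 else 0)" for k
    by (rule pm[OF p1], erule chr, rule pm[OF q1], erule chr, rule pm[OF dm(3)], erule chr,
        rule pm[OF dm(3)], erule chr, rule pm[OF dm(1)], erule chr, rule pm[OF dm(1)], erule chr,
        rule pm[OF dm(4)], erule chr, rule pm[OF dm(2)], erule chr)
  have ric: "ricci g \<psi> i i u = - (E1 t * m t + E t * m1) + E t * m t * p t + 2 * F t * m t * q t - (E t * m t)\<^sup>2"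
    "ricci g \<psi> i j u = - (F1 t * m t + F t * m1) - E t * F t * (m t)\<^sup>2 + G t * m t * q t"
    "ricci g \<psi> j i u = - (F1 t * m t + F t * m1) - E t * F t * (m t)\<^sup>2 + G t * m t * q t"
    "ricci g \<psi> j j u = - (G1 t * m t + G t * m1) - G t * m t * p t + E t * G t * (m t)\<^sup>2 - 2 * (F t)\<^sup>2 * (m t)\<^sup>2"
    unfolding ricci_def sum2 pc chr[OF u(1)] u(2)[symmetric] using ji
    by (simp_all add: algebra_simps power2_eq_square)
  have "scalar_curvature g \<psi> u =
     (G t * (- (E1 t * m t + E t * m1) + E t * m t * p t + 2 * F t * m t * q t - (E t * m t)\<^sup>2)
     - 2 * F t * (- (F1 t * m t + F t * m1) - E t * F t * (m t)\<^sup>2 + G t * m t * q t)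
     + E t * (- (G1 t * m t + G t * m1) - G t * m t * p t + E t * G t * (m t)\<^sup>2 - 2 * (F t)\<^sup>2 * (m t)\<^sup>2)) / D t"
    unfolding scalar_curvature_def sum2 inv[OF u(1)] ric u(2)[symmetric]
    by (simp add: add_divide_distrib diff_divide_distrib)
  also have "\<dots> = - G2 t / D t + G1 t * D1 t / (2 * (D t)\<^sup>2)"
    by (rule scalar_curvature_surface_algebra[OF D(1) Dt D1 m_def m1_def])
  finally show ?thesis .
qed

subsection \<open>The slope of the profile curve\<close>

lemma smooth_real_deriv:
  fixes f :: "real \<Rightarrow> real"
  assumes "\<And>k. C_on k f UNIV"
  shows "(f has_real_derivative deriv f x) (at x)" "C_on k (deriv f) UNIV"
proof -
  obtain f' where f': "\<And>x. (f has_real_derivative f' x) (at x)" "\<And>k. C_on k f' UNIV"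
    using C_on_real_derivs[OF assms] by metis
  then have "deriv f = f'" by (auto simp: DERIV_imp_deriv)
  then show "(f has_real_derivative deriv f x) (at x)" "C_on k (deriv f) UNIV" using f' by simp_all
qed

text \<open>The bracket is the one in which both curvature formulas display the second derivative of
  the profile, so its sign passes directly to the derivative of \<open>slope\<close>.\<close>

lemma has_real_derivative_quotient_sqrt:
  fixes G D :: "real \<Rightarrow> real"
  assumes "(G has_real_derivative G') (at t)" "(D has_real_derivative D') (at t)" "0 < D t"
  shows "((\<lambda>t. G t / sqrt (D t)) has_real_derivative
     (G' / D t - G t * D' / (2 * (D t)\<^sup>2)) * sqrt (D t)) (at t)"
proof -
  have s: "sqrt (D t) \<noteq> 0" "sqrt (D t) * sqrt (D t) = D t" using assms(3) by simp_all
  have "((\<lambda>t. sqrt (D t)) has_real_derivative (inverse (sqrt (D t)) / 2 * D')) (at t)"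
    by (rule DERIV_chain2[OF DERIV_real_sqrt[OF assms(3)] assms(2)])
  from DERIV_divide[OF assms(1) this s(1)] show ?thesis
  proof (rule DERIV_cong)
    obtain w where w: "w = sqrt (D t)" "w \<noteq> 0" "D t = w * w" using s by metis
    show "(G' * sqrt (D t) - G t * (inverse (sqrt (D t)) / 2 * D')) / (sqrt (D t) * sqrt (D t))
      = (G' / D t - G t * D' / (2 * (D t)\<^sup>2)) * sqrt (D t)"
      unfolding w(1)[symmetric] w(3) using w(2) by (simp add: field_simps power2_eq_square)
  qed
qed

context rot_metric
begin

lemmas cA_deriv = smooth_real_deriv(1)[OF coefficients_C_on(1)]
  and cA_deriv2 = smooth_real_deriv(1)[OF smooth_real_deriv(2)[OF coefficients_C_on(1)]]
  and cE_deriv = smooth_real_deriv(1)[OF coefficients_C_on(2)]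
  and cE_deriv2 = smooth_real_deriv(1)[OF smooth_real_deriv(2)[OF coefficients_C_on(2)]]
  and cF_deriv = smooth_real_deriv(1)[OF coefficients_C_on(3)]
  and cF_deriv2 = smooth_real_deriv(1)[OF smooth_real_deriv(2)[OF coefficients_C_on(3)]]

text \<open>
  The orbit through \<open>axis i1 r\<close> is a round sphere of radius \<open>f = r sqrt (cA r)\<close>, and \<open>slope\<close> is the
  derivative of \<open>f\<close> with respect to arc length orthogonal to the orbits.
\<close>

definition slope :: "real \<Rightarrow> real" where
  "slope r = (cA r + r * deriv cA r / 2) / sqrt (disc r)"

definition polar :: "real ^ 'n \<Rightarrow> real ^ 'n" where
  "polar u = plane_rot i1 i2 (u $ i2) (axis i1 (u $ i1))"

lemma polar_eq: "polar u = axis i1 (u $ i1 * cos (u $ i2)) + axis i2 (u $ i1 * sin (u $ i2))"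
  unfolding polar_def plane_rot_axis(2)[OF i12] by (simp add: mult.commute)

lemma axis_scaleR: "axis i (x :: real) = x *\<^sub>R axis i 1"
  by (simp add: vec_eq_iff axis_def)

lemma polar_has_derivative:
  "(polar has_derivative (\<lambda>h. plane_rot i1 i2 (u $ i2) (axis i1 (h $ i1) + axis i2 (u $ i1 * h $ i2)))) (at u)"
proof -
  have nth: "((\<lambda>x. x $ i) has_derivative (\<lambda>x. x $ i)) (at u)" for i :: 'n
    by (rule bounded_linear_imp_has_derivative[OF bounded_linear_vec_nth])
  have co: "((\<lambda>x. cos (x $ i2)) has_derivative (\<lambda>x. x $ i2 * - sin (u $ i2))) (at u)"
    and si: "((\<lambda>x. sin (x $ i2)) has_derivative (\<lambda>x. x $ i2 * cos (u $ i2))) (at u)"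
    by (rule has_derivative_eq_rhs[OF has_derivative_cos[OF nth]], simp)
       (rule has_derivative_eq_rhs[OF has_derivative_sin[OF nth]], simp)
  have d: "((\<lambda>u. (u $ i1 * cos (u $ i2)) *\<^sub>R (axis i1 1 :: real ^ 'n) + (u $ i1 * sin (u $ i2)) *\<^sub>R axis i2 1) has_derivative
     (\<lambda>h. (u $ i1 * (h $ i2 * - sin (u $ i2)) + h $ i1 * cos (u $ i2)) *\<^sub>R axis i1 1
        + (u $ i1 * (h $ i2 * cos (u $ i2)) + h $ i1 * sin (u $ i2)) *\<^sub>R axis i2 1)) (at u)"
    by (rule has_derivative_add[OF has_derivative_scaleR_left[OF has_derivative_mult[OF nth co]]
        has_derivative_scaleR_left[OF has_derivative_mult[OF nth si]]])
  have f: "(\<lambda>u. (u $ i1 * cos (u $ i2)) *\<^sub>R axis i1 1 + (u $ i1 * sin (u $ i2)) *\<^sub>R axis i2 1) = polar"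
    unfolding fun_eq_iff polar_eq by (simp add: axis_scaleR[symmetric])
  have e: "(u $ i1 * (h $ i2 * - sin (u $ i2)) + h $ i1 * cos (u $ i2)) *\<^sub>R axis i1 1
        + (u $ i1 * (h $ i2 * cos (u $ i2)) + h $ i1 * sin (u $ i2)) *\<^sub>R axis i2 1
      = plane_rot i1 i2 (u $ i2) (axis i1 (h $ i1) + axis i2 (u $ i1 * h $ i2))" for h :: "real ^ 'n"
    unfolding linear_add[OF linear_plane_rot] plane_rot_axis(2,3)[OF i12]
    by (simp add: axis_scaleR[of _ "_ * _"] axis_scaleR[of _ "- _"] algebra_simps)
  show ?thesis using d unfolding f e .
qed

text \<open>Angles between -1 and 1 stay inside (-pi/2, pi/2), where the sine determines the angle.
  The curvature will be evaluated at angle 0.\<close>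

definition polar_domain :: "(real ^ 'n) set" where
  "polar_domain = {u. 0 < u $ i1} \<inter> {u. - 1 < u $ i2} \<inter> {u. u $ i2 < 1}"

lemma open_polar_domain: "open polar_domain"
  unfolding polar_domain_def
  by (intro open_Int open_Collect_less continuous_intros)

lemma local_param_polar:
  assumes univ: "UNIV = {i1, i2}"
  shows "local_param polar_domain (\<lambda>u. stereo (polar u))"
  unfolding local_param_def
proof (intro conjI ballI)
  show "open polar_domain" by (rule open_polar_domain)
  have nth: "C_on k (\<lambda>u. u $ i) UNIV" for k and i :: 'n
    by (rule C_on_linear_id[OF bounded_linear_vec_nth open_UNIV])
  have "C_on k (\<lambda>u. (u $ i1 * cos (u $ i2)) *\<^sub>R axis i1 1 + (u $ i1 * sin (u $ i2)) *\<^sub>R (axis i2 1 :: real ^ 'n)) UNIV" for k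
    using C_on_sin_cos
    by (intro C_on_add C_on_scaleR C_on_mult C_on_const nth open_UNIV
        C_on_compose[OF open_UNIV open_UNIV _ nth]) auto
  then have "C_on k polar UNIV" for k
    unfolding polar_eq[abs_def] axis_scaleR[of _ "_ * _"] .
  then have "C_on k (\<lambda>u. stereo (polar u)) UNIV" for k
    using stereo_smooth C_on_compose[OF open_UNIV open_UNIV, of polar k stereo]
    unfolding smooth_on_def by auto
  then show "smooth_on polar_domain (\<lambda>u. stereo (polar u))"
    unfolding smooth_on_def using C_on_subset[OF _ open_UNIV open_polar_domain] by blast
  show "(\<lambda>u. stereo (polar u)) ` polar_domain \<subseteq> unit_sphere"
    using stereo_in_sphere by blast
  show "inj_on (\<lambda>u. stereo (polar u)) polar_domain"
  proof (rule inj_onI)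
    fix u v assume uv: "u \<in> polar_domain" "v \<in> polar_domain" "stereo (polar u) = stereo (polar v)"
    then have eq: "polar u = polar v" using inj_stereo by (auto dest: injD)
    have "norm (polar w) = \<bar>w $ i1\<bar>" for w
      using orthogonal_transformation_norm[OF orthogonal_plane_rot[OF i12]] by (simp add: polar_def)
    then have "\<bar>u $ i1\<bar> = \<bar>v $ i1\<bar>" using eq by metis
    then have 1: "u $ i1 = v $ i1" "0 < v $ i1" using uv by (auto simp: polar_domain_def)
    have "polar w $ i2 = w $ i1 * sin (w $ i2)" for w
      using i12 by (simp add: polar_eq axis_def)
    then have "sin (u $ i2) = sin (v $ i2)" using eq 1 by (metis mult_cancel_left less_irrefl)
    moreover have "- (pi / 2) \<le> w $ i2" "w $ i2 \<le> pi / 2" if "w \<in> polar_domain" for w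
      using that pi_gt3 by (auto simp: polar_domain_def)
    ultimately have "u $ i2 = v $ i2" using uv sin_inj_pi by blast
    then show "u = v" using 1 univ by (metis insertE UNIV_I singletonD vec_eq_iff)
  qed
  show "inj (frechet_derivative (\<lambda>u. stereo (polar u)) (at u))" if u: "u \<in> polar_domain" for u
  proof -
    let ?D = "\<lambda>h. dstereo (polar u) (plane_rot i1 i2 (u $ i2) (axis i1 (h $ i1) + axis i2 (u $ i1 * h $ i2)))"
    have D: "((\<lambda>u. stereo (polar u)) has_derivative ?D) (at u)"
      by (rule has_derivative_compose[OF polar_has_derivative stereo_has_derivative])
    have "h = 0" if "?D h = 0" for h
    proof -
      have "plane_rot i1 i2 (u $ i2) (axis i1 (h $ i1) + axis i2 (u $ i1 * h $ i2)) = 0"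
        using dstereo_inj[OF that] .
      then have z: "axis i1 (h $ i1) + axis i2 (u $ i1 * h $ i2) = 0"
        using orthogonal_transformation_norm[OF orthogonal_plane_rot[OF i12]] by (metis norm_eq_zero)
      have "h $ i1 = 0" "u $ i1 * h $ i2 = 0"
        using arg_cong[OF z, of "\<lambda>x. x $ i1"] arg_cong[OF z, of "\<lambda>x. x $ i2"] i12
        by (auto simp: axis_def)
      then have "h $ i1 = 0" "h $ i2 = 0" using u by (auto simp: polar_domain_def)
      then show ?thesis using univ by (metis insertE UNIV_I singletonD vec_eq_iff zero_index)
    qed
    then have "inj ?D" using linear_injective_0[OF has_derivative_linear[OF D]] by blast
    then show ?thesis using frechet_derivative_at[OF D] by simp
  qed
qed

text \<open>The angle acts by an isometry, which can be stripped from the base point and from both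
  tangent vectors, so the coefficients depend on the radius alone. The powers of the radius stem
  from the derivative in the angle.\<close>

lemma gram_polar:
  shows "gram g (\<lambda>u. stereo (polar u)) u $ i1 $ i1 = cE (u $ i1)"
    "gram g (\<lambda>u. stereo (polar u)) u $ i1 $ i2 = u $ i1 * cF (u $ i1)"
    "gram g (\<lambda>u. stereo (polar u)) u $ i2 $ i1 = u $ i1 * cF (u $ i1)"
    "gram g (\<lambda>u. stereo (polar u)) u $ i2 $ i2 = (u $ i1)\<^sup>2 * cA (u $ i1)"
proof -
  let ?R = "plane_rot i1 i2 (u $ i2)"
  have p: "partial i (\<lambda>u. stereo (polar u)) u =
     dstereo (polar u) (?R (axis i1 (axis i 1 $ i1) + axis i2 (u $ i1 * axis i 1 $ i2)))" for i
    by (rule partial_eqI[OF has_derivative_compose[OF polar_has_derivative stereo_has_derivative]])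
  have n: "axis i1 (1::real) $ i1 = 1" "axis i1 (1::real) $ i2 = 0" "axis i2 (1::real) $ i1 = 0" "axis i2 (1::real) $ i2 = 1"
    using i12 by (simp_all add: axis_def)
  have p1: "partial i1 (\<lambda>u. stereo (polar u)) u = dstereo (polar u) (?R (axis i1 1))"
    and p2: "partial i2 (\<lambda>u. stereo (polar u)) u = dstereo (polar u) (?R (u $ i1 *\<^sub>R axis i2 1))"
    unfolding p n by (simp_all add: axis_scaleR[of i2 "u $ i1", symmetric])
  show "gram g (\<lambda>u. stereo (polar u)) u $ i1 $ i1 = cE (u $ i1)"
    "gram g (\<lambda>u. stereo (polar u)) u $ i1 $ i2 = u $ i1 * cF (u $ i1)"
    "gram g (\<lambda>u. stereo (polar u)) u $ i2 $ i1 = u $ i1 * cF (u $ i1)"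
    "gram g (\<lambda>u. stereo (polar u)) u $ i2 $ i2 = (u $ i1)\<^sup>2 * cA (u $ i1)"
    unfolding gram_def vec_lambda_beta p1 p2 form_def[symmetric]
    unfolding polar_def form_plane_rot[OF i12]
    by (simp_all add: linear_scale[OF form_linear_left] linear_scale[OF form_linear_right]
        cE_def cF_def cA_def power2_eq_square form_sym[of _ "axis i2 1" "axis i1 1"])
qed

text \<open>In the polar chart \<open>slope\<close> is \<open>G1 / (2 * sqrt D)\<close> at positive
  radius, and the scalar curvature is -2 / sqrt D times its derivative. In dimension two the slope
  is therefore nonincreasing whatever its size.\<close>

lemma slope_deriv_surface:
  assumes univ: "UNIV = {i1, i2}" and R: "nonneg_scalar_curvature g" and r: "0 < r"
  obtains d where "(slope has_real_derivative d) (at r)" "d \<le> 0"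
proof -
  define G1 where "G1 t = 2 * t * cA t + t\<^sup>2 * deriv cA t" for t
  define G2 where "G2 t = 2 * cA t + 4 * t * deriv cA t + t\<^sup>2 * deriv (deriv cA) t" for t
  define F1 where "F1 t = cF t + t * deriv cF t" for t
  define F2 where "F2 t = 2 * deriv cF t + t * deriv (deriv cF) t" for t
  define D where "D t = cE t * (t\<^sup>2 * cA t) - (t * cF t) * (t * cF t)" for t
  define D1 where "D1 t = deriv cE t * (t\<^sup>2 * cA t) + cE t * G1 t - 2 * (t * cF t) * F1 t" for t
  have D: "D t = t\<^sup>2 * disc t" for t by (simp add: D_def disc_def algebra_simps power2_eq_square)
  have Dpos: "0 < D t" if "0 < t" for t unfolding D using that disc_pos by simp
  have dG1: "((\<lambda>t. t\<^sup>2 * cA t) has_real_derivative G1 t) (at t)" for t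
    unfolding G1_def by (rule derivative_eq_intros cA_deriv refl)+ simp
  have dG2: "(G1 has_real_derivative G2 t) (at t)" for t
    unfolding G1_def[abs_def] G2_def by (rule derivative_eq_intros cA_deriv cA_deriv2 refl)+ (simp add: algebra_simps)
  have dF1: "((\<lambda>t. t * cF t) has_real_derivative F1 t) (at t)" for t
    unfolding F1_def by (rule derivative_eq_intros cF_deriv refl)+ simp
  have dF2: "(F1 has_real_derivative F2 t) (at t)" for t
    unfolding F1_def[abs_def] F2_def by (rule derivative_eq_intros cF_deriv cF_deriv2 refl)+ simp
  have dD: "(D has_real_derivative D1 t) (at t)" for t
    unfolding D_def[abs_def] D1_def by (rule derivative_eq_intros cE_deriv dG1 dF1 refl)+ simp
  let ?u = "axis i1 r :: real ^ 'n"
  have u: "?u \<in> polar_domain" "r = ?u $ i1" using r i12 by (auto simp: polar_domain_def axis_def)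
  have "scalar_curvature g (\<lambda>u. stereo (polar u)) ?u = - G2 r / D r + G1 r * D1 r / (2 * (D r)\<^sup>2)"
    by (rule scalar_curvature_surface[OF univ i12 open_polar_domain _ gram_polar cE_deriv dF1 dG1 cE_deriv2 dF2 dG2
        D_def less_imp_neq[OF Dpos, symmetric] D1_def u, of "{0<..}"]) (auto simp: polar_domain_def)
  then have R0: "0 \<le> - G2 r / D r + G1 r * D1 r / (2 * (D r)\<^sup>2)"
    using R local_param_polar[OF univ] u(1) unfolding nonneg_scalar_curvature_def by metis
  define d where "d = (G2 r / D r - G1 r * D1 r / (2 * (D r)\<^sup>2)) * sqrt (D r) / 2"
  have "((\<lambda>t. G1 t / sqrt (D t) / 2) has_real_derivative d) (at r)"
    unfolding d_def by (rule DERIV_cdivide[OF has_real_derivative_quotient_sqrt[OF dG2 dD Dpos[OF r]]])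
  moreover have "G1 t / sqrt (D t) / 2 = slope t" if "t \<in> {0<..}" for t
  proof -
    have "sqrt (D t) = t * sqrt (disc t)" using that by (simp add: D real_sqrt_mult)
    then show ?thesis
      using that disc_pos[of t] unfolding G1_def slope_def by (simp add: field_simps power2_eq_square)
  qed
  ultimately have "(slope has_real_derivative d) (at r)"
    using has_field_derivative_transform_within_open[of "\<lambda>t. G1 t / sqrt (D t) / 2" d r "{0<..}" slope] r by auto
  moreover have "d \<le> 0"
    unfolding d_def using R0 Dpos[OF r] by (intro divide_nonpos_pos mult_nonpos_nonneg) auto
  ultimately show thesis by (rule that)
qed

text \<open>The passage from the radius to its square, the variable of
  \<open>scalar_curvature_radial\<close>.\<close>

lemma smooth_sqrt_derivs:
  fixes h :: "real \<Rightarrow> real"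
  assumes "\<And>k. C_on k h UNIV" "0 < q"
  shows "((\<lambda>q. h (sqrt q)) has_real_derivative deriv h (sqrt q) / (2 * sqrt q)) (at q)"
    "((\<lambda>q. deriv h (sqrt q) / (2 * sqrt q)) has_real_derivative
       (deriv (deriv h) (sqrt q) - deriv h (sqrt q) / sqrt q) / (4 * q)) (at q)"
proof -
  have ds: "(sqrt has_real_derivative inverse (sqrt q) / 2) (at q)" by (rule DERIV_real_sqrt[OF assms(2)])
  have s: "sqrt q \<noteq> 0" "sqrt q * sqrt q = q" using assms(2) by simp_all
  note d1 = DERIV_chain2[OF smooth_real_deriv(1)[OF assms(1)] ds]
  note d2 = DERIV_chain2[OF smooth_real_deriv(1)[OF smooth_real_deriv(2)[OF assms(1)]] ds]
  show "((\<lambda>q. h (sqrt q)) has_real_derivative deriv h (sqrt q) / (2 * sqrt q)) (at q)"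
    by (rule DERIV_cong[OF d1]) (simp add: field_simps)
  have s2: "2 * sqrt q \<noteq> 0" using s by simp
  obtain w where w: "w = sqrt q" "w \<noteq> 0" "q = w * w" using s by metis
  show "((\<lambda>q. deriv h (sqrt q) / (2 * sqrt q)) has_real_derivative
       (deriv (deriv h) (sqrt q) - deriv h (sqrt q) / sqrt q) / (4 * q)) (at q)"
    by (rule DERIV_cong[OF DERIV_divide[OF d2 DERIV_cmult[OF ds] s2]])
       (use w(2) in \<open>simp add: w(1)[symmetric] w(3) field_simps\<close>)
qed

text \<open>On the ray the form is \<open>cA\<close> times the Euclidean inner product with the
  radial entry corrected to \<open>cE\<close>. Rotating back replaces the coordinate along the ray
  by the inner product with \<open>u / norm u\<close>.\<close>

lemma gram_radial:
  assumes "UNIV \<noteq> {i1, i2}" "u \<noteq> 0"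
  shows "gram g stereo u $ i $ j = cA (norm u) * kron i j
     + (cE (norm u) - cA (norm u)) / (norm u)\<^sup>2 * (u $ i * u $ j)"
proof -
  let ?r = "norm u" and ?s = "axis i1 (norm u) :: real ^ 'n"
  obtain A where A: "A \<in> special_orthogonal" "A *v ?s = u" by (rule rot_to_ray)
  have orth: "orthogonal_matrix A" using A(1) by (simp add: special_orthogonal_def)
  have ray: "form ?s v w = cA ?r * (v \<bullet> w) + (cE ?r - cA ?r) * (v $ i1 * w $ i1)" for v w
  proof -
    have e: "form ?s (axis k 1) (axis l 1) = cA ?r * kron k l + (cE ?r - cA ?r) * (kron k i1 * kron l i1)" for k l
    proof -
      consider "k = i1" "l = i1" | "k = i1" "l \<noteq> i1" | "k \<noteq> i1" "l = i1" | "k \<noteq> i1" "l \<noteq> i1" "k = l"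
        | "k \<noteq> i1" "l \<noteq> i1" "k \<noteq> l" by blast
      then show ?thesis
        using ray_structure[OF assms(1)] form_sym[of ?s "axis k 1" "axis l 1"]
        by cases (auto simp: kron_def cE_def)
    qed
    have "form ?s v w = (\<Sum>k\<in>UNIV. v $ k * (\<Sum>l\<in>UNIV. w $ l * form ?s (axis k 1) (axis l 1)))"
      by (subst form_expand_left, subst form_sym, subst form_expand_left) (simp add: form_sym[of ?s "axis _ 1" "axis _ 1"])
    also have "\<dots> = (\<Sum>k\<in>UNIV. v $ k * (cA ?r * w $ k + (cE ?r - cA ?r) * (kron k i1 * w $ i1)))"
    proof (intro sum.cong refl arg_cong2[where f = "(*)"])
      fix k
      have "(\<Sum>l\<in>UNIV. w $ l * form ?s (axis k 1) (axis l 1)) =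
        cA ?r * (\<Sum>l\<in>UNIV. w $ l * kron k l) + (cE ?r - cA ?r) * kron k i1 * (\<Sum>l\<in>UNIV. w $ l * kron l i1)"
        unfolding e by (simp only: sum_distrib_left sum.distrib[symmetric]) (simp add: algebra_simps)
      then show "(\<Sum>l\<in>UNIV. w $ l * form ?s (axis k 1) (axis l 1)) = cA ?r * w $ k + (cE ?r - cA ?r) * (kron k i1 * w $ i1)"
        by simp
    qed
    also have "\<dots> = cA ?r * (\<Sum>k\<in>UNIV. v $ k * w $ k) + (cE ?r - cA ?r) * w $ i1 * (\<Sum>k\<in>UNIV. v $ k * kron k i1)"
      by (simp only: sum_distrib_left sum.distrib[symmetric]) (simp add: algebra_simps)
    finally show ?thesis by (simp add: inner_vec_def)
  qed
  have surj: "\<exists>v'. v = A *v v'" for v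
    using orth unfolding orthogonal_matrix_def by (metis matrix_vector_mul_assoc matrix_vector_mul_lid)
  obtain v w where v: "axis i 1 = A *v v" and w: "axis j 1 = A *v w" using surj by metis
  have comp: "u \<bullet> (A *v x) = norm u * x $ i1" for x
    using orthogonal_matrix_inner[OF orth, of ?s x] by (simp add: A(2) inner_axis')
  have "gram g stereo u $ i $ j = form (A *v ?s) (A *v v) (A *v w)" by (simp add: gram_stereo v w A(2))
  also have "\<dots> = form ?s v w" by (rule form_rot[OF A(1)])
  also have "\<dots> = cA ?r * (axis i (1 :: real) \<bullet> axis j 1) + (cE ?r - cA ?r) * (v $ i1 * w $ i1)"
    by (simp only: ray v w orthogonal_matrix_inner[OF orth])
  also have "v $ i1 = u $ i / norm u" using comp[of v] assms(2) by (simp add: v[symmetric] inner_axis)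
  also have "w $ i1 = u $ j / norm u" using comp[of w] assms(2) by (simp add: w[symmetric] inner_axis)
  finally show ?thesis by (simp add: inner_axis_axis kron_def power2_eq_square)
qed

text \<open>From dimension three on the curvature contains a multiple of 1 - slope^2, which is
  nonpositive once the slope exceeds 1. Non-negative curvature then forces the term with the second
  derivative of the profile to be non-negative, that is, \<open>d\<close> to be nonpositive.\<close>

lemma slope_deriv_radial:
  assumes dim: "UNIV \<noteq> {i1, i2}" and R: "nonneg_scalar_curvature g" and r: "0 < r"
  obtains d where "(slope has_real_derivative d) (at r)" "1 < slope r \<longrightarrow> d \<le> 0"
proof -
  define a where "a q = cA (sqrt q)" for q
  define a1 where "a1 q = deriv cA (sqrt q) / (2 * sqrt q)" for q
  define a2 where "a2 q = (deriv (deriv cA) (sqrt q) - deriv cA (sqrt q) / sqrt q) / (4 * q)" for q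
  define e1 where "e1 q = deriv cE (sqrt q) / (2 * sqrt q)" for q
  define e2 where "e2 q = (deriv (deriv cE) (sqrt q) - deriv cE (sqrt q) / sqrt q) / (4 * q)" for q
  define b where "b q = (cE (sqrt q) - a q) / q" for q
  define b1 where "b1 q = (e1 q - a1 q - b q) / q" for q
  define b2 where "b2 q = (e2 q - a2 q - 2 * b1 q) / q" for q
  have da: "(a has_real_derivative a1 q) (at q)" "(a1 has_real_derivative a2 q) (at q)"
    and de: "((\<lambda>q. cE (sqrt q)) has_real_derivative e1 q) (at q)" "(e1 has_real_derivative e2 q) (at q)" if "0 < q" for q
    unfolding a_def[abs_def] a1_def[abs_def] a2_def e1_def[abs_def] e2_def
    using smooth_sqrt_derivs[OF coefficients_C_on(1) that] smooth_sqrt_derivs[OF coefficients_C_on(2) that] by auto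
  have db: "(b has_real_derivative b1 q) (at q)" if q: "0 < q" for q
    unfolding b_def[abs_def]
    by (rule DERIV_cong[OF DERIV_divide[OF DERIV_diff[OF de(1)[OF q] da(1)[OF q]] DERIV_ident]])
       (use q in \<open>auto simp: b1_def b_def field_simps\<close>)
  have db1: "(b1 has_real_derivative b2 q) (at q)" if q: "0 < q" for q
    unfolding b1_def[abs_def]
    by (rule DERIV_cong[OF DERIV_divide[OF DERIV_diff[OF DERIV_diff[OF de(2)[OF q] da(2)[OF q]] db[OF q]] DERIV_ident]])
       (use q in \<open>auto simp: b1_def b2_def field_simps\<close>)
  have bq: "a q + b q * q = cE (sqrt q)" if "0 < q" for q using that by (simp add: b_def)
  let ?u = "axis i1 r :: real ^ 'n"
  define q where "q = r\<^sup>2"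
  have q: "0 < q" "sqrt q = r" "q = ?u \<bullet> ?u" using r by (simp_all add: q_def inner_axis_axis power2_eq_square)
  have un: "?u \<noteq> 0" using r by (simp add: axis_eq_0_iff)
  define N where "N = real CARD('n)"
  define E where "E = a q + b q * q"
  have gram: "gram g stereo u $ i $ j = a (u \<bullet> u) * kron i j + b (u \<bullet> u) * (u $ i * u $ j)" if "u \<noteq> 0" for u i j
    using gram_radial[OF dim that, of i j]
    by (simp add: a_def b_def norm_eq_sqrt_inner[symmetric] power2_norm_eq_inner[symmetric])
  have "scalar_curvature g stereo ?u = (N - 1) * (N - 2) * (1 - (a q + q * a1 q)\<^sup>2 / (a q * E)) / (q * a q)
     - 4 * (N - 1) * ((2 * a1 q + q * a2 q) / (a q * E)
        - (a q + q * a1 q) * (a1 q * E + a q * (a1 q + b q + b1 q * q)) / (2 * (a q)\<^sup>2 * E\<^sup>2))"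
    by (rule scalar_curvature_radial[OF gram da db db1 _ _ un q(3) N_def E_def])
       (simp_all add: bq cE_pos, simp add: a_def cA_pos)
  then have R0: "0 \<le> (N - 1) * (N - 2) * (1 - (a q + q * a1 q)\<^sup>2 / (a q * E)) / (q * a q)
     - 4 * (N - 1) * ((2 * a1 q + q * a2 q) / (a q * E)
        - (a q + q * a1 q) * (a1 q * E + a q * (a1 q + b q + b1 q * q)) / (2 * (a q)\<^sup>2 * E\<^sup>2))"
    using R local_param_stereo unfolding nonneg_scalar_curvature_def by (metis UNIV_I)
  define h where "h t = a t + t * a1 t" for t
  define P where "P t = a t * (a t + b t * t)" for t
  have P: "0 < P t" if "0 < t" for t
    unfolding P_def bq[OF that] using cE_pos cA_pos by (simp add: a_def)
  have dh: "(h has_real_derivative 2 * a1 q + q * a2 q) (at q)"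
    unfolding h_def[abs_def] by (rule derivative_eq_intros da[OF q(1)] refl)+ simp
  have dP: "(P has_real_derivative a1 q * E + a q * (a1 q + b q + b1 q * q)) (at q)"
    unfolding P_def[abs_def] E_def by (rule derivative_eq_intros da[OF q(1)] db[OF q(1)] refl)+ (simp add: algebra_simps)
  define X where "X = (2 * a1 q + q * a2 q) / (a q * E)
        - (a q + q * a1 q) * (a1 q * E + a q * (a1 q + b q + b1 q * q)) / (2 * (a q)\<^sup>2 * E\<^sup>2)"
  have "((\<lambda>t. h t / sqrt (P t)) has_real_derivative X * sqrt (P q)) (at q)"
    by (rule DERIV_cong[OF has_real_derivative_quotient_sqrt[OF dh dP P[OF q(1)]]])
       (simp add: X_def h_def P_def E_def power_mult_distrib)
  then have "((\<lambda>t. h t / sqrt (P t)) has_real_derivative X * sqrt (P q)) (at (r\<^sup>2))" by (simp add: q_def)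
  then have "((\<lambda>t. h (t\<^sup>2) / sqrt (P (t\<^sup>2))) has_real_derivative X * sqrt (P q) * (2 * r)) (at r)"
    by (rule DERIV_chain2[where f = "\<lambda>t. h t / sqrt (P t)" and g = "\<lambda>t. t\<^sup>2"])
       (auto intro!: derivative_eq_intros)
  moreover have slope_eq: "h (t\<^sup>2) / sqrt (P (t\<^sup>2)) = slope t" if "t \<in> {0<..}" for t
  proof -
    have t: "0 < t" "sqrt (t\<^sup>2) = t" using that by simp_all
    have "P (t\<^sup>2) = disc t"
      using t bq[of "t\<^sup>2"] by (simp add: P_def a_def disc_def ray_structure(4)[OF dim])
    moreover have "h (t\<^sup>2) = cA t + t * deriv cA t / 2"
      using t by (simp add: h_def a_def a1_def power2_eq_square)
    ultimately show ?thesis by (simp add: slope_def)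
  qed
  ultimately have "(slope has_real_derivative X * sqrt (P q) * (2 * r)) (at r)"
    using has_field_derivative_transform_within_open[of "\<lambda>t. h (t\<^sup>2) / sqrt (P (t\<^sup>2))" _ r "{0<..}" slope] r by auto
  moreover have "1 < slope r \<longrightarrow> X * sqrt (P q) * (2 * r) \<le> 0"
  proof
    assume s: "1 < slope r"
    have "slope r = h q / sqrt (P q)" using slope_eq[of r] r by (simp add: q_def)
    then have "(slope r)\<^sup>2 = (a q + q * a1 q)\<^sup>2 / (a q * E)"
      using P[OF q(1)] by (simp add: power_divide h_def P_def E_def)
    then have "1 - (a q + q * a1 q)\<^sup>2 / (a q * E) \<le> 0" using s one_less_power[OF s, of 2] by simp
    moreover have N: "2 \<le> N" using CARD_ge_2 by (simp add: N_def)
    moreover have "0 < q * a q" using q(1) cA_pos by (simp add: a_def)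
    ultimately have "(N - 1) * (N - 2) * (1 - (a q + q * a1 q)\<^sup>2 / (a q * E)) / (q * a q) \<le> 0"
      by (intro divide_nonpos_pos mult_nonneg_nonpos) auto
    then have "4 * (N - 1) * X \<le> 0" using R0 unfolding X_def[symmetric] by linarith
    then have "X \<le> 0" using N by (simp add: mult_le_0_iff)
    then show "X * sqrt (P q) * (2 * r) \<le> 0" using r P[OF q(1)] by (intro mult_nonpos_nonneg) auto
  qed
  ultimately show thesis by (rule that)
qed

lemma continuous_cA: "continuous_on S cA" and continuous_cE: "continuous_on S cE" and continuous_cF: "continuous_on S cF"
  using coefficients_C_on[of 0] continuous_on_subset[OF _ subset_UNIV] by auto

lemma continuous_disc: "continuous_on S disc"
  unfolding disc_def[abs_def] by (intro continuous_intros continuous_cA continuous_cE continuous_cF)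

text \<open>Suppose the slope exceeds 1 at \<open>r\<close>, and let \<open>s\<close> be the last
  point up to \<open>r\<close> where it is at most a value \<open>e\<close> strictly between 1 and
  \<open>slope r\<close>. After \<open>s\<close> the slope exceeds 1, hence does not increase, and
  cannot climb from \<open>e\<close> to \<open>slope r\<close>. The pole guarantees that such an
  \<open>s\<close> exists.\<close>

lemma slope_le_1:
  assumes R: "nonneg_scalar_curvature g" and r: "0 < r"
  shows "slope r \<le> 1"
proof (rule ccontr)
  assume "\<not> slope r \<le> 1"
  define e where "e = (1 + slope r) / 2"
  have e: "1 < e" "e < slope r" using \<open>\<not> slope r \<le> 1\<close> by (auto simp: e_def)
  have "continuous_on UNIV (deriv cA)"
    using smooth_real_deriv(2)[OF coefficients_C_on(1), of 0] by simp
  then have cont: "continuous_on {0..r} slope"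
    unfolding slope_def[abs_def]
    by (intro continuous_intros continuous_cA continuous_disc)
       (auto simp: less_imp_neq[OF disc_pos, symmetric] intro: continuous_on_subset)
  define S where "S = {0..r} \<inter> slope -` {..e}"
  \<comment> \<open>Here smoothness across the pole enters: \<open>cE 0 = cA 0\<close> and
    \<open>cF 0 = 0\<close> make \<open>disc 0\<close> the square of \<open>cA 0\<close>.\<close>
  have "slope 0 = 1"
    using cA_pos[of 0] by (simp add: slope_def disc_def coefficients_at_pole power2_eq_square)
  then have "0 \<in> S" using e r by (simp add: S_def)
  have "closed S" unfolding S_def by (rule continuous_closed_preimage[OF cont]) auto
  moreover have "bounded S" unfolding S_def by (rule bounded_subset[OF bounded_closed_interval[of 0 r]]) auto
  ultimately have "compact S" by (simp add: compact_eq_bounded_closed)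
  then obtain s where s: "s \<in> S" "\<And>x. x \<in> S \<Longrightarrow> x \<le> s"
    using compact_attains_sup[of S] \<open>0 \<in> S\<close> by blast
  have s': "0 \<le> s" "slope s \<le> e" "s < r"
    using s(1) e by (auto simp: S_def less_le)
  have deriv: "\<exists>d. (slope has_real_derivative d) (at t) \<and> d \<le> 0" if "s < t" "t < r" for t
  proof -
    have "t \<notin> S" using s(2)[of t] that by auto
    then have "1 < slope t" using that s' e by (auto simp: S_def)
    moreover have "0 < t" using that s' by simp
    ultimately show ?thesis
      using slope_deriv_surface[OF _ R, of t] slope_deriv_radial[OF _ R, of t] by metis
  qed
  have "slope r \<le> slope s"
  proof (rule DERIV_nonpos_imp_decreasing_open[where f = slope])
    show "s \<le> r" using s' by simp
    show "\<exists>y. (slope has_real_derivative y) (at x) \<and> y \<le> 0" if "s < x" "x < r" for x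
      using deriv[OF that] .
    show "continuous_on {s..r} slope" using cont by (rule continuous_on_subset) (use s' in auto)
  qed
  then show False using s' e by linarith
qed

end

subsection \<open>The volume profile\<close>

locale unit_volume_metric = rot_metric g i1 i2 for g :: "'n::finite metric_field" and i1 i2 +
  assumes unit_volume: "emeasure (vol g) unit_sphere = 1"
    and nonneg_curvature: "nonneg_scalar_curvature g"
begin

definition height :: "real \<Rightarrow> real" where "height r = (r\<^sup>2 - 1) / (r\<^sup>2 + 1)"

text \<open>The volume density in the radius, up to the factor \<open>ball_const\<close>. In terms
  of the profile it is f^(n - 1) ds/dr.\<close>

definition dens :: "real \<Rightarrow> real" where
  "dens r = sqrt (cA r) ^ (CARD('n) - 2) * sqrt (disc r) * r ^ (CARD('n) - 1)"

text \<open>The area of the unit sphere in R^n.\<close>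

definition ball_const :: real where "ball_const = CARD('n) * unit_ball_vol CARD('n)"

text \<open>
  The volume of the cap of stereographic radius \<open>r\<close> is \<open>ball_const * vprof r\<close>. Integrating from \<open>- 1\<close>
  gives a two-sided derivative at \<open>0\<close>.
\<close>

definition vprof :: "real \<Rightarrow> real" where
  "vprof r = integral {- 1..r} dens - integral {- 1..0} dens"

lemma ball_const_pos: "0 < ball_const"
  using CARD_ge_2 by (simp add: ball_const_def)

lemma continuous_dens: "continuous_on S dens"
  unfolding dens_def[abs_def] by (intro continuous_intros continuous_cA continuous_disc)

lemma dens_nonneg: "0 \<le> r \<Longrightarrow> 0 \<le> dens r"
  unfolding dens_def using cA_pos[of r] disc_pos[of r] by simp

lemma space_vol: "space (vol g) = unit_sphere" and sets_vol: "sets (vol g) = sets (restrict_space borel unit_sphere)"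
  by (simp_all add: vol_def space_restrict_space)

lemma measurable_vol: "f \<in> borel_measurable borel \<Longrightarrow> f \<in> borel_measurable (vol g)"
  by (simp add: measurable_cong_sets[OF sets_vol refl] measurable_restrict_space1)

lemma fst_stereo_norm: "fst (stereo u) = height (norm u)"
  by (simp add: fst_stereo height_def power2_norm_eq_inner)

text \<open>Functions of the first coordinate are radial in the stereographic chart, and so is the
  volume density, so polar coordinates leave an integral over the radius.\<close>

lemma nn_integral_vol:
  fixes \<zeta> :: "real \<Rightarrow> ennreal"
  assumes [measurable]: "\<zeta> \<in> borel_measurable borel"
  shows "(\<integral>\<^sup>+ p. \<zeta> (fst p) \<partial>vol g)
    = ennreal ball_const * (\<integral>\<^sup>+ r. \<zeta> (height r) * ennreal (dens r) * indicator {0..} r \<partial>lborel)"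
proof -
  define \<rho> where "\<rho> r = sqrt (cA r) ^ (CARD('n) - 2) * sqrt (disc r)" for r
  have dens_eq: "dens r = \<rho> r * r ^ (CARD('n) - 1)" for r by (simp add: dens_def \<rho>_def)
  have \<rho>: "0 \<le> \<rho> r" for r using cA_pos[of r] disc_pos[of r] by (simp add: \<rho>_def)
  have dens_ennreal: "ennreal (dens r) = ennreal (\<rho> r) * ennreal (r ^ (CARD('n) - 1))" if "0 \<le> r" for r
    unfolding dens_eq using \<rho> that by (simp add: ennreal_mult)
  have det: "sqrt (det (gram g stereo u)) = \<rho> (norm u)" for u
    by (simp add: det_gram_stereo \<rho>_def real_sqrt_mult real_sqrt_power)
  have "continuous_on UNIV \<rho>"
    unfolding \<rho>_def[abs_def] by (intro continuous_intros continuous_cA continuous_disc)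
  then have [measurable]: "\<rho> \<in> borel_measurable borel" by (rule borel_measurable_continuous_onI)
  have [measurable]: "height \<in> borel_measurable borel" unfolding height_def[abs_def] by measurable
  have "continuous_on UNIV (stereo :: real ^ 'n \<Rightarrow> _)"
    using stereo_smooth[unfolded smooth_on_def, rule_format, of 0] by simp
  then have "stereo \<in> borel \<rightarrow>\<^sub>M (borel :: 'n space measure)" by (rule borel_measurable_continuous_onI)
  then have st: "stereo \<in> density lborel (\<lambda>u. ennreal (sqrt (det (gram g stereo u)))) \<rightarrow>\<^sub>M restrict_space borel unit_sphere"
    using stereo_in_sphere by (intro measurable_restrict_space2) (auto simp: measurable_def)
  have fst_meas: "(\<lambda>p :: 'n space. \<zeta> (fst p)) \<in> borel_measurable (restrict_space borel unit_sphere)"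
    by (rule measurable_restrict_space1, rule measurable_compose[OF _ assms])
       (auto intro!: borel_measurable_continuous_onI continuous_intros)
  have "(\<integral>\<^sup>+ p. \<zeta> (fst p) \<partial>vol g) = (\<integral>\<^sup>+ u. \<zeta> (fst (stereo u)) \<partial>density lborel (\<lambda>u. ennreal (sqrt (det (gram g stereo u)))))"
    unfolding vol_def by (rule nn_integral_distr[OF st]) (use fst_meas in \<open>simp add: measurable_def\<close>)
  also have "\<dots> = (\<integral>\<^sup>+ u. ennreal (\<rho> (norm u)) * \<zeta> (height (norm (u :: real ^ 'n))) \<partial>lborel)"
    unfolding det fst_stereo_norm by (rule nn_integral_density) measurable
  also have "\<dots> = ennreal (DIM(real ^ 'n) * unit_ball_vol DIM(real ^ 'n)) *
      (\<integral>\<^sup>+ r. ennreal (\<rho> r) * \<zeta> (height r) * ennreal (r ^ (DIM(real ^ 'n) - 1)) * indicator {0..} r \<partial>lborel)"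
    by (rule nn_integral_norm_lborel) measurable
  also have "(\<integral>\<^sup>+ r. ennreal (\<rho> r) * \<zeta> (height r) * ennreal (r ^ (DIM(real ^ 'n) - 1)) * indicator {0..} r \<partial>lborel)
     = (\<integral>\<^sup>+ r. \<zeta> (height r) * ennreal (dens r) * indicator {0..} r \<partial>lborel)"
    by (rule nn_integral_cong)
       (auto simp: dens_ennreal ac_simps split: split_indicator)
  finally show ?thesis by (simp add: ball_const_def)
qed

lemma vprof_0 [simp]: "vprof 0 = 0"
  by (simp add: vprof_def)

lemma vprof_deriv:
  assumes "- 1 < r" shows "(vprof has_real_derivative dens r) (at r)"
proof -
  have "((\<lambda>r. integral {- 1..r} dens) has_real_derivative dens r) (at r within {- 1..r + 1})"
    by (rule integral_has_real_derivative[OF continuous_dens]) (use assms in auto)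
  moreover have "at r within {- 1..r + 1} = at r"
    by (rule at_within_Icc_at) (use assms in auto)
  ultimately have "((\<lambda>r. integral {- 1..r} dens) has_real_derivative dens r) (at r)" by simp
  from DERIV_diff[OF this DERIV_const] show ?thesis
    unfolding vprof_def[abs_def] by simp
qed

lemma continuous_vprof: "continuous_on {0..} vprof"
  by (rule DERIV_continuous_on, rule has_field_derivative_at_within, rule vprof_deriv) simp

lemma nn_integral_dens:
  assumes "0 \<le> r" shows "(\<integral>\<^sup>+ x. ennreal (dens x) * indicator {0..r} x \<partial>lborel) = ennreal (vprof r)"
proof -
  have [measurable]: "dens \<in> borel_measurable borel"
    by (rule borel_measurable_continuous_onI[OF continuous_dens])
  have "(\<integral>\<^sup>+ x. ennreal (dens x) * indicator {0..r} x \<partial>lborel) = ennreal (vprof r - vprof 0)"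
    by (rule nn_integral_FTC_Icc) (use assms in \<open>auto intro!: vprof_deriv dens_nonneg\<close>)
  then show ?thesis by simp
qed

lemma total_volume: "ennreal ball_const * (\<integral>\<^sup>+ r. ennreal (dens r) * indicator {0..} r \<partial>lborel) = 1"
  using nn_integral_vol[of "\<lambda>_. 1"] unit_volume by (simp add: space_vol[symmetric])

lemma vprof_mono: "0 \<le> r \<Longrightarrow> r \<le> s \<Longrightarrow> vprof r \<le> vprof s"
  by (rule DERIV_nonneg_imp_nondecreasing[where f = vprof]) (auto intro!: exI vprof_deriv dens_nonneg)

lemma vprof_nonneg: "0 \<le> r \<Longrightarrow> 0 \<le> vprof r"
  using vprof_mono[of 0 r] by simp

lemma nn_integral_dens_total: "(\<integral>\<^sup>+ r. ennreal (dens r) * indicator {0..} r \<partial>lborel) = ennreal (1 / ball_const)"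
proof -
  let ?I = "\<integral>\<^sup>+ r. ennreal (dens r) * indicator {0..} r \<partial>lborel"
  have "?I = (ennreal (1 / ball_const) * ennreal ball_const) * ?I"
    using ball_const_pos by (simp add: ennreal_mult[symmetric])
  then show ?thesis using total_volume by (simp add: mult.assoc)
qed

lemma vprof_le: "0 \<le> r \<Longrightarrow> vprof r \<le> 1 / ball_const"
proof -
  assume r: "0 \<le> r"
  have "ennreal (vprof r) \<le> ennreal (1 / ball_const)"
    unfolding nn_integral_dens[OF r, symmetric] nn_integral_dens_total[symmetric]
    by (rule nn_integral_mono) (auto split: split_indicator)
  then show ?thesis using ball_const_pos by (simp add: ennreal_le_iff)
qed

text \<open>The caps exhaust the total volume, by monotone convergence. A function of
  \<open>y\<close> that vanishes near the upper end of its range therefore vanishes beyond a finite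
  radius, away from the pole at infinity.\<close>

lemma vprof_reaches:
  assumes "0 < w" obtains R where "0 < R" "1 / ball_const - w < vprof R"
proof -
  have [measurable]: "dens \<in> borel_measurable borel"
    by (rule borel_measurable_continuous_onI[OF continuous_dens])
  have "(\<integral>\<^sup>+ r. (SUP k::nat. ennreal (dens r) * indicator {0..real k} r) \<partial>lborel)
     = (SUP k::nat. \<integral>\<^sup>+ r. ennreal (dens r) * indicator {0..real k} r \<partial>lborel)"
    by (rule nn_integral_monotone_convergence_SUP)
       (auto simp: incseq_def le_fun_def split: split_indicator)
  moreover have "(SUP k::nat. ennreal (dens r) * indicator {0..real k} r) = ennreal (dens r) * indicator {0..} r" for r
  proof (rule antisym)
    show "(SUP k::nat. ennreal (dens r) * indicator {0..real k} r) \<le> ennreal (dens r) * indicator {0..} r"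
      by (rule SUP_least) (auto split: split_indicator)
    obtain k :: nat where "r \<le> real k" using real_arch_simple by blast
    then have "ennreal (dens r) * indicator {0..} r \<le> ennreal (dens r) * indicator {0..real k} r"
      by (auto split: split_indicator)
    then show "ennreal (dens r) * indicator {0..} r \<le> (SUP k::nat. ennreal (dens r) * indicator {0..real k} r)"
      by (rule order_trans) (rule SUP_upper, simp)
  qed
  ultimately have sup: "(SUP k::nat. ennreal (vprof (real k))) = ennreal (1 / ball_const)"
    by (simp add: nn_integral_dens nn_integral_dens_total)
  have "ennreal (1 / ball_const - w) < ennreal (1 / ball_const)"
    using assms ball_const_pos by (simp add: ennreal_less_iff ennreal_lessI)
  then obtain k :: nat where "ennreal (1 / ball_const - w) < ennreal (vprof (real k))"
    unfolding sup[symmetric] less_SUP_iff by auto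
  then have "1 / ball_const - w < vprof (real k)"
    using vprof_nonneg[of "real k"] by (meson ennreal_leI not_le of_nat_0_le_iff)
  also have "\<dots> \<le> vprof (real k + 1)" by (rule vprof_mono) auto
  finally show thesis by (intro that[of "real k + 1"]) auto
qed

lemma vprof_small:
  assumes "0 < w" obtains R where "0 < R" "vprof R < w"
proof -
  have "isCont vprof 0" using vprof_deriv[of 0] DERIV_isCont by simp
  then have "\<forall>\<^sub>F x in at 0. vprof x < w"
    using assms order_tendstoD(2)[of vprof 0 "at 0" w] by (simp add: isCont_def)
  then obtain d where d: "0 < d" "\<And>x. x \<noteq> 0 \<Longrightarrow> dist x 0 < d \<Longrightarrow> vprof x < w"
    unfolding eventually_at by blast
  show thesis by (rule that[of "d / 2"]) (use d(1) d(2)[of "d / 2"] in \<open>auto simp: dist_real_def\<close>)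
qed

text \<open>Substitution \<open>y = vprof r\<close>, which absorbs the density. The margin
  \<open>w\<close> confines both integrals to compact intervals, where the substitution rule
  applies.\<close>

lemma nn_integral_vprof:
  fixes f :: "real \<Rightarrow> real"
  assumes f: "continuous_on UNIV f" "\<And>x. 0 \<le> f x" and w: "0 < w"
    and supp: "\<And>x. x \<le> w \<or> 1 / ball_const - w \<le> x \<Longrightarrow> f x = 0"
  shows "(\<integral>\<^sup>+ r. ennreal (f (vprof r)) * ennreal (dens r) * indicator {0..} r \<partial>lborel) = (\<integral>\<^sup>+ x. ennreal (f x) \<partial>lborel)"
proof -
  obtain R where R: "0 < R" "1 / ball_const - w < vprof R" by (rule vprof_reaches[OF w])
  have [measurable]: "f \<in> borel_measurable borel" by (rule borel_measurable_continuous_onI[OF f(1)])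
  have a: "(\<integral>\<^sup>+ x. ennreal (f x * indicator {vprof 0..vprof R} x) \<partial>lborel)
      = (\<integral>\<^sup>+ r. ennreal (f (vprof r) * dens r * indicator {0..R} r) \<partial>lborel)"
    by (rule nn_integral_substitution)
       (use R in \<open>auto intro!: vprof_deriv continuous_dens dens_nonneg simp: set_borel_measurable_def\<close>)
  have b: "f x * indicator {vprof 0..vprof R} x = f x" for x
    using supp[of x] R w by (cases "x \<le> w \<or> 1 / ball_const - w \<le> x") (auto split: split_indicator)
  have c: "ennreal (f (vprof r) * dens r * indicator {0..R} r)
     = ennreal (f (vprof r)) * ennreal (dens r) * indicator {0..} r" for r
  proof (cases "R < r")
    case True
    then have "f (vprof r) = 0" using supp[of "vprof r"] R vprof_mono[of R r] by auto
    then show ?thesis by simp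
  next
    case False
    then show ?thesis
      using f(2)[of "vprof r"] dens_nonneg[of r] by (auto simp: ennreal_mult split: split_indicator)
  qed
  show ?thesis using a unfolding b c by simp
qed

text \<open>By the slope bound \<open>f\<^sup>n\<close> grows at most \<open>n\<close> times as fast as \<open>vprof\<close>.\<close>

lemma profile_le_vprof:
  assumes "0 \<le> r" shows "(r * sqrt (cA r)) ^ CARD('n) \<le> CARD('n) * vprof r"
proof -
  let ?n = "CARD('n)"
  let ?f = "\<lambda>r. r * sqrt (cA r)"
  have n: "?n - 1 = Suc (?n - 2)" using CARD_ge_2 by simp
  \<comment> \<open>The derivative of f^n in r is n f^(n - 1) (ds/dr) slope, that is n times
    \<open>dens\<close> times \<open>slope\<close>.\<close>
  have deriv: "((\<lambda>r. ?n * vprof r - ?f r ^ ?n) has_real_derivative ?n * dens r * (1 - slope r)) (at r)"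
    if "0 < r" for r
  proof -
    have s: "sqrt (cA r) \<noteq> 0" "sqrt (disc r) \<noteq> 0" using cA_pos[of r] disc_pos[of r] by simp_all
    have "((\<lambda>r. sqrt (cA r)) has_real_derivative inverse (sqrt (cA r)) / 2 * deriv cA r) (at r)"
      by (rule DERIV_chain2[OF DERIV_real_sqrt[OF cA_pos] cA_deriv])
    from DERIV_mult[OF DERIV_ident this]
    have "(?f has_real_derivative slope r * sqrt (disc r) / sqrt (cA r)) (at r)"
    proof (rule DERIV_cong)
      have "cA r = sqrt (cA r) * sqrt (cA r)" using cA_pos[of r] by simp
      then show "1 * sqrt (cA r) + inverse (sqrt (cA r)) / 2 * deriv cA r * r = slope r * sqrt (disc r) / sqrt (cA r)"
        using s unfolding slope_def by (simp add: field_simps)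
    qed
    from DERIV_power[OF this, of ?n]
    have "((\<lambda>r. ?f r ^ ?n) has_real_derivative ?n * dens r * slope r) (at r)"
      by (rule DERIV_cong) (use s n in \<open>simp add: dens_def power_mult_distrib field_simps\<close>)
    from DERIV_diff[OF DERIV_cmult[OF vprof_deriv] this, of "real ?n"] that show ?thesis
      by (simp add: algebra_simps)
  qed
  have "?n * vprof 0 - ?f 0 ^ ?n \<le> ?n * vprof r - ?f r ^ ?n"
  proof (rule DERIV_nonneg_imp_increasing_open[OF assms, where f = "\<lambda>r. ?n * vprof r - ?f r ^ ?n"])
    show "\<exists>y. ((\<lambda>r. ?n * vprof r - ?f r ^ ?n) has_real_derivative y) (at x) \<and> 0 \<le> y" if "0 < x" "x < r" for x
      using deriv[OF that(1)] slope_le_1[OF nonneg_curvature that(1)] dens_nonneg[of x] that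
      by (intro exI[of _ "?n * dens x * (1 - slope x)"] conjI) auto
    show "continuous_on {0..r} (\<lambda>r. ?n * vprof r - ?f r ^ ?n)"
      by (intro continuous_intros continuous_cA continuous_on_subset[OF continuous_vprof]) auto
  qed
  then show ?thesis using CARD_ge_2 by (simp add: power_0_left)
qed

text \<open>From f^n <= n y and y <= \<open>1 / ball_const\<close> follows f^n <=
  \<open>1 / unit_ball_vol n\<close>. The maximum with 1 bounds f itself without an n-th root, since
  f <= f^n once f > 1. The exponent is that of f in the energy.\<close>

definition orbit_bound :: real where
  "orbit_bound = max 1 (1 / unit_ball_vol CARD('n)) ^ (2 * (CARD('n) - 1))"

lemma orbit_bound_pos: "0 < orbit_bound"
  unfolding orbit_bound_def by (rule zero_less_power) auto

text \<open>The bounded quantity is (dy/ds)^2 = f^(2 (n - 1)), the weight of the squared derivative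
  in the energy.\<close>

lemma dens_sq_le:
  assumes "0 \<le> r" shows "(dens r)\<^sup>2 * cA r / disc r \<le> orbit_bound"
proof -
  let ?n = "CARD('n)" and ?f = "r * sqrt (cA r)"
  have n: "?n - 1 = Suc (?n - 2)" "1 \<le> ?n" using CARD_ge_2 by simp_all
  have s: "sqrt (cA r) ^ 2 = cA r" "sqrt (disc r) ^ 2 = disc r" "disc r \<noteq> 0"
    using cA_pos[of r] disc_pos[of r] by simp_all
  have f0: "0 \<le> ?f" using assms cA_pos[of r] by simp
  have "?f ^ ?n \<le> ?n * (1 / ball_const)"
    using profile_le_vprof[OF assms] vprof_le[OF assms] by (meson mult_left_mono of_nat_0_le_iff order_trans)
  also have "\<dots> = 1 / unit_ball_vol ?n" by (simp add: ball_const_def)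
  finally have fn: "?f ^ ?n \<le> 1 / unit_ball_vol ?n" .
  have "?f \<le> max 1 (1 / unit_ball_vol ?n)"
  proof (cases "?f \<le> 1")
    case False
    then have "?f ^ 1 \<le> ?f ^ ?n" by (intro power_increasing n) auto
    then show ?thesis using fn by simp
  qed simp
  then have "?f ^ (2 * (?n - 1)) \<le> orbit_bound"
    unfolding orbit_bound_def by (intro power_mono f0)
  moreover have "(dens r)\<^sup>2 * cA r / disc r = ?f ^ (2 * (?n - 1))"
  proof -
    have "(dens r)\<^sup>2 = (sqrt (cA r) ^ 2) ^ (?n - 2) * sqrt (disc r) ^ 2 * (r ^ 2) ^ (?n - 1)"
      unfolding dens_def power_mult_distrib by (simp only: power_mult[symmetric] mult.commute)
    also have "\<dots> = cA r ^ (?n - 2) * disc r * (r ^ 2) ^ (?n - 1)" by (simp only: s)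
    finally have "(dens r)\<^sup>2 * cA r / disc r = cA r ^ (?n - 1) * (r ^ 2) ^ (?n - 1)"
      using s(3) n by simp
    also have "\<dots> = (?f ^ 2) ^ (?n - 1)" by (simp add: power_mult_distrib s(1))
    finally show ?thesis by (simp only: power_mult)
  qed
  ultimately show ?thesis by simp
qed

end

subsection \<open>Invariant functions of the volume profile\<close>

text \<open>Squaring the positive part makes the function C1 across 0 and 1, the regularity that
  integration by parts asks for.\<close>

definition bump :: "real \<Rightarrow> real" where "bump x = (max 0 (x * (1 - x)))\<^sup>2"
definition bump' :: "real \<Rightarrow> real" where "bump' x = 2 * max 0 (x * (1 - x)) * (1 - 2 * x)"

lemma bump_deriv: "(bump has_real_derivative bump' x) (at x)"
proof -
  have sq: "((\<lambda>z. (max 0 z)\<^sup>2) has_real_derivative 2 * max 0 z) (at z)" for z :: real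
  proof -
    consider "z < 0" | "z = 0" | "0 < z" by linarith
    then show ?thesis
    proof cases
      case 1
      have "((\<lambda>_. 0) has_real_derivative 2 * max 0 z) (at z)" using 1 by simp
      then show ?thesis
        by (rule has_field_derivative_transform_within_open[where S = "{..<0}"]) (use 1 in auto)
    next
      case 2
      have "((\<lambda>h::real. (max 0 (0 + h))\<^sup>2 / h - 0) \<longlongrightarrow> 0) (at 0)"
      proof (rule Lim_null_comparison)
        show "((\<lambda>h::real. \<bar>h\<bar>) \<longlongrightarrow> 0) (at 0)"
          using tendsto_rabs_zero[OF tendsto_ident_at] .
        show "\<forall>\<^sub>F h in at 0. norm ((max 0 (0 + h))\<^sup>2 / h - 0) \<le> \<bar>h :: real\<bar>"
          by (rule always_eventually) (auto simp: max_def power2_eq_square)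
      qed
      then show ?thesis using 2 by (simp add: DERIV_def)
    next
      case 3
      have "((\<lambda>z. z\<^sup>2) has_real_derivative 2 * max 0 z) (at z)" using 3 by (auto intro!: derivative_eq_intros)
      then show ?thesis
        by (rule has_field_derivative_transform_within_open[where S = "{0<..}"]) (use 3 in auto)
    qed
  qed
  have "((\<lambda>x. x * (1 - x)) has_real_derivative 1 - 2 * x) (at x)"
    by (rule derivative_eq_intros refl)+ simp
  from DERIV_chain2[OF sq this] show ?thesis
    unfolding bump_def[abs_def] bump'_def .
qed

lemma bump_outside:
  assumes "x \<le> 0 \<or> 1 \<le> x" shows "bump x = 0" "bump' x = 0"
proof -
  have "x * (1 - x) \<le> 0" using assms by (auto simp: mult_le_0_iff)
  then have "max 0 (x * (1 - x)) = 0" by simp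
  then show "bump x = 0" "bump' x = 0" unfolding bump_def bump'_def by simp_all
qed

lemma bump_pos: "0 < x \<Longrightarrow> x < 1 \<Longrightarrow> 0 < bump x"
  by (simp add: bump_def max_def mult_le_0_iff)

text \<open>
  With \<open>w = Y / (k + 3)\<close>, the translates with index \<open>i \<le> k\<close> live on \<open>[(i + 1) w, (i + 2) w]\<close>, which
  leaves a margin \<open>w\<close> at both ends of \<open>[0, Y]\<close>.
\<close>

definition width :: "real \<Rightarrow> nat \<Rightarrow> real" where "width Y k = Y / (k + 3)"

definition tst :: "real \<Rightarrow> nat \<Rightarrow> nat \<Rightarrow> real \<Rightarrow> real" where
  "tst Y k i y = bump (y / width Y k - (i + 1))"
definition tst' :: "real \<Rightarrow> nat \<Rightarrow> nat \<Rightarrow> real \<Rightarrow> real" where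
  "tst' Y k i y = bump' (y / width Y k - (i + 1)) / width Y k"

lemma width_pos: "0 < Y \<Longrightarrow> 0 < width Y k"
  by (simp add: width_def)

lemma tst_deriv:
  assumes "0 < Y" shows "(tst Y k i has_real_derivative tst' Y k i y) (at y)"
proof -
  have "((\<lambda>y. y / width Y k - (i + 1)) has_real_derivative 1 / width Y k) (at y)"
    using width_pos[OF assms, of k] by (auto intro!: derivative_eq_intros)
  from DERIV_chain2[OF bump_deriv this] show ?thesis
    unfolding tst_def[abs_def] tst'_def by simp
qed

lemma continuous_tst: "continuous_on S (tst Y k i)" and continuous_tst': "continuous_on S (tst' Y k i)"
proof -
  have "continuous_on UNIV bump" "continuous_on UNIV bump'"
    unfolding bump_def[abs_def] bump'_def[abs_def] by (intro continuous_intros)+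
  then show "continuous_on S (tst Y k i)" "continuous_on S (tst' Y k i)"
    unfolding tst_def[abs_def] tst'_def[abs_def] divide_inverse
    by (auto intro!: continuous_intros intro: continuous_on_compose2)
qed

lemma tst_outside:
  assumes "0 < Y" "i \<le> k" "y \<le> width Y k \<or> Y - width Y k \<le> y"
  shows "tst Y k i y = 0" "tst' Y k i y = 0"
proof -
  let ?w = "width Y k"
  have w: "0 < ?w" "Y = ?w * (k + 3)" using assms(1) by (simp_all add: width_def)
  have "y / ?w - (i + 1) \<le> 0 \<or> 1 \<le> y / ?w - (i + 1)"
    using assms(3)
  proof
    assume "y \<le> ?w"
    then have "y / ?w \<le> 1" using w(1) by simp
    then show ?thesis by simp
  next
    assume "Y - ?w \<le> y"
    then have "?w * (k + 2) \<le> y" using w by (simp add: algebra_simps)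
    then have "k + 2 \<le> y / ?w" using w(1) by (simp add: pos_le_divide_eq mult.commute)
    moreover have "real i \<le> real k" using assms(2) by simp
    ultimately show ?thesis by simp
  qed
  then show "tst Y k i y = 0" "tst' Y k i y = 0"
    unfolding tst_def tst'_def using bump_outside by simp_all
qed

text \<open>Neighbouring supports meet in an endpoint at most, where \<open>bump\<close> and
  \<open>bump'\<close> vanish.\<close>

lemma tst_disjoint:
  assumes "i \<noteq> j" shows "tst Y k i y * tst Y k j y = 0" "tst' Y k i y * tst' Y k j y = 0"
proof -
  let ?z = "y / width Y k"
  have "?z - (i + 1) \<le> 0 \<or> 1 \<le> ?z - (i + 1) \<or> ?z - (j + 1) \<le> 0 \<or> 1 \<le> ?z - (j + 1)"
    using assms by (cases "i < j") auto
  then show "tst Y k i y * tst Y k j y = 0" "tst' Y k i y * tst' Y k j y = 0"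
    unfolding tst_def tst'_def using bump_outside by auto
qed

lemma square_sum_disjoint:
  fixes f :: "nat \<Rightarrow> real"
  assumes "\<And>i j. i \<noteq> j \<Longrightarrow> f i * f j = 0"
  shows "(\<Sum>i\<in>I. c i * f i)\<^sup>2 = (\<Sum>i\<in>I. (c i)\<^sup>2 * (f i)\<^sup>2)"
proof (cases "finite I")
  case True
  then show ?thesis
  proof (induction I rule: finite_induct)
    case (insert x I)
    have "(c x * f x) * (\<Sum>i\<in>I. c i * f i) = (\<Sum>i\<in>I. c x * c i * (f x * f i))"
      by (simp add: sum_distrib_left ac_simps)
    also have "\<dots> = 0"
    proof (intro sum.neutral ballI)
      fix i assume "i \<in> I"
      then have "f x * f i = 0" using assms insert(2) by metis
      then show "c x * c i * (f x * f i) = 0" by simp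
    qed
    finally show ?case using insert by (simp add: power2_sum power_mult_distrib)
  qed simp
qed simp

text \<open>\<open>mass\<close> and \<open>stiff\<close> see the metric only through the length
  \<open>Y\<close> of the range of \<open>y\<close>, which unit volume fixes in terms of n.\<close>

definition mass :: "real \<Rightarrow> nat \<Rightarrow> nat \<Rightarrow> ennreal" where
  "mass Y k i = (\<integral>\<^sup>+ y. ennreal ((tst Y k i y)\<^sup>2) \<partial>lborel)"
definition stiff :: "real \<Rightarrow> nat \<Rightarrow> nat \<Rightarrow> ennreal" where
  "stiff Y k i = (\<integral>\<^sup>+ y. ennreal ((tst' Y k i y)\<^sup>2) \<partial>lborel)"

lemma nn_integral_compact_support_finite:
  fixes f :: "real \<Rightarrow> real"
  assumes "continuous_on UNIV f" "\<And>y. y \<le> a \<or> b \<le> y \<Longrightarrow> f y = 0" "\<And>y. 0 \<le> f y"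
  shows "(\<integral>\<^sup>+ y. ennreal (f y) \<partial>lborel) < \<infinity>"
proof -
  have "integrable lborel f"
    by (rule continuous_compact_support_integrable[OF assms(1), of "{a..b}"]) (use assms(2) in auto)
  then show ?thesis using assms(3) by (simp add: nn_integral_eq_integral)
qed

lemma mass_finite: "0 < Y \<Longrightarrow> i \<le> k \<Longrightarrow> mass Y k i < \<infinity>"
  unfolding mass_def
  by (rule nn_integral_compact_support_finite[of _ "width Y k" "Y - width Y k"])
     (auto intro!: continuous_intros continuous_tst simp: tst_outside)

lemma stiff_finite: "0 < Y \<Longrightarrow> i \<le> k \<Longrightarrow> stiff Y k i < \<infinity>"
  unfolding stiff_def
  by (rule nn_integral_compact_support_finite[of _ "width Y k" "Y - width Y k"])
     (auto intro!: continuous_intros continuous_tst' simp: tst_outside)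

lemma mass_pos:
  assumes "0 < Y" shows "0 < mass Y k i"
proof (rule ccontr)
  assume "\<not> 0 < mass Y k i"
  then have "mass Y k i = 0" by simp
  moreover have "(\<lambda>y. ennreal ((tst Y k i y)\<^sup>2)) \<in> borel_measurable lborel"
    by (auto intro!: borel_measurable_continuous_onI continuous_intros continuous_tst)
  ultimately have "AE y in lborel. ennreal ((tst Y k i y)\<^sup>2) = 0"
    unfolding mass_def by (simp add: nn_integral_0_iff_AE)
  then have ae: "AE y in lborel. tst Y k i y = 0" by simp
  let ?w = "width Y k"
  have w: "0 < ?w" by (rule width_pos[OF assms])
  have "AE y in lborel. y \<notin> {?w * (i + 1)<..<?w * (i + 2)}"
    using ae
  proof (rule eventually_mono)
    fix y assume 0: "tst Y k i y = 0"
    show "y \<notin> {?w * (i + 1)<..<?w * (i + 2)}"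
    proof
      assume "y \<in> {?w * (i + 1)<..<?w * (i + 2)}"
      then have "0 < y / ?w - (i + 1)" "y / ?w - (i + 1) < 1" using w by (auto simp: field_simps)
      from bump_pos[OF this] show False using 0 by (simp add: tst_def)
    qed
  qed
  then have "{?w * (i + 1)<..<?w * (i + 2)} \<in> null_sets lborel"
    by (subst AE_iff_null_sets) auto
  then have "emeasure lborel {?w * (i + 1)<..<?w * (i + 2)} = 0" by auto
  then show False using w by (simp add: algebra_simps)
qed

section \<open>The height coordinate and its inverse\<close>

context unit_volume_metric
begin

definition radius :: "real \<Rightarrow> real" where "radius x = sqrt ((1 + x) / (1 - x))"

lemma radius_height: "0 \<le> r \<Longrightarrow> radius (height r) = r"
proof -
  assume r: "0 \<le> r"
  have p: "r\<^sup>2 + 1 \<noteq> 0" using zero_le_power2[of r] by linarith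
  have "(1 + height r) / (1 - height r) = r\<^sup>2"
    unfolding height_def using p by (simp add: divide_simps)
  then show ?thesis using r by (simp add: radius_def)
qed

lemma sq_plus_1_pos: "0 < r\<^sup>2 + (1 :: real)"
  using zero_le_power2[of r] by linarith

lemma height_bounds: "- 1 \<le> height r" "height r < 1"
  unfolding height_def using sq_plus_1_pos[of r] by (simp_all add: pos_le_divide_eq pos_divide_less_eq)

lemma height_gt: "0 < r \<Longrightarrow> - 1 < height r"
  unfolding height_def using sq_plus_1_pos[of r] by (simp add: pos_less_divide_eq)

lemma one_minus_height: "1 - height r = 2 / (r\<^sup>2 + 1)"
proof -
  have p: "r\<^sup>2 + 1 \<noteq> 0" using zero_le_power2[of r] by linarith
  then show ?thesis unfolding height_def by (simp add: divide_simps)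
qed

lemma height_mono: "0 \<le> r \<Longrightarrow> r < s \<Longrightarrow> height r < height s"
proof -
  assume "0 \<le> r" "r < s"
  then have "r\<^sup>2 < s\<^sup>2" by (intro power_strict_mono) auto
  then have "2 / (s\<^sup>2 + 1) < 2 / (r\<^sup>2 + 1)" by (intro divide_strict_left_mono mult_pos_pos sq_plus_1_pos) auto
  then show ?thesis unfolding one_minus_height[symmetric] by simp
qed

lemma height_radius: "- 1 < x \<Longrightarrow> x < 1 \<Longrightarrow> height (radius x) = x"
proof -
  assume x: "- 1 < x" "x < 1"
  have "(radius x)\<^sup>2 = (1 + x) / (1 - x)" using x by (simp add: radius_def)
  moreover have "(1 + x) / (1 - x) - 1 = 2 * x / (1 - x)" "(1 + x) / (1 - x) + 1 = 2 / (1 - x)"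
    using x by (simp_all add: divide_simps)
  ultimately show ?thesis unfolding height_def using x by simp
qed

lemma radius_pos: "- 1 < x \<Longrightarrow> x < 1 \<Longrightarrow> 0 < radius x"
  by (simp add: radius_def)

lemma radius_deriv:
  assumes "- 1 < x" "x < 1"
  shows "(radius has_real_derivative 1 / (radius x * (1 - x)\<^sup>2)) (at x)"
proof -
  have q: "0 < (1 + x) / (1 - x)" using assms by simp
  have "((\<lambda>x. (1 + x) / (1 - x)) has_real_derivative 2 / (1 - x)\<^sup>2) (at x)"
    by (rule derivative_eq_intros refl)+ (use assms in \<open>auto simp: power2_eq_square field_simps\<close>)
  note d = DERIV_chain2[OF DERIV_real_sqrt[OF q] this]
  have "inverse s / 2 * (2 / c) = 1 / (s * c)" for s c :: real
    by (simp add: inverse_eq_divide)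
  from this[of "sqrt ((1 + x) / (1 - x))" "(1 - x)\<^sup>2"] show ?thesis
    using d unfolding radius_def[abs_def] by (simp only:)
qed

lemma continuous_radius: "continuous_on {- 1<..<1} radius"
  by (rule DERIV_continuous_on, rule has_field_derivative_at_within, rule radius_deriv) simp_all

end

text \<open>\<open>h\<close> is a C1 profile in the variable \<open>y\<close>, whose range ends at
  \<open>1 / ball_const\<close>. The margin \<open>w\<close> at both ends is what makes the
  resulting function on the sphere vanish near the poles.\<close>

locale transplant = unit_volume_metric g i1 i2 for g :: "'n::finite metric_field" and i1 i2 +
  fixes h h' :: "real \<Rightarrow> real" and w :: real
  assumes h_deriv: "\<And>y. (h has_real_derivative h' y) (at y)" and h'_cont: "continuous_on UNIV h'"
    and w: "0 < w"
    and h_supp: "\<And>y. y \<le> w \<or> 1 / ball_const - w \<le> y \<Longrightarrow> h y = 0 \<and> h' y = 0"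
begin

text \<open>The profile as a function of the first coordinate, defined on the whole real line. It is
  C1 there, so its composition with \<open>fst\<close> can be differentiated in any parametrization,
  poles included. The indicator removes the values outside (-1, 1), where \<open>radius\<close> does
  not invert \<open>height\<close>.\<close>

definition hh :: "real \<Rightarrow> real" where "hh x = indicator {- 1<..<1} x *\<^sub>R h (vprof (radius x))"
definition hh' :: "real \<Rightarrow> real" where
  "hh' x = indicator {- 1<..<1} x *\<^sub>R (h' (vprof (radius x)) * (dens (radius x) / (radius x * (1 - x)\<^sup>2)))"

text \<open>Heights near -1 have small cap volume and heights near 1 almost full cap volume, so the
  margin in \<open>y\<close> becomes a margin in the height.\<close>

lemma support_interval:
  obtains x0 x1 where "- 1 < x0" "x1 < 1"
    "\<And>x. x \<in> {- 1<..<1} - {x0..x1} \<Longrightarrow> h (vprof (radius x)) = 0 \<and> h' (vprof (radius x)) = 0"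
proof -
  obtain R0 where R0: "0 < R0" "vprof R0 < w" by (rule vprof_small[OF w])
  obtain R1 where R1: "0 < R1" "1 / ball_const - w < vprof R1" by (rule vprof_reaches[OF w])
  show thesis
  proof (rule that[of "height R0" "height R1"])
    show "- 1 < height R0" by (rule height_gt[OF R0(1)])
    show "height R1 < 1" by (rule height_bounds)
    fix x assume x: "x \<in> {- 1<..<1} - {height R0..height R1}"
    then have x': "- 1 < x" "x < 1" by auto
    have r: "0 < radius x" "height (radius x) = x" using radius_pos[OF x'] height_radius[OF x'] by auto
    from x have "x < height R0 \<or> height R1 < x" by auto
    then have "radius x \<le> R0 \<or> R1 \<le> radius x"
      using height_mono[of R0 "radius x"] height_mono[of "radius x" R1] R0 R1 r by force
    then have "vprof (radius x) \<le> w \<or> 1 / ball_const - w \<le> vprof (radius x)"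
      using vprof_mono[of "radius x" R0] vprof_mono[of R1 "radius x"] R0 R1 r(1) by force
    then show "h (vprof (radius x)) = 0 \<and> h' (vprof (radius x)) = 0" by (rule h_supp)
  qed
qed

lemma hh_deriv: "(hh has_real_derivative hh' x) (at x)"
proof (cases "x \<in> {- 1<..<1}")
  case True
  then have x: "- 1 < x" "x < 1" by auto
  have "((\<lambda>x. h (vprof (radius x))) has_real_derivative
     h' (vprof (radius x)) * (dens (radius x) * (1 / (radius x * (1 - x)\<^sup>2)))) (at x)"
    by (rule DERIV_chain2[OF h_deriv DERIV_chain2[OF vprof_deriv radius_deriv[OF x]]])
       (use radius_pos[OF x] in simp)
  then have "((\<lambda>x. h (vprof (radius x))) has_real_derivative hh' x) (at x)"
    using True by (simp add: hh'_def)
  then show ?thesis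
    by (rule has_field_derivative_transform_within_open[OF _ open_greaterThanLessThan True])
       (simp add: hh_def)
next
  case False
  obtain x0 x1 where s: "- 1 < x0" "x1 < 1"
    "\<And>x. x \<in> {- 1<..<1} - {x0..x1} \<Longrightarrow> h (vprof (radius x)) = 0 \<and> h' (vprof (radius x)) = 0"
    using support_interval by blast
  have "((\<lambda>_. 0) has_real_derivative hh' x) (at x)" using False by (simp add: hh'_def)
  moreover have "hh y = 0" if "y \<in> - {x0..x1}" for y
    using s(3)[of y] that by (cases "y \<in> {- 1<..<1}") (auto simp: hh_def)
  moreover have "x \<in> - {x0..x1}" using False s by auto
  moreover have "open (- {x0..x1})" by (simp add: open_Compl)
  ultimately show ?thesis
    using has_field_derivative_transform_within_open[of "\<lambda>_. 0" "hh' x" x "- {x0..x1}" hh] by auto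
qed

lemma continuous_hh': "continuous_on UNIV hh'"
proof -
  obtain x0 x1 where s: "- 1 < x0" "x1 < 1"
    "\<And>x. x \<in> {- 1<..<1} - {x0..x1} \<Longrightarrow> h (vprof (radius x)) = 0 \<and> h' (vprof (radius x)) = 0"
    using support_interval by blast
  have r: "radius x \<noteq> 0" "0 \<le> radius x" "1 - x \<noteq> 0" if "x \<in> {- 1<..<1}" for x
    using radius_pos[of x] that by auto
  show ?thesis
    unfolding hh'_def[abs_def]
  proof (rule continuous_on_extend_zero[of _ "{x0..x1}"])
    show "continuous_on {- 1<..<1} (\<lambda>x. h' (vprof (radius x)) * (dens (radius x) / (radius x * (1 - x)\<^sup>2)))"
      by (intro continuous_intros continuous_on_compose2[OF h'_cont] continuous_on_compose2[OF continuous_vprof]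
          continuous_on_compose2[OF continuous_dens[of UNIV]] continuous_radius) (auto dest: r)
  qed (use s in auto)
qed

lemma continuous_hh: "continuous_on UNIV hh"
  by (rule DERIV_continuous_on, rule has_field_derivative_at_within, rule hh_deriv)

lemma hh_height: "0 < r \<Longrightarrow> hh (height r) = h (vprof r)"
  using height_gt[of r] height_bounds[of r] radius_height[of r] by (simp add: hh_def)

text \<open>Since \<open>height\<close> has derivative r (1 - height)^2 in r, this is the chain rule
  for \<open>h (vprof r)\<close>, divided by r.\<close>

lemma hh'_height: "0 < r \<Longrightarrow> hh' (height r) * (1 - height r)\<^sup>2 = h' (vprof r) * dens r / r"
  using height_gt[of r] height_bounds[of r] radius_height[of r] by (simp add: hh'_def)

section \<open>The transplanted function and its gradient\<close>

lemma hh'_ends: "hh' 1 = 0" "hh' (- 1) = 0" by (simp_all add: hh'_def)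

definition \<phi> :: "'n space \<Rightarrow> real" where "\<phi> p = hh (fst p)"

text \<open>The differential of \<open>fst\<close> along \<open>stereo\<close> is (1 - fst)^2 times
  that of half the squared norm, whence the factor in front of \<open>grad_radial\<close>. The point
  (1, 0) lies outside the chart; \<open>hh'\<close> vanishes at its height, so the gradient there is
  0.\<close>

definition grad :: "'n space \<Rightarrow> 'n space" where
  "grad p = (if fst p = 1 then 0 else (hh' (fst p) * (1 - fst p)\<^sup>2) *\<^sub>R dstereo (stereo_inv p) (grad_radial (stereo_inv p)))"

lemma grad_stereo: "grad (stereo u) = (hh' (fst (stereo u)) * (1 - fst (stereo u))\<^sup>2) *\<^sub>R dstereo u (grad_radial u)"
proof -
  have "fst (stereo u) \<noteq> 1" using one_minus_fst_stereo[of u] by auto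
  then show ?thesis by (simp add: grad_def)
qed

lemma sphere_cases:
  assumes "p \<in> unit_sphere"
  obtains "fst p = 1" | u where "p = stereo u" "fst p \<noteq> 1"
  using stereo_stereo_inv[OF assms] by metis

lemma tangent_scaleR: "v \<in> tangent_space p \<Longrightarrow> c *\<^sub>R v \<in> tangent_space p"
  by (simp add: tangent_space_def)

lemma grad_tangent: "p \<in> unit_sphere \<Longrightarrow> grad p \<in> tangent_space p"
proof (erule sphere_cases)
  assume "fst p = 1" then show ?thesis by (simp add: grad_def tangent_space_def)
next
  fix u assume "p = stereo u" then show ?thesis
    using tangent_scaleR[OF dstereo_tangent] by (simp add: grad_stereo)
qed

lemma g_zero: "p \<in> unit_sphere \<Longrightarrow> v \<in> tangent_space p \<Longrightarrow> g p 0 v = 0"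
  using g_scale[of p v v 0] by simp

lemma g_grad:
  assumes "p \<in> unit_sphere" "v \<in> tangent_space p"
  shows "g p (grad p) v = hh' (fst p) * fst v"
  using assms(1)
proof (rule sphere_cases)
  assume "fst p = 1" then show ?thesis using g_zero[OF assms] by (simp add: grad_def hh'_ends)
next
  fix u assume p: "p = stereo u"
  obtain z where z: "dstereo u z = v" using dstereo_surj assms(2) unfolding p by blast
  have "g p (grad p) v = hh' (fst p) * (1 - fst p)\<^sup>2 * form u (grad_radial u) z"
    unfolding p grad_stereo z[symmetric] form_def
    by (rule g_scale) auto
  also have "\<dots> = hh' (fst p) * ((1 - fst p)\<^sup>2 * (u \<bullet> z))" by (simp add: form_grad_radial)
  also have "(1 - fst p)\<^sup>2 * (u \<bullet> z) = fst v"
    unfolding p one_minus_fst_stereo z[symmetric] dstereo_def by (simp add: power_divide)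
  finally show ?thesis .
qed

definition energy_density :: "real \<Rightarrow> real" where
  "energy_density x = (hh' x * (1 - x)\<^sup>2)\<^sup>2 * ((radius x)\<^sup>2 * cA (radius x) / disc (radius x))"

lemma g_grad_grad:
  assumes "p \<in> unit_sphere" shows "g p (grad p) (grad p) = energy_density (fst p)"
  using assms
proof (rule sphere_cases)
  assume "fst p = 1"
  moreover have "(0 :: 'n space) \<in> tangent_space p" by (simp add: tangent_space_def)
  ultimately show ?thesis using g_zero[OF assms] by (simp add: grad_def energy_density_def)
next
  fix u assume p: "p = stereo u"
  let ?c = "hh' (fst p) * (1 - fst p)\<^sup>2"
  have "g p (grad p) (grad p) = form u (?c *\<^sub>R grad_radial u) (?c *\<^sub>R grad_radial u)"
    unfolding p grad_stereo form_def linear_scale[OF linear_dstereo] ..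
  also have "\<dots> = ?c\<^sup>2 * ((norm u)\<^sup>2 * cA (norm u) / disc (norm u))"
    unfolding linear_scale[OF form_linear_left] linear_scale[OF form_linear_right] form_grad_radial_self
    by (simp add: power2_eq_square)
  also have "norm u = radius (fst p)" by (simp add: p fst_stereo_norm radius_height)
  finally show ?thesis by (simp add: energy_density_def)
qed

lemma measurable_energy_density: "energy_density \<in> borel_measurable borel"
proof -
  have [measurable]: "hh' \<in> borel_measurable borel" "cA \<in> borel_measurable borel" "disc \<in> borel_measurable borel"
    by (auto intro: borel_measurable_continuous_onI continuous_hh' continuous_cA continuous_disc)
  show ?thesis unfolding energy_density_def[abs_def] radius_def[abs_def] by measurable
qed

lemma measurable_hh: "hh \<in> borel_measurable borel"
  by (rule borel_measurable_continuous_onI[OF continuous_hh])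

text \<open>In the radius the energy density is (h')^2 times the quantity bounded by
  \<open>dens_sq_le\<close>, because the factors r and (1 - height)^2 cancel. The substitution
  \<open>nn_integral_vprof\<close> then removes the metric.\<close>

lemma energy_le:
  "(\<integral>\<^sup>+ p. ennreal (g p (grad p) (grad p)) \<partial>vol g)
    \<le> ennreal ball_const * (ennreal orbit_bound * (\<integral>\<^sup>+ y. ennreal ((h' y)\<^sup>2) \<partial>lborel))"
proof -
  have "(\<integral>\<^sup>+ p. ennreal (g p (grad p) (grad p)) \<partial>vol g) = (\<integral>\<^sup>+ p. ennreal (energy_density (fst p)) \<partial>vol g)"
    by (rule nn_integral_cong) (simp add: space_vol g_grad_grad del: mem_sphere_0)
  also have "\<dots> = ennreal ball_const *
      (\<integral>\<^sup>+ r. ennreal (energy_density (height r)) * ennreal (dens r) * indicator {0..} r \<partial>lborel)"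
    by (rule nn_integral_vol[of "\<lambda>x. ennreal (energy_density x)"]) (use measurable_energy_density in measurable)
  also have "\<dots> \<le> ennreal ball_const *
      (\<integral>\<^sup>+ r. ennreal (orbit_bound * (h' (vprof r))\<^sup>2) * ennreal (dens r) * indicator {0..} r \<partial>lborel)"
  proof (rule mult_left_mono, rule nn_integral_mono)
    fix r :: real
    show "ennreal (energy_density (height r)) * ennreal (dens r) * indicator {0..} r
      \<le> ennreal (orbit_bound * (h' (vprof r))\<^sup>2) * ennreal (dens r) * indicator {0..} r"
    proof (cases "0 < r")
      case True
      have "energy_density (height r) = (h' (vprof r))\<^sup>2 * ((dens r)\<^sup>2 * cA r / disc r)"
        unfolding energy_density_def hh'_height[OF True] using True radius_height[of r]
        by (simp add: power_divide power_mult_distrib)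
      also have "\<dots> \<le> (h' (vprof r))\<^sup>2 * orbit_bound"
        using dens_sq_le[of r] True by (intro mult_left_mono) auto
      finally show ?thesis by (intro mult_right_mono ennreal_leI) (simp_all add: mult.commute)
    next
      case False
      \<comment> \<open>\<open>hh'_height\<close> speaks of positive radii only; at the pole the
        height is -1, where \<open>hh'\<close> vanishes.\<close>
      have "energy_density (height r) = 0" if "r = 0"
        using that by (simp add: energy_density_def height_def hh'_ends)
      then show ?thesis using False by (cases "r = 0") (auto split: split_indicator)
    qed
  qed auto
  also have "(\<integral>\<^sup>+ r. ennreal (orbit_bound * (h' (vprof r))\<^sup>2) * ennreal (dens r) * indicator {0..} r \<partial>lborel)
     = (\<integral>\<^sup>+ y. ennreal (orbit_bound * (h' y)\<^sup>2) \<partial>lborel)"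
    by (rule nn_integral_vprof[OF _ _ w])
       (use h_supp orbit_bound_pos in \<open>auto intro!: continuous_intros h'_cont\<close>)
  also have "\<dots> = ennreal orbit_bound * (\<integral>\<^sup>+ y. ennreal ((h' y)\<^sup>2) \<partial>lborel)"
  proof -
    have [measurable]: "h' \<in> borel_measurable borel" by (rule borel_measurable_continuous_onI[OF h'_cont])
    show ?thesis using orbit_bound_pos by (subst nn_integral_cmult[symmetric]) (auto simp: ennreal_mult)
  qed
  finally show ?thesis .
qed

lemma L2_norm: "(\<integral>\<^sup>+ p. ennreal ((\<phi> p)\<^sup>2) \<partial>vol g) = ennreal ball_const * (\<integral>\<^sup>+ y. ennreal ((h y)\<^sup>2) \<partial>lborel)"
proof -
  have "continuous_on UNIV h"
    by (rule DERIV_continuous_on, rule has_field_derivative_at_within, rule h_deriv)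
  have "(\<integral>\<^sup>+ p. ennreal ((\<phi> p)\<^sup>2) \<partial>vol g) = ennreal ball_const *
      (\<integral>\<^sup>+ r. ennreal ((hh (height r))\<^sup>2) * ennreal (dens r) * indicator {0..} r \<partial>lborel)"
    unfolding \<phi>_def by (rule nn_integral_vol[of "\<lambda>x. ennreal ((hh x)\<^sup>2)"]) (use measurable_hh in measurable)
  also have "(\<integral>\<^sup>+ r. ennreal ((hh (height r))\<^sup>2) * ennreal (dens r) * indicator {0..} r \<partial>lborel)
     = (\<integral>\<^sup>+ r. ennreal ((h (vprof r))\<^sup>2) * ennreal (dens r) * indicator {0..} r \<partial>lborel)"
  proof (rule nn_integral_cong)
    fix r :: real
    \<comment> \<open>The indicator in \<open>hh\<close> excludes the height -1, so
      \<open>hh\<close> is 0 at the pole, in agreement with \<open>h 0 = 0\<close>.\<close>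
    have "hh (height 0) = h (vprof 0)" using h_supp[of 0] w by (simp add: hh_def height_def)
    then show "ennreal ((hh (height r))\<^sup>2) * ennreal (dens r) * indicator {0..} r
      = ennreal ((h (vprof r))\<^sup>2) * ennreal (dens r) * indicator {0..} r"
      using hh_height[of r] by (cases "r = 0") (auto split: split_indicator)
  qed
  also have "\<dots> = (\<integral>\<^sup>+ y. ennreal ((h y)\<^sup>2) \<partial>lborel)"
    by (rule nn_integral_vprof[OF _ _ w])
       (use h_supp in \<open>auto intro!: continuous_intros \<open>continuous_on UNIV h\<close>\<close>)
  finally show ?thesis .
qed

lemma measurable_fst_space: "(fst :: 'n space \<Rightarrow> real) \<in> borel_measurable borel"
  by (auto intro!: borel_measurable_continuous_onI continuous_intros)

lemma measurable_snd_space: "(snd :: 'n space \<Rightarrow> real ^ 'n) \<in> borel_measurable borel"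
  by (auto intro!: borel_measurable_continuous_onI continuous_intros)

lemma measurable_\<phi>: "\<phi> \<in> borel_measurable (vol g)"
  unfolding \<phi>_def[abs_def] by (rule measurable_vol[OF measurable_compose[OF measurable_fst_space measurable_hh]])

lemma measurable_grad: "grad \<in> borel_measurable (vol g)"
proof -
  note [measurable] = measurable_fst_space measurable_snd_space
  have [measurable]: "hh' \<in> borel_measurable borel" by (rule borel_measurable_continuous_onI[OF continuous_hh'])
  have "continuous_on UNIV (\<lambda>u. dstereo u (grad_radial u))"
    unfolding dstereo_def by (intro continuous_intros continuous_grad_radial) (auto simp del: power2_eq_square)
  then have D: "(\<lambda>u. dstereo u (grad_radial u)) \<in> borel_measurable borel" by (rule borel_measurable_continuous_onI)
  have s: "stereo_inv \<in> borel_measurable (borel :: 'n space measure)"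
    unfolding stereo_inv_def[abs_def] by measurable
  have [measurable]: "(\<lambda>p. dstereo (stereo_inv p) (grad_radial (stereo_inv p))) \<in> borel_measurable borel"
    by (rule measurable_compose[OF s D])
  have "grad \<in> borel_measurable borel" unfolding grad_def[abs_def] by measurable
  then show ?thesis by (rule measurable_vol)
qed

text \<open>The composition of \<open>\<phi>\<close> with any parametrization is C1, so classical
  integration by parts applies, and by \<open>g_grad\<close> the covector of \<open>grad\<close> is
  its differential.\<close>

lemma grad_weak: "grad \<in> weak_gradients g \<phi>" if fin: "(\<integral>\<^sup>+ y. ennreal ((h' y)\<^sup>2) \<partial>lborel) < \<infinity>"
  unfolding weak_gradients_def
proof (intro CollectI conjI allI impI ballI)
  show "grad \<in> borel_measurable (vol g)" by (rule measurable_grad)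
  show "grad p \<in> tangent_space p" if "p \<in> unit_sphere" for p using that by (rule grad_tangent)
  show "(\<integral>\<^sup>+ p. ennreal (g p (grad p) (grad p)) \<partial>vol g) < \<infinity>"
    by (rule le_less_trans[OF energy_le]) (use fin in \<open>simp add: ennreal_mult_less_top\<close>)
next
  fix U :: "(real ^ 'n) set" and \<psi> :: "real ^ 'n \<Rightarrow> 'n space" and \<eta> :: "real ^ 'n \<Rightarrow> real" and i :: 'n
  assume *: "local_param U \<psi> \<and> test_function U \<eta>"
  then have U: "open U" and \<psi>: "C_on 1 \<psi> U" "\<psi> ` U \<subseteq> unit_sphere" and \<eta>: "C_on 1 \<eta> UNIV"
    and supp: "compact (closure {u. \<eta> u \<noteq> 0})" "closure {u. \<eta> u \<noteq> 0} \<subseteq> U"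
    unfolding local_param_def test_function_def smooth_on_def by auto
  note \<psi>1 = \<psi>(1)[unfolded One_nat_def]
  note \<eta>1 = \<eta>[unfolded One_nat_def]
  let ?D = "\<lambda>u. frechet_derivative \<psi> (at u)"
  have d\<psi>: "(\<psi> has_derivative ?D u) (at u)" if "u \<in> U" for u by (rule C_on_SucD[OF U \<psi>1 that])
  have d\<eta>: "(\<eta> has_derivative frechet_derivative \<eta> (at u)) (at u)" for u by (rule C_on_SucD[OF open_UNIV \<eta>1 UNIV_I])
  have c\<psi>: "continuous_on U \<psi>" using C_on_lower[OF U \<psi>1] by simp
  have df: "((\<lambda>u. \<phi> (\<psi> u)) has_derivative (\<lambda>v. hh' (fst (\<psi> u)) * fst (?D u v))) (at u)" if u: "u \<in> U" for u
  proof -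
    have "((\<lambda>u. fst (\<psi> u)) has_derivative (\<lambda>v. fst (?D u v))) (at u)"
      by (rule has_derivative_fst[OF d\<psi>[OF u]])
    from has_derivative_compose[OF this, of hh "(*) (hh' (fst (\<psi> u)))"] hh_deriv show ?thesis
      unfolding \<phi>_def has_field_derivative_def by auto
  qed
  have parts: "(LINT u:U|lborel. \<phi> (\<psi> u) * frechet_derivative \<eta> (at u) (axis i 1)) =
      - (LINT u:U|lborel. hh' (fst (\<psi> u)) * fst (?D u (axis i 1)) * \<eta> u)"
  proof (rule integration_by_parts[OF U df _ d\<eta> _ supp])
    have "continuous_on U (\<lambda>u. ?D u (axis i 1))" using \<psi>1 by simp
    then show "continuous_on U (\<lambda>u. hh' (fst (\<psi> u)) * fst (?D u (axis i 1)))"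
      by (intro continuous_intros continuous_on_compose2[OF continuous_hh'] c\<psi>) auto
    show "continuous_on UNIV (\<lambda>u. frechet_derivative \<eta> (at u) (axis i 1))" using \<eta>1 by simp
    show "\<eta> u = 0" if "u \<notin> closure {u. \<eta> u \<noteq> 0}" for u
      using that subsetD[OF closure_subset, of u "{u. \<eta> u \<noteq> 0}"] by auto
  qed
  \<comment> \<open>Obtained by differentiating the constant
    \<open>\<psi> u \<bullet> \<psi> u = 1\<close>.\<close>
  have tang: "partial i \<psi> u \<in> tangent_space (\<psi> u)" if u: "u \<in> U" for u
  proof -
    have "((\<lambda>u. \<psi> u \<bullet> \<psi> u) has_derivative (\<lambda>v. \<psi> u \<bullet> ?D u v + ?D u v \<bullet> \<psi> u)) (at u)"
      by (rule has_derivative_inner[OF d\<psi>[OF u] d\<psi>[OF u]])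
    moreover have "((\<lambda>u. \<psi> u \<bullet> \<psi> u) has_derivative (\<lambda>v. 0)) (at u)"
    proof -
      have "\<psi> x \<bullet> \<psi> x = 1" if "x \<in> U" for x
        using \<psi>(2) that by (auto simp: power2_norm_eq_inner[symmetric] image_subset_iff)
      then show ?thesis using has_derivative_cong_open[OF U u, of "\<lambda>u. \<psi> u \<bullet> \<psi> u" "\<lambda>_. 1"] by simp
    qed
    ultimately have "\<psi> u \<bullet> ?D u (axis i 1) + ?D u (axis i 1) \<bullet> \<psi> u = 0"
      by (rule fun_cong[OF has_derivative_unique])
    then show ?thesis by (simp add: tangent_space_def partial_def inner_commute)
  qed
  have eq: "g (\<psi> u) (grad (\<psi> u)) (partial i \<psi> u) = hh' (fst (\<psi> u)) * fst (?D u (axis i 1))" if "u \<in> U" for u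
    using g_grad[OF _ tang[OF that]] \<psi>(2) that unfolding partial_def by blast
  have "(LINT u:U|lborel. g (\<psi> u) (grad (\<psi> u)) (partial i \<psi> u) * \<eta> u)
     = (LINT u:U|lborel. hh' (fst (\<psi> u)) * fst (?D u (axis i 1)) * \<eta> u)"
    by (rule set_lebesgue_integral_cong) (use U in \<open>auto simp: eq\<close>)
  with parts show "(LINT u:U|lborel. \<phi> (\<psi> u) * partial i \<eta> u) =
      - (LINT u:U|lborel. g (\<psi> u) (grad (\<psi> u)) (partial i \<psi> u) * \<eta> u)"
    unfolding partial_def by simp
qed

lemma \<phi>_W12_invariant:
  assumes "(\<integral>\<^sup>+ y. ennreal ((h' y)\<^sup>2) \<partial>lborel) < \<infinity>" "(\<integral>\<^sup>+ y. ennreal ((h y)\<^sup>2) \<partial>lborel) < \<infinity>"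
  shows "\<phi> \<in> W12_invariant g"
  unfolding W12_invariant_def W12_def
proof (intro CollectI conjI ballI)
  show "\<phi> \<in> borel_measurable (vol g)" by (rule measurable_\<phi>)
  show "(\<integral>\<^sup>+ p. ennreal ((\<phi> p)\<^sup>2) \<partial>vol g) < \<infinity>"
    unfolding L2_norm using assms(2) by (simp add: ennreal_mult_less_top)
  show "weak_gradients g \<phi> \<noteq> {}" using grad_weak[OF assms(1)] by auto
  show "AE p in vol g. \<phi> (so_act A p) = \<phi> p" for A by (simp add: \<phi>_def so_act_def)
qed

lemma dirichlet_energy_le:
  assumes "(\<integral>\<^sup>+ y. ennreal ((h' y)\<^sup>2) \<partial>lborel) < \<infinity>"
  shows "dirichlet_energy g \<phi> \<le> ennreal ball_const * (ennreal orbit_bound * (\<integral>\<^sup>+ y. ennreal ((h' y)\<^sup>2) \<partial>lborel))"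
  unfolding dirichlet_energy_def by (rule order_trans, rule INF_lower[OF grad_weak[OF assms]], rule energy_le)

end

section \<open>The space of test functions and its Rayleigh quotients\<close>

context unit_volume_metric
begin

definition total :: real where "total = 1 / ball_const"

text \<open>This is \<open>transplant.\<phi>\<close> with the profile as an argument, so that
  different profiles can be combined linearly.\<close>

definition lift :: "(real \<Rightarrow> real) \<Rightarrow> 'n space \<Rightarrow> real" where
  "lift h p = indicator {- 1<..<1} (fst p) *\<^sub>R h (vprof (radius (fst p)))"

definition comb :: "nat \<Rightarrow> (nat \<Rightarrow> real) \<Rightarrow> real \<Rightarrow> real" where
  "comb k c y = (\<Sum>i\<le>k. c i * tst total k i y)"
definition comb' :: "nat \<Rightarrow> (nat \<Rightarrow> real) \<Rightarrow> real \<Rightarrow> real" where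
  "comb' k c y = (\<Sum>i\<le>k. c i * tst' total k i y)"

lemma total_pos: "0 < total" using ball_const_pos by (simp add: total_def)

lemma transplant_comb: "transplant g i1 i2 (comb k c) (comb' k c) (width total k)"
proof unfold_locales
  show "(comb k c has_real_derivative comb' k c y) (at y)" for y
    unfolding comb_def[abs_def] comb'_def by (intro DERIV_sum DERIV_cmult tst_deriv total_pos)
  show "continuous_on UNIV (comb' k c)"
    unfolding comb'_def[abs_def] by (intro continuous_intros continuous_tst')
  show "0 < width total k" by (rule width_pos[OF total_pos])
  show "comb k c y = 0 \<and> comb' k c y = 0" if "y \<le> width total k \<or> 1 / ball_const - width total k \<le> y" for y
    unfolding comb_def comb'_def using tst_outside[OF total_pos _ that[folded total_def]] by simp
qed

lemma transplant_\<phi>: "transplant.\<phi> g i1 i2 (comb k c) = lift (comb k c)"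
proof -
  interpret transplant g i1 i2 "comb k c" "comb' k c" "width total k" by (rule transplant_comb)
  show ?thesis unfolding fun_eq_iff \<phi>_def hh_def lift_def by simp
qed

lemma lift_comb: "lift (comb k c) p = (\<Sum>i\<le>k. c i * lift (tst total k i) p)"
  by (simp add: lift_def comb_def sum_distrib_left ac_simps)

lemma comb_unit: "i \<le> k \<Longrightarrow> comb k (\<lambda>j. if j = i then 1 else 0) = tst total k i"
proof
  fix y assume "i \<le> k"
  have "comb k (\<lambda>j. if j = i then 1 else 0) y = (\<Sum>j\<le>k. if j = i then tst total k j y else 0)"
    unfolding comb_def by (rule sum.cong) auto
  then show "comb k (\<lambda>j. if j = i then 1 else 0) y = tst total k i y"
    using \<open>i \<le> k\<close> by simp
qed

text \<open>Disjoint supports kill all mixed terms, so both quadratic forms are diagonal in the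
  coefficients.\<close>

lemma nn_integral_comb:
  "(\<integral>\<^sup>+ y. ennreal ((comb k c y)\<^sup>2) \<partial>lborel) = (\<Sum>i\<le>k. ennreal ((c i)\<^sup>2) * mass total k i)"
  "(\<integral>\<^sup>+ y. ennreal ((comb' k c y)\<^sup>2) \<partial>lborel) = (\<Sum>i\<le>k. ennreal ((c i)\<^sup>2) * stiff total k i)"
proof -
  have [measurable]: "tst total k i \<in> borel_measurable borel" "tst' total k i \<in> borel_measurable borel" for i
    by (auto intro: borel_measurable_continuous_onI continuous_tst continuous_tst')
  have "(\<integral>\<^sup>+ y. ennreal ((comb k c y)\<^sup>2) \<partial>lborel)
      = (\<integral>\<^sup>+ y. (\<Sum>i\<le>k. ennreal ((c i)\<^sup>2) * ennreal ((tst total k i y)\<^sup>2)) \<partial>lborel)"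
    unfolding comb_def
    by (subst square_sum_disjoint) (simp_all add: tst_disjoint(1)[simplified] ennreal_mult[symmetric])
  also have "\<dots> = (\<Sum>i\<le>k. ennreal ((c i)\<^sup>2) * mass total k i)"
    unfolding mass_def by (simp add: nn_integral_sum nn_integral_cmult)
  finally show "(\<integral>\<^sup>+ y. ennreal ((comb k c y)\<^sup>2) \<partial>lborel) = (\<Sum>i\<le>k. ennreal ((c i)\<^sup>2) * mass total k i)" .
  have "(\<integral>\<^sup>+ y. ennreal ((comb' k c y)\<^sup>2) \<partial>lborel)
      = (\<integral>\<^sup>+ y. (\<Sum>i\<le>k. ennreal ((c i)\<^sup>2) * ennreal ((tst' total k i y)\<^sup>2)) \<partial>lborel)"
    unfolding comb'_def
    by (subst square_sum_disjoint) (simp_all add: tst_disjoint(2)[simplified] ennreal_mult[symmetric])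
  also have "\<dots> = (\<Sum>i\<le>k. ennreal ((c i)\<^sup>2) * stiff total k i)"
    unfolding stiff_def by (simp add: nn_integral_sum nn_integral_cmult)
  finally show "(\<integral>\<^sup>+ y. ennreal ((comb' k c y)\<^sup>2) \<partial>lborel) = (\<Sum>i\<le>k. ennreal ((c i)\<^sup>2) * stiff total k i)" .
qed

lemma comb_finite:
  "(\<integral>\<^sup>+ y. ennreal ((comb k c y)\<^sup>2) \<partial>lborel) < \<infinity>" "(\<integral>\<^sup>+ y. ennreal ((comb' k c y)\<^sup>2) \<partial>lborel) < \<infinity>"
  unfolding nn_integral_comb
  using mass_finite[OF total_pos] stiff_finite[OF total_pos]
  by (auto simp: ennreal_mult_less_top less_top[symmetric] ennreal_mult_eq_top_iff)

lemma comb_mass_pos: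
  assumes "i \<le> k" "c i \<noteq> 0" shows "0 < (\<integral>\<^sup>+ y. ennreal ((comb k c y)\<^sup>2) \<partial>lborel)"
proof -
  have "0 < ennreal ((c i)\<^sup>2) * mass total k i"
    using assms(2) mass_pos[OF total_pos] by (simp add: ennreal_zero_less_mult_iff)
  also have "\<dots> \<le> (\<Sum>i\<le>k. ennreal ((c i)\<^sup>2) * mass total k i)"
    by (rule member_le_sum) (use assms(1) in auto)
  finally show ?thesis unfolding nn_integral_comb .
qed

text \<open>For diagonal forms the largest quotient of diagonal entries bounds the Rayleigh
  quotient; the sum of these nonnegative quotients is a convenient substitute for the
  maximum.\<close>

definition ratio :: "nat \<Rightarrow> real" where
  "ratio k = (\<Sum>i\<le>k. enn2real (stiff total k i) / enn2real (mass total k i))"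

lemma ratio_nonneg: "0 \<le> ratio k"
  unfolding ratio_def by (intro sum_nonneg divide_nonneg_nonneg) auto

lemma stiff_le:
  assumes "i \<le> k" shows "stiff total k i \<le> ennreal (ratio k) * mass total k i"
proof -
  have m: "mass total k i = ennreal (enn2real (mass total k i))"
    and s: "stiff total k i = ennreal (enn2real (stiff total k i))"
    using mass_finite[OF total_pos assms] stiff_finite[OF total_pos assms] by simp_all
  have pos: "0 < enn2real (mass total k i)"
    using mass_finite[OF total_pos assms] mass_pos[OF total_pos, of k i] by (simp add: enn2real_positive_iff)
  have "enn2real (stiff total k i) / enn2real (mass total k i) \<le> ratio k"
    unfolding ratio_def by (rule member_le_sum) (use assms in auto)
  then have "enn2real (stiff total k i) \<le> ratio k * enn2real (mass total k i)"
    using pos by (simp add: pos_divide_le_eq)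
  then have "ennreal (enn2real (stiff total k i)) \<le> ennreal (ratio k) * ennreal (enn2real (mass total k i))"
    using ratio_nonneg by (simp add: ennreal_mult[symmetric] ennreal_leI)
  then show ?thesis using m s by simp
qed

lemma rayleigh_comb_le:
  assumes "i \<le> k" "c i \<noteq> 0"
  shows "rayleigh_quotient g (lift (comb k c)) \<le> ennreal (orbit_bound * ratio k)"
proof -
  interpret transplant g i1 i2 "comb k c" "comb' k c" "width total k" by (rule transplant_comb)
  let ?I = "\<integral>\<^sup>+ y. ennreal ((comb k c y)\<^sup>2) \<partial>lborel" and ?J = "\<integral>\<^sup>+ y. ennreal ((comb' k c y)\<^sup>2) \<partial>lborel"
  have "?J \<le> (\<Sum>i\<le>k. ennreal ((c i)\<^sup>2) * (ennreal (ratio k) * mass total k i))"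
    unfolding nn_integral_comb by (intro sum_mono mult_left_mono stiff_le) auto
  also have "\<dots> = ennreal (ratio k) * ?I"
    unfolding nn_integral_comb by (simp add: sum_distrib_left ac_simps)
  finally have J: "?J \<le> ennreal (ratio k) * ?I" .
  have "dirichlet_energy g \<phi> \<le> ennreal ball_const * (ennreal orbit_bound * ?J)"
    by (rule dirichlet_energy_le[OF comb_finite(2)])
  also have "\<dots> \<le> ennreal ball_const * (ennreal orbit_bound * (ennreal (ratio k) * ?I))"
    by (intro mult_left_mono J) auto
  also have "\<dots> = ennreal (orbit_bound * ratio k) * (ennreal ball_const * ?I)"
    using orbit_bound_pos ratio_nonneg by (simp add: ennreal_mult ac_simps)
  finally have e: "dirichlet_energy g \<phi> \<le> ennreal (orbit_bound * ratio k) * (ennreal ball_const * ?I)" .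
  \<comment> \<open>In the extended nonnegative reals a factor cancels in a quotient only if it is
    neither 0 nor \<open>top\<close>.\<close>
  have nz: "ennreal ball_const * ?I \<noteq> 0" "ennreal ball_const * ?I \<noteq> top"
    using comb_mass_pos[where c = c, OF assms(1) assms(2)] comb_finite(1)[of k c] ball_const_pos
    by (auto simp: ennreal_mult_eq_top_iff)
  have "rayleigh_quotient g \<phi> \<le> ennreal (orbit_bound * ratio k) * (ennreal ball_const * ?I) / (ennreal ball_const * ?I)"
    unfolding rayleigh_quotient_def L2_norm by (rule divide_right_mono_ennreal[OF e])
  also have "\<dots> = ennreal (orbit_bound * ratio k)"
    by (rule ennreal_mult_divide_eq) (use nz in auto)
  finally show ?thesis unfolding transplant_\<phi> .
qed

text \<open>A combination that vanishes almost everywhere has L2 norm zero, and by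
  \<open>comb_mass_pos\<close> a nonzero coefficient would make that norm positive.\<close>

lemma lift_tst_basis: "invariant_basis g k (\<lambda>i. lift (tst total k i))"
  unfolding invariant_basis_def
proof (intro conjI allI impI)
  fix i assume i: "i \<le> k"
  \<comment> \<open>A single basis function is treated as the combination with unit coefficients, so
    that \<open>transplant_comb\<close> serves for it as well.\<close>
  interpret transplant g i1 i2 "comb k (\<lambda>j. if j = i then 1 else 0)" "comb' k (\<lambda>j. if j = i then 1 else 0)"
    "width total k" by (rule transplant_comb)
  show "lift (tst total k i) \<in> W12_invariant g"
    using \<phi>_W12_invariant[OF comb_finite(2,1)] unfolding transplant_\<phi> unfolding comb_unit[OF i] .
next
  fix c :: "nat \<Rightarrow> real" and i
  assume ae: "AE p in vol g. (\<Sum>i\<le>k. c i * lift (tst total k i) p) = 0" and i: "i \<le> k"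
  interpret transplant g i1 i2 "comb k c" "comb' k c" "width total k" by (rule transplant_comb)
  have "(\<integral>\<^sup>+ p. ennreal ((\<phi> p)\<^sup>2) \<partial>vol g) = (\<integral>\<^sup>+ p. 0 \<partial>vol g)"
    by (rule nn_integral_cong_AE) (use ae in \<open>simp add: transplant_\<phi> lift_comb\<close>)
  then have "(\<integral>\<^sup>+ y. ennreal ((comb k c y)\<^sup>2) \<partial>lborel) = 0"
    unfolding L2_norm using ball_const_pos by simp
  then show "c i = 0" using comb_mass_pos[OF i, of c] by auto
qed

lemma invariant_eigenvalue_le: "invariant_eigenvalue g k \<le> ennreal (orbit_bound * ratio k)"
proof -
  have "invariant_eigenvalue g k \<le> (SUP c \<in> {c. \<exists>i\<le>k. c i \<noteq> 0}.
      rayleigh_quotient g (\<lambda>p. \<Sum>i\<le>k. c i * lift (tst total k i) p))"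
    unfolding invariant_eigenvalue_def by (rule INF_lower) (simp add: lift_tst_basis)
  also have "\<dots> \<le> ennreal (orbit_bound * ratio k)"
    by (rule SUP_least) (use rayleigh_comb_le in \<open>auto simp: lift_comb[abs_def, symmetric]\<close>)
  finally show ?thesis .
qed

end

theorem theorem2:
  assumes "CARD('n::finite) \<ge> 2"
  shows "\<exists>D :: nat \<Rightarrow> real. (\<forall>k\<ge>1. D k > 0) \<and>
    (\<forall>g :: 'n metric_field.
       riemannian_metric g \<and> so_invariant_metric g \<and>
       emeasure (vol g) unit_sphere = 1 \<and> nonneg_scalar_curvature g \<longrightarrow>
       (\<forall>k\<ge>1. invariant_eigenvalue g k \<le> ennreal (D k)))"
proof -
  obtain i1 i2 :: 'n where i12: "i1 \<noteq> i2"
    using assms card_le_Suc0_iff_eq[of "UNIV :: 'n set"] by fastforce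
  \<comment> \<open>\<open>Y\<close>, \<open>M\<close> and \<open>K k\<close> are
    \<open>total\<close>, \<open>orbit_bound\<close> and \<open>ratio k\<close> spelled out without
    the metric, since the constants have to be chosen before \<open>g\<close>.\<close>
  define Y where "Y = 1 / (CARD('n) * unit_ball_vol CARD('n))"
  define M where "M = max 1 (1 / unit_ball_vol CARD('n)) ^ (2 * (CARD('n) - 1))"
  define K where "K k = (\<Sum>i\<le>k. enn2real (stiff Y k i) / enn2real (mass Y k i))" for k
  have K: "0 \<le> K k" for k unfolding K_def by (intro sum_nonneg divide_nonneg_nonneg) auto
  have M: "0 < M" unfolding M_def by (rule zero_less_power) auto
  \<comment> \<open>The summand 1 makes the constant positive, as only \<open>0 \<le> K k\<close> is
    at hand.\<close>
  have "invariant_eigenvalue g k \<le> ennreal (M * K k + 1)"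
    if g: "riemannian_metric g" "so_invariant_metric g" "emeasure (vol g) unit_sphere = 1" "nonneg_scalar_curvature g"
    for g :: "'n metric_field" and k
  proof -
    interpret unit_volume_metric g i1 i2 by unfold_locales (use g i12 in auto)
    have "invariant_eigenvalue g k \<le> ennreal (M * K k)"
      using invariant_eigenvalue_le[of k]
      unfolding orbit_bound_def ratio_def total_def ball_const_def Y_def[symmetric] M_def[symmetric] K_def[symmetric] .
    also have "\<dots> \<le> ennreal (M * K k + 1)" by (rule ennreal_leI) simp
    finally show ?thesis .
  qed
  moreover have "0 < M * K k + 1" for k using K[of k] M by (simp add: add_nonneg_pos)
  ultimately show ?thesis by (intro exI[of _ "\<lambda>k. M * K k + 1"]) auto
qed

end
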